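(* Consider the distributed stochastic gradient tracking method described in the context, under the assumptions on the stochastic gradients, the network and the cost functions stated there, with $0<\rho_w<1$. Let $\Gamma>1$ and suppose the constant step size $\alpha>0$ satisfies $$\alpha\le \min\left\{\frac{1-\rho_w^2}{12\rho_w^2 L},\ \frac{(1-\rho_w^2)^2}{2\sqrt{\Gamma}\,L\max\{6\rho_w\|W-I\|,\,1-\rho_w^2\}},\ \frac{1-\rho_w^2}{3\rho_w^{2/3}L}\left[\frac{\mu^2}{L^2}\frac{\Gamma-1}{\Gamma(\Gamma+1)}\right]^{1/3}\right\}.$$ Put $\beta=\frac{1-\rho_w^2}{2\rho_w^2}-4\alpha L-2\alpha^2L^2$, $$A=\begin{bmatrix}1-\alpha\mu & \frac{\alpha L^2}{\mu n}(1+\alpha\mu) & 0\\ 0 & \frac12(1+\rho_w^2) & \alpha^2\frac{(1+\rho_w^2)\rho_w^2}{1-\rho_w^2}\\ 2\alpha nL^3 & \left(\frac1\beta+2\right)\|W-I\|^2L^2+3\alpha L^3 & \frac12(1+\rho_w^2)\end{bmatrix},$$ let $\rho_A$ be the spectral radius of $A$, and let $M_\sigma=\left[3\alpha^2L^2+2(\alpha L+1)(n+1)\right]\sigma^2$. Define $$R_1=\frac{\Gamma+1}{\Gamma}\frac{\alpha\sigma^2}{\mu n}+\left(\frac{\Gamma+1}{\Gamma-1}\right)\frac{4\alpha^2L^2(1+\alpha\mu)(1+\rho_w^2)\rho_w^2}{\mu^2n(1-\rho_w^2)^3}M_\sigma,$$ $$R_2=\left(\frac{\Gamma+1}{\Gamma-1}\right)\frac{4\alpha^2(1+\rho_w^2)\rho_w^2\,(2\alpha^2L^3\sigma^2+\mu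 M_\sigma)}{\mu(1-\rho_w^2)^3}.$$ Then $\rho_A<1$, and both $\sup_{l\ge k}\mathbb{E}[\|\overline{x}_l-x^*\|^2]$ and $\sup_{l\ge k}\mathbb{E}[\|\mathbf{x}_{l+1}-\mathbf{1}\overline{x}_{l+1}\|^2]$ converge to a neighborhood of $0$ at the linear rate $\mathcal{O}(\rho_A^k)$; that is, there is a constant $C>0$ (independent of $k$) such that for all $k\ge 0$ $$\sup_{l\ge k}\mathbb{E}[\|\overline{x}_l-x^*\|^2]\le R_1+C\rho_A^k,\qquad \sup_{l\ge k}\mathbb{E}[\|\mathbf{x}_{l+1}-\mathbf{1}\overline{x}_{l+1}\|^2]\le R_2+C\rho_A^k.$$ Furthermore, $$\limsup_{k\to\infty}\mathbb{E}[\|\overline{x}_k-x^*\|^2]\le R_1,\qquad \limsup_{k\to\infty}\mathbb{E}[\|\mathbf{x}_k-\mathbf{1}\overline{x}_k\|^2]\le R_2.$$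
   Context: Setting. There are $n$ agents $\mathcal{N}=\{1,\dots,n\}$; agent $i$ has a differentiable cost function $f_i:\mathbb{R}^p\to\mathbb{R}$, and $f(x)=\frac1n\sum_{i=1}^n f_i(x)$. Elements of $\mathbb{R}^p$ and of $\mathbb{R}^{1\times p}$ (row vectors) are identified when convenient. $\|\cdot\|$ is the Euclidean norm for vectors and the Frobenius norm for matrices; $\mathbf{1}$ is the all-ones column vector. Cost functions. There are $\mu>0$ and $L>0$ such that for all $i$ and all $x,x'\in\mathbb{R}^p$: $\langle\nabla f_i(x)-\nabla f_i(x'),x-x'\rangle\ge\mu\|x-x'\|^2$ and $\|\nabla f_i(x)-\nabla f_i(x')\|\le L\|x-x'\|$. Then $f$ has a unique minimizer, denoted $x^*$. Stochastic gradients. For each $i$, agent $i$ has access to samples $g_i(x,\xi_i)$, with $\xi_i\in\mathbb{R}^m$ a random vector, such that for every $x\in\mathbb{R}^p$, $\mathbb{E}_{\xi_i}[g_i(x,\xi_i)\mid x]=\nabla f_i(x)$ and $\mathbb{E}_{\xi_i}[\|g_i(x,\xi_i)-\nabla f_i(x)\|^2\mid x]\le\sigma^2$, for some $\sigma>0$. The random vectors $\xi_{i,k}$ (agent $i$, time $k$) used by the algorithm are independent over all $i$ and $k$, $\xi_{i,k}$ being a sample of $\xi_i$. Network. $W=[w_{ij}]\in\mathbb{R}^{n\times n}$ is nonnegative with $w_{ij}=w_{ji}$; for $i\neq j$, $w_{ij}>0$ iff $i,j$ are adjacent in an undirected connected graph on $\mathcal{N}$; $W\mathbf{1}=\mathbf{1}$,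 $\mathbf{1}^{\top}W=\mathbf{1}^{\top}$; and $w_{ii}>0$ for some $i$. $\rho_w$ denotes the spectral norm of $W-\frac1n\mathbf{1}\mathbf{1}^{\top}$ (under these assumptions $\rho_w<1$). $I$ is the identity matrix. Algorithm. With constant step size $\alpha>0$, arbitrary initial points $x_{i,0}\in\mathbb{R}^p$ and $y_{i,0}=g_i(x_{i,0},\xi_{i,0})$, for $k=0,1,2,\dots$ and all $i\in\mathcal{N}$: $$x_{i,k+1}=\sum_{j=1}^n w_{ij}(x_{j,k}-\alpha y_{j,k}),\qquad y_{i,k+1}=\sum_{j=1}^n w_{ij}y_{j,k}+g_i(x_{i,k+1},\xi_{i,k+1})-g_i(x_{i,k},\xi_{i,k}).$$ $\mathbf{x}_k\in\mathbb{R}^{n\times p}$ is the matrix whose $i$-th row is $x_{i,k}^{\top}$, and $\overline{x}_k=\frac1n\mathbf{1}^{\top}\mathbf{x}_k\in\mathbb{R}^{1\times p}$. *)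

theory Defs
  imports
    "HOL-Probability.Probability"
    "Jordan_Normal_Form.Spectral_Radius"
begin

(* Both HOL-Analysis and Jordan_Normal_Form use these infixes; the HOL-Analysis reading is kept. *)
no_notation Matrix.vec_index (infixl \<open>$\<close> 100)
no_notation Matrix.scalar_prod (infix \<open>\<bullet>\<close> 70)

definition avg_cost :: "('n::finite \<Rightarrow> 'v \<Rightarrow> real) \<Rightarrow> 'v \<Rightarrow> real" where
  "avg_cost f x = (1 / real CARD('n)) * (\<Sum>i\<in>UNIV. f i x)"

definition minimizer :: "('n::finite \<Rightarrow> 'v \<Rightarrow> real) \<Rightarrow> 'v" where
  "minimizer f = arg_min (avg_cost f) (\<lambda>_. True)"

definition connected_graph :: "('n \<times> 'n) set \<Rightarrow> bool" where
  "connected_graph E \<longleftrightarrow> sym E \<and> irrefl E \<and> (\<forall>i j. (i, j) \<in> E\<^sup>*)"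

(* 1 :: real^'n is the all-ones vector; the diagonal of W is not tied to the graph. *)
definition mixing_matrix :: "('n::finite \<times> 'n) set \<Rightarrow> real^'n^'n \<Rightarrow> bool" where
  "mixing_matrix E W \<longleftrightarrow>
     (\<forall>i j. 0 \<le> W $ i $ j) \<and>
     (\<forall>i j. W $ i $ j = W $ j $ i) \<and>
     (\<forall>i j. i \<noteq> j \<longrightarrow> (0 < W $ i $ j \<longleftrightarrow> (i, j) \<in> E)) \<and>
     W *v 1 = 1 \<and> 1 v* W = 1 \<and>
     (\<exists>i. 0 < W $ i $ i)"

(* The operator norm induced by the Euclidean norm, i.e. the spectral norm, of W - 1 1^T / n. *)
definition rho_w :: "real^'n::finite^'n \<Rightarrow> real" where
  "rho_w W = onorm ((*v) (W - (\<chi> i j. 1 / real CARD('n))))"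

(* norm on real^'n^'n is the Frobenius norm. *)
definition dist_id :: "real^'n::finite^'n \<Rightarrow> real" where
  "dist_id W = norm (W - Finite_Cartesian_Product.mat 1)"

definition row_avg :: "real^'p::finite^'n::finite \<Rightarrow> real^'p" where
  "row_avg X = (1 / real CARD('n)) *\<^sub>R (1 v* X)"

definition consensus_error :: "real^'p::finite^'n::finite \<Rightarrow> real^'p^'n" where
  "consensus_error X = X - (\<chi> i. row_avg X)"

(* D i is the law of xi_i. *)
definition stochastic_oracle ::
  "('n \<Rightarrow> (real^'m::finite) measure) \<Rightarrow> ('n \<Rightarrow> real^'p::finite \<Rightarrow> real^'m \<Rightarrow> real^'p)
    \<Rightarrow> ('n \<Rightarrow> real^'p \<Rightarrow> real^'p) \<Rightarrow> real \<Rightarrow> bool" where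
  "stochastic_oracle D g grad \<sigma> \<longleftrightarrow>
     (\<forall>i. prob_space (D i) \<and> sets (D i) = sets borel \<and>
        (\<lambda>(x, z). g i x z) \<in> borel_measurable (borel \<Otimes>\<^sub>M borel) \<and>
        (\<forall>x. integrable (D i) (g i x) \<and> (\<integral>z. g i x z \<partial>D i) = grad i x \<and>
             (\<integral>\<^sup>+z. ennreal ((norm (g i x z - grad i x))\<^sup>2) \<partial>D i) \<le> ennreal (\<sigma>\<^sup>2)))"

(* Pathwise recursion: z i k is the realized sample of agent i at time k; the result is
   (x_k, y_k), whose i-th rows are x_{i,k} and y_{i,k}. *)
primrec dsgt ::
  "real^'n^'n \<Rightarrow> ('n::finite \<Rightarrow> real^'p::finite \<Rightarrow> real^'m \<Rightarrow> real^'p) \<Rightarrow> real \<Rightarrow> real^'p^'n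
    \<Rightarrow> ('n \<Rightarrow> nat \<Rightarrow> real^'m) \<Rightarrow> nat \<Rightarrow> (real^'p^'n) \<times> (real^'p^'n)" where
  "dsgt W g \<alpha> x0 z 0 = (x0, \<chi> i. g i (x0 $ i) (z i 0))"
| "dsgt W g \<alpha> x0 z (Suc k) =
     (let (x, y) = dsgt W g \<alpha> x0 z k;
          x' = (\<chi> i. \<Sum>j\<in>UNIV. W $ i $ j *\<^sub>R (x $ j - \<alpha> *\<^sub>R y $ j));
          y' = (\<chi> i. (\<Sum>j\<in>UNIV. W $ i $ j *\<^sub>R y $ j)
                      + g i (x' $ i) (z i (Suc k)) - g i (x $ i) (z i k))
      in (x', y'))"

(* In the following, rw stands for rho_w, d for the Frobenius norm of W - I, and n for the
   number of agents. *)

definition step_bound :: "real \<Rightarrow> real \<Rightarrow> real \<Rightarrow> real \<Rightarrow> real \<Rightarrow> real" where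
  "step_bound \<mu> L rw d \<Gamma> = Min
     {(1 - rw\<^sup>2) / (12 * rw\<^sup>2 * L),
      (1 - rw\<^sup>2)\<^sup>2 / (2 * sqrt \<Gamma> * L * max (6 * rw * d) (1 - rw\<^sup>2)),
      (1 - rw\<^sup>2) / (3 * (rw powr (2/3)) * L)
        * ((\<mu>\<^sup>2 / L\<^sup>2) * ((\<Gamma> - 1) / (\<Gamma> * (\<Gamma> + 1)))) powr (1/3)}"

definition beta :: "real \<Rightarrow> real \<Rightarrow> real \<Rightarrow> real" where
  "beta L rw \<alpha> = (1 - rw\<^sup>2) / (2 * rw\<^sup>2) - 4 * \<alpha> * L - 2 * \<alpha>\<^sup>2 * L\<^sup>2"

definition A_mat :: "real \<Rightarrow> real \<Rightarrow> real \<Rightarrow> real \<Rightarrow> real \<Rightarrow> real \<Rightarrow> real mat" where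
  "A_mat n \<mu> L rw d \<alpha> = mat_of_rows_list 3
     [[1 - \<alpha> * \<mu>, (\<alpha> * L\<^sup>2 / (\<mu> * n)) * (1 + \<alpha> * \<mu>), 0],
      [0, (1/2) * (1 + rw\<^sup>2), \<alpha>\<^sup>2 * ((1 + rw\<^sup>2) * rw\<^sup>2 / (1 - rw\<^sup>2))],
      [2 * \<alpha> * n * L^3, (1 / beta L rw \<alpha> + 2) * d\<^sup>2 * L\<^sup>2 + 3 * \<alpha> * L^3, (1/2) * (1 + rw\<^sup>2)]]"

definition rho_A :: "real \<Rightarrow> real \<Rightarrow> real \<Rightarrow> real \<Rightarrow> real \<Rightarrow> real \<Rightarrow> real" where
  "rho_A n \<mu> L rw d \<alpha> = spectral_radius (map_mat complex_of_real (A_mat n \<mu> L rw d \<alpha>))"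

definition M_sigma :: "real \<Rightarrow> real \<Rightarrow> real \<Rightarrow> real \<Rightarrow> real" where
  "M_sigma n L \<alpha> \<sigma> = (3 * \<alpha>\<^sup>2 * L\<^sup>2 + 2 * (\<alpha> * L + 1) * (n + 1)) * \<sigma>\<^sup>2"

definition R1 :: "real \<Rightarrow> real \<Rightarrow> real \<Rightarrow> real \<Rightarrow> real \<Rightarrow> real \<Rightarrow> real \<Rightarrow> real" where
  "R1 n \<mu> L rw \<alpha> \<sigma> \<Gamma> =
     ((\<Gamma> + 1) / \<Gamma>) * (\<alpha> * \<sigma>\<^sup>2 / (\<mu> * n))
     + ((\<Gamma> + 1) / (\<Gamma> - 1))
       * (4 * \<alpha>\<^sup>2 * L\<^sup>2 * (1 + \<alpha> * \<mu>) * (1 + rw\<^sup>2) * rw\<^sup>2 / (\<mu>\<^sup>2 * n * (1 - rw\<^sup>2)^3))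
       * M_sigma n L \<alpha> \<sigma>"

definition R2 :: "real \<Rightarrow> real \<Rightarrow> real \<Rightarrow> real \<Rightarrow> real \<Rightarrow> real \<Rightarrow> real \<Rightarrow> real" where
  "R2 n \<mu> L rw \<alpha> \<sigma> \<Gamma> =
     ((\<Gamma> + 1) / (\<Gamma> - 1))
     * (4 * \<alpha>\<^sup>2 * (1 + rw\<^sup>2) * rw\<^sup>2 * (2 * \<alpha>\<^sup>2 * L^3 * \<sigma>\<^sup>2 + \<mu> * M_sigma n L \<alpha> \<sigma>)
        / (\<mu> * (1 - rw\<^sup>2)^3))"

end

theory Submission
  imports Defs
begin

text \<open>
  Let \<open>v\<^sub>k\<close> be the vector of the three expected squared errors: distance of the average iterate to
  the minimizer, consensus error of the iterates, consensus error of the gradient trackers. The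
  assumptions give \<open>v\<^sub>k\<^sub>+\<^sub>1 \<le> A v\<^sub>k + e\<close> componentwise with the nonnegative matrix \<open>A\<close> of the
  statement. The step size bound makes the characteristic polynomial of \<open>A\<close> positive at \<open>1\<close>, and it is
  negative at the largest root of its cofactor, so \<open>A\<close> has an eigenvalue \<open>\<kappa> < 1\<close> with a positive
  eigenvector \<open>w\<close>; such an eigenvalue is the spectral radius. If \<open>s = A s + e\<close> then
  \<open>v\<^sub>k \<le> s + C \<kappa>\<^sup>k w\<close> by monotonicity of \<open>A\<close>, and Cramer's rule bounds the first two entries of \<open>s\<close>
  by \<open>R\<^sub>1\<close> and \<open>R\<^sub>2\<close>.

  For the recursion the samples are moved to the infinite product of their laws, where a single
  coordinate can be resampled independently. The noise of agent \<open>i\<close> at time \<open>k\<close> is therefore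
  orthogonal to every square integrable function that ignores the coordinate \<open>(i, k)\<close>.
\<close>

section \<open>The three-dimensional comparison system\<close>

text \<open>The obstacle is that every sample is used twice. The sample of agent i at time k enters
  y_k, through it x_{k+1}, and is subtracted again in y_{k+1}. The old noise is therefore correlated
  with the mixed tracker and with the new gradients, and two cross terms of the tracking recursion
  do not vanish. They are only bounded from below, by -\<sigma>^2 and -\<alpha> L n \<sigma>^2;
  together with the second moments of the old and the new noise these feed \<open>M_sigma\<close>.
  The entries of A come from one weighted inequality for (a + b)^2 with a different weight in each
  row: \<alpha>\<mu> in the first, (1 - \<rho>^2) / (2 \<rho>^2) in the second. In the third it is
  \<open>beta\<close>, the weight that leaves exactly (1 + \<rho>^2) / 2 on the tracking error once
  all other contributions are added. Of the three step size bounds, the first is aimed at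
  \<open>beta\<close>, the second at the feedback between the two consensus errors, the third at the
  loop through all three errors. The parameter \<Gamma> fixes how much of det(I - A) these loops may
  consume, and its reciprocal share reappears in \<open>R1\<close> and \<open>R2\<close>.\<close>

lemma spectral_radius_eq_positive_eigenvalue:
  fixes A :: "real mat"
  assumes A: "A \<in> carrier_mat m m" and m: "0 < m"
    and nonneg: "\<And>i j. i < m \<Longrightarrow> j < m \<Longrightarrow> 0 \<le> A $$ (i, j)"
    and w: "\<And>i. i < m \<Longrightarrow> 0 < w i"
    and ev: "\<And>i. i < m \<Longrightarrow> (\<Sum>j<m. A $$ (i, j) * w j) = \<kappa> * w i"
  shows "spectral_radius (map_mat complex_of_real A) = \<kappa>"
proof -
  let ?B = "map_mat complex_of_real A"
  have B: "?B \<in> carrier_mat m m" using A by simp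
  have mult: "Matrix.vec_index (?B *\<^sub>v v) i = (\<Sum>j<m. of_real (A $$ (i, j)) * Matrix.vec_index v j)"
    if "i < m" "v \<in> carrier_vec m" for i v
    using that A by (auto simp: scalar_prod_def lessThan_atLeast0 intro!: sum.cong)
  have "0 \<le> \<kappa> * w 0"
    unfolding ev[OF m, symmetric]
    using w nonneg m by (intro sum_nonneg mult_nonneg_nonneg) (auto intro: less_imp_le)
  with w[OF m] have lam: "0 \<le> \<kappa>" by (simp add: zero_le_mult_iff)
  have upper: "norm k \<le> \<kappa>" if "k \<in> spectrum ?B" for k
  proof -
    from that obtain v where v: "v \<in> carrier_vec m" "v \<noteq> 0\<^sub>v m" "?B *\<^sub>v v = k \<cdot>\<^sub>v v"
      unfolding spectrum_def eigenvalue_def eigenvector_def using A by auto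
    \<comment> \<open>\<open>c\<close> compares the complex eigenvector with the positive one
      entrywise. At the index \<open>l\<close> of the largest ratio, row \<open>l\<close> of the
      eigenvalue equation bounds the modulus of \<open>k\<close> by \<kappa>.\<close>
    define c where "c i = norm (Matrix.vec_index v i) / w i" for i
    obtain l where l: "l < m" "\<And>i. i < m \<Longrightarrow> c i \<le> c l"
    proof -
      have "Max (c ` {..<m}) \<in> c ` {..<m}" using m by (intro Max_in) auto
      then obtain l where "l < m" "c l = Max (c ` {..<m})" by auto
      then show ?thesis using that[of l] by auto
    qed
    have "c l > 0"
    proof -
      obtain i where "i < m" "Matrix.vec_index v i \<noteq> 0"
        using v by (metis carrier_vecD eq_vecI index_zero_vec(1) zero_carrier_vec)
      then have "0 < c i" using w by (auto simp: c_def)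
      then show ?thesis using l(2)[of i] \<open>i < m\<close> by linarith
    qed
    have "norm k * (c l * w l) = norm (k * Matrix.vec_index v l)"
      using w[OF l(1)] by (simp add: c_def norm_mult)
    also have "k * Matrix.vec_index v l = (\<Sum>j<m. of_real (A $$ (l, j)) * Matrix.vec_index v j)"
      using mult[OF l(1) v(1)] v l(1) by simp
    also have "norm \<dots> \<le> (\<Sum>j<m. A $$ (l, j) * (c l * w j))"
    proof (intro order_trans[OF norm_sum] sum_mono)
      fix j assume j: "j \<in> {..<m}"
      then have "norm (Matrix.vec_index v j) \<le> c l * w j"
        using l(2)[of j] w[of j] by (simp add: c_def field_simps)
      then show "norm (of_real (A $$ (l, j)) * Matrix.vec_index v j) \<le> A $$ (l, j) * (c l * w j)"
        using nonneg[OF l(1), of j] j by (simp add: norm_mult mult_left_mono)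
    qed
    also have "\<dots> = c l * (\<Sum>j<m. A $$ (l, j) * w j)"
      by (simp add: sum_distrib_left mult_ac)
    also have "\<dots> = \<kappa> * (c l * w l)"
      by (simp add: ev[OF l(1)])
    finally show ?thesis
      using \<open>c l > 0\<close> w[OF l(1)] by (simp add: mult_le_cancel_right)
  qed
  have "complex_of_real \<kappa> \<in> spectrum ?B"
  proof -
    define v where "v = Matrix.vec m (\<lambda>i. complex_of_real (w i))"
    have v: "v \<in> carrier_vec m" by (simp add: v_def)
    have "Matrix.vec_index v 0 \<noteq> 0" using w[OF m] m by (simp add: v_def)
    then have "v \<noteq> 0\<^sub>v m" using m by auto
    moreover have "?B *\<^sub>v v = complex_of_real \<kappa> \<cdot>\<^sub>v v"
    proof (rule eq_vecI)
      fix i assume "i < dim_vec (complex_of_real \<kappa> \<cdot>\<^sub>v v)"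
      then have i: "i < m" by (simp add: v_def)
      have "Matrix.vec_index (?B *\<^sub>v v) i = (\<Sum>j<m. of_real (A $$ (i, j)) * of_real (w j))"
        unfolding mult[OF i v] by (simp add: v_def)
      also have "\<dots> = of_real (\<kappa> * w i)"
        unfolding ev[OF i, symmetric] by simp
      finally show "Matrix.vec_index (?B *\<^sub>v v) i = Matrix.vec_index (complex_of_real \<kappa> \<cdot>\<^sub>v v) i"
        using i by (simp add: v_def)
    qed (use A in \<open>auto simp: v_def\<close>)
    ultimately show ?thesis
      unfolding spectrum_def eigenvalue_def eigenvector_def using A v by auto
  qed
  then have "norm (complex_of_real \<kappa>) \<le> spectral_radius ?B"
    by (intro spectral_radius_mem_max(2)[OF B m]) blast
  moreover have "spectral_radius ?B \<le> \<kappa>"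
    using spectral_radius_mem_max(1)[OF B m] upper by auto
  ultimately show ?thesis using lam by simp
qed

text \<open>The polynomial \<open>P\<close> below is det(xI - A) for the matrix with rows (a, p, 0),
  (0, b, q), (r, s, b), and \<open>det\<close> says \<open>P 1 > 0\<close>. The intermediate value
  theorem is started at \<open>m\<close> rather than at \<open>a\<close> or \<open>b\<close> so that
  the root exceeds both, which makes the eigenvector positive.\<close>

lemma positive_eigenvector_3:
  fixes a b p q r s :: real
  assumes "a < 1" "b < 1" "0 < p" "0 < q" "0 < r" "0 \<le> s"
    and det: "p * q * r < (1 - a) * ((1 - b)\<^sup>2 - q * s)"
  obtains \<kappa> w1 w2 w3 where "a < \<kappa>" "b < \<kappa>" "\<kappa> < 1" "0 < w1" "0 < w2" "0 < w3"
    "a * w1 + p * w2 = \<kappa> * w1" "b * w2 + q * w3 = \<kappa> * w2" "r * w1 + s * w2 + b * w3 = \<kappa> * w3"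
proof -
  define P where "P x = (x - a) * ((x - b)\<^sup>2 - q * s) - p * q * r" for x
  define m where "m = max a (b + sqrt (q * s))"
  have qs: "0 \<le> q * s" using assms by simp
  have pqr: "0 < p * q * r" using assms by simp
  have "0 < (1 - a) * ((1 - b)\<^sup>2 - q * s)" using det pqr by linarith
  then have "q * s < (1 - b)\<^sup>2" using \<open>a < 1\<close> by (simp add: zero_less_mult_iff)
  then have "sqrt (q * s) < 1 - b" using \<open>b < 1\<close> by (intro real_less_lsqrt) auto
  then have m1: "m < 1" using \<open>a < 1\<close> by (simp add: m_def)
  have "(m - a) * ((m - b)\<^sup>2 - q * s) = 0" using qs by (auto simp: m_def max_def)
  then have "P m < 0" using pqr unfolding P_def by linarith
  moreover have "0 < P 1" using det by (simp add: P_def)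
  moreover have "continuous_on {m..1} P" unfolding P_def by (intro continuous_intros)
  ultimately obtain x where x: "m \<le> x" "x \<le> 1" "P x = 0"
    using IVT'[of P m 0 1] m1 by auto
  have x': "m < x" "x < 1"
    using x \<open>P m < 0\<close> \<open>0 < P 1\<close> by (auto simp: less_le)
  have "a < x" using x' by (auto simp: m_def)
  have "b < x" using x' qs by (smt (verit) m_def real_sqrt_ge_zero)
  \<comment> \<open>With third entry 1, the second row gives \<open>w2\<close> and the first row
    gives \<open>w1\<close>; the third row then amounts to \<open>P x = 0\<close>.\<close>
  define w2 where "w2 = q / (x - b)"
  define w1 where "w1 = p * w2 / (x - a)"
  show ?thesis
  proof (rule that[of x w1 w2 1])
    show "0 < w2" using \<open>b < x\<close> assms by (simp add: w2_def)
    then show "0 < w1" using \<open>a < x\<close> assms by (simp add: w1_def)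
    show "a * w1 + p * w2 = x * w1" using \<open>a < x\<close> by (simp add: w1_def field_simps)
    show "b * w2 + q * 1 = x * w2" using \<open>b < x\<close> by (simp add: w2_def field_simps)
    have "r * w1 + s * w2 = x - b"
    proof -
      have "(r * w1 + s * w2) * ((x - a) * (x - b)) = r * p * q + s * q * (x - a)"
      proof -
        have "w2 * (x - b) = q" "w1 * (x - a) = p * w2"
          using \<open>a < x\<close> \<open>b < x\<close> by (simp_all add: w1_def w2_def)
        have "(r * w1 + s * w2) * ((x - a) * (x - b)) = r * (w1 * (x - a)) * (x - b) + s * (w2 * (x - b)) * (x - a)"
          by (simp add: algebra_simps)
        also have "\<dots> = r * p * (w2 * (x - b)) + s * q * (x - a)"
          using \<open>w2 * (x - b) = q\<close> \<open>w1 * (x - a) = p * w2\<close> by simp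
        finally show ?thesis using \<open>w2 * (x - b) = q\<close> by simp
      qed
      also have "\<dots> = (x - b) * ((x - a) * (x - b))"
        using x(3) by (simp add: P_def power2_eq_square algebra_simps)
      finally show ?thesis using \<open>a < x\<close> \<open>b < x\<close> by simp
    qed
    then show "r * w1 + s * w2 + b * 1 = x * 1" by simp
  qed (use \<open>a < x\<close> \<open>b < x\<close> x' in auto)
qed

text \<open>Subtracting the fixed point removes the forcing terms, and a nonnegative matrix
  preserves domination by a multiple of its eigenvector. Hence the rate is exactly \<kappa>^k, with
  no polynomial factor and no diagonalisation.\<close>

lemma affine_recursion_3:
  fixes a b p q r s :: real and v1 v2 v3 :: "nat \<Rightarrow> real"
  assumes coeff: "0 \<le> a" "0 \<le> b" "0 \<le> p" "0 \<le> q" "0 \<le> r" "0 \<le> s"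
    and w: "0 < w1" "0 < w2" "0 < w3"
      "a * w1 + p * w2 = \<kappa> * w1" "b * w2 + q * w3 = \<kappa> * w2" "r * w1 + s * w2 + b * w3 = \<kappa> * w3"
    and fp: "a * s1 + p * s2 + e1 = s1" "b * s2 + q * s3 = s2" "r * s1 + s * s2 + b * s3 + e3 = s3"
    and rec: "\<And>k. v1 (Suc k) \<le> a * v1 k + p * v2 k + e1"
      "\<And>k. v2 (Suc k) \<le> b * v2 k + q * v3 k"
      "\<And>k. v3 (Suc k) \<le> r * v1 k + s * v2 k + b * v3 k + e3"
  obtains c where "0 < c" "\<And>k. v1 k \<le> s1 + c * \<kappa> ^ k" "\<And>k. v2 k \<le> s2 + c * \<kappa> ^ k"
proof -
  \<comment> \<open>The three quotients give domination at time 0; the entry 1 keeps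
    \<open>C\<close> positive when the start already lies below the fixed point.\<close>
  define C where "C = Max {(v1 0 - s1) / w1, (v2 0 - s2) / w2, (v3 0 - s3) / w3, 1}"
  have C: "(v1 0 - s1) / w1 \<le> C" "(v2 0 - s2) / w2 \<le> C" "(v3 0 - s3) / w3 \<le> C" "1 \<le> C"
    by (simp_all add: C_def)
  have "0 \<le> a * w1 + p * w2" using coeff w(1,2) by simp
  then have lam: "0 \<le> \<kappa>" using w(1,4) by (simp add: zero_le_mult_iff)
  have main: "v1 k \<le> s1 + C * \<kappa> ^ k * w1 \<and> v2 k \<le> s2 + C * \<kappa> ^ k * w2 \<and> v3 k \<le> s3 + C * \<kappa> ^ k * w3" for k
  proof (induction k)
    case 0
    show ?case using C w by (simp add: field_simps)
  next
    case (Suc k)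
    let ?D = "C * \<kappa> ^ k"
    have "v1 (Suc k) \<le> a * (s1 + ?D * w1) + p * (s2 + ?D * w2) + e1"
      using rec(1)[of k] mult_left_mono[OF conjunct1[OF Suc] coeff(1)]
        mult_left_mono[OF conjunct1[OF conjunct2[OF Suc]] coeff(3)] by linarith
    also have "\<dots> = (a * s1 + p * s2 + e1) + ?D * (a * w1 + p * w2)" by (simp add: algebra_simps)
    finally have 1: "v1 (Suc k) \<le> s1 + C * \<kappa> ^ Suc k * w1" unfolding w fp by (simp add: mult_ac)
    have "v2 (Suc k) \<le> b * (s2 + ?D * w2) + q * (s3 + ?D * w3)"
      using rec(2)[of k] mult_left_mono[OF conjunct1[OF conjunct2[OF Suc]] coeff(2)]
        mult_left_mono[OF conjunct2[OF conjunct2[OF Suc]] coeff(4)] by linarith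
    also have "\<dots> = (b * s2 + q * s3) + ?D * (b * w2 + q * w3)" by (simp add: algebra_simps)
    finally have 2: "v2 (Suc k) \<le> s2 + C * \<kappa> ^ Suc k * w2" unfolding w fp by (simp add: mult_ac)
    have "v3 (Suc k) \<le> r * (s1 + ?D * w1) + s * (s2 + ?D * w2) + b * (s3 + ?D * w3) + e3"
      using rec(3)[of k] mult_left_mono[OF conjunct1[OF Suc] coeff(5)]
        mult_left_mono[OF conjunct1[OF conjunct2[OF Suc]] coeff(6)]
        mult_left_mono[OF conjunct2[OF conjunct2[OF Suc]] coeff(2)] by linarith
    also have "\<dots> = (r * s1 + s * s2 + b * s3 + e3) + ?D * (r * w1 + s * w2 + b * w3)"
      by (simp add: algebra_simps)
    finally have 3: "v3 (Suc k) \<le> s3 + C * \<kappa> ^ Suc k * w3" unfolding w fp by (simp add: mult_ac)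
    from 1 2 3 show ?case by blast
  qed
  show ?thesis
  proof (rule that[of "C * max w1 w2"])
    show "0 < C * max w1 w2" using C(4) w by (auto simp: max_def)
    have D: "0 \<le> C * \<kappa> ^ k" for k using C(4) lam by simp
    show "v1 k \<le> s1 + C * max w1 w2 * \<kappa> ^ k" for k
      using main[of k] mult_left_mono[OF max.cobounded1[of w1 w2] D[of k]] by (simp add: mult_ac)
    show "v2 k \<le> s2 + C * max w1 w2 * \<kappa> ^ k" for k
      using main[of k] mult_left_mono[OF max.cobounded2[of w2 w1] D[of k]] by (simp add: mult_ac)
  qed
qed

text \<open>\<Delta> is det(I - A). Hypothesis \<open>qs\<close> gives T >= (\<Gamma> - 1) /
  \<Gamma> * B^2, and \<open>pqr\<close> lets the long loop use at most the share 1 / (\<Gamma> + 1)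
  of A T. So \<Delta> has two lower bounds: \<Gamma> / (\<Gamma> + 1) * A T, used for the
  \<open>e1\<close> part of \<open>s1\<close>, where T cancels, and (\<Gamma> - 1) / (\<Gamma> + 1)
  * A B^2, used for everything else.\<close>

lemma fixed_point_bound_3:
  fixes a b p q r s e1 e3 \<Gamma> :: real
  assumes "a < 1" "b < 1" "0 < p" "0 < q" "0 < r" "0 \<le> s" "0 \<le> e1" "0 \<le> e3" "1 < \<Gamma>"
    and qs: "q * s \<le> (1 - b)\<^sup>2 / \<Gamma>"
    and pqr: "p * q * r \<le> (1 - a) * (\<Gamma> - 1) / (\<Gamma> * (\<Gamma> + 1)) * (1 - b)\<^sup>2"
  obtains s1 s2 s3 where
    "a * s1 + p * s2 + e1 = s1" "b * s2 + q * s3 = s2" "r * s1 + s * s2 + b * s3 + e3 = s3"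
    "s1 \<le> (\<Gamma> + 1) / \<Gamma> * (e1 / (1 - a)) + (\<Gamma> + 1) / (\<Gamma> - 1) * (p * q * e3 / ((1 - a) * (1 - b)\<^sup>2))"
    "s2 \<le> (\<Gamma> + 1) / (\<Gamma> - 1) * (q * (r * e1 + (1 - a) * e3) / ((1 - a) * (1 - b)\<^sup>2))"
    "p * q * r < (1 - a) * ((1 - b)\<^sup>2 - q * s)"
proof -
  define A B T \<Delta> where "A = 1 - a" and "B = 1 - b" and "T = B\<^sup>2 - q * s" and "\<Delta> = A * T - p * q * r"
  have A: "0 < A" and B: "0 < B" using assms by (simp_all add: A_def B_def)
  have a: "a = 1 - A" and b: "b = 1 - B" by (simp_all add: A_def B_def)
  have T: "(\<Gamma> - 1) / \<Gamma> * B\<^sup>2 \<le> T"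
    using qs \<open>1 < \<Gamma>\<close> by (simp add: T_def B_def field_simps)
  have Tpos: "0 < T" using T \<open>1 < \<Gamma>\<close> B by (smt (verit) divide_pos_pos mult_pos_pos zero_less_power)
  have "p * q * r \<le> 1 / (\<Gamma> + 1) * A * ((\<Gamma> - 1) / \<Gamma> * B\<^sup>2)"
    using pqr \<open>1 < \<Gamma>\<close> by (simp add: A_def B_def field_simps)
  also have "\<dots> \<le> 1 / (\<Gamma> + 1) * A * T"
    using T A \<open>1 < \<Gamma>\<close> by (intro mult_left_mono) auto
  finally have 1: "\<Gamma> / (\<Gamma> + 1) * A * T \<le> \<Delta>"
    using \<open>1 < \<Gamma>\<close> by (simp add: \<Delta>_def field_simps)
  have "\<Gamma> / (\<Gamma> + 1) * A * ((\<Gamma> - 1) / \<Gamma> * B\<^sup>2) \<le> \<Gamma> / (\<Gamma> + 1) * A * T"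
    using T A \<open>1 < \<Gamma>\<close> by (intro mult_left_mono) auto
  moreover have "\<Gamma> / (\<Gamma> + 1) * A * ((\<Gamma> - 1) / \<Gamma> * B\<^sup>2) = (\<Gamma> - 1) / (\<Gamma> + 1) * (A * B\<^sup>2)"
    using \<open>1 < \<Gamma>\<close> by simp
  ultimately have 2: "(\<Gamma> - 1) / (\<Gamma> + 1) * (A * B\<^sup>2) \<le> \<Delta>"
    using 1 by linarith
  have dpos: "0 < \<Gamma> / (\<Gamma> + 1) * A * T" "0 < (\<Gamma> - 1) / (\<Gamma> + 1) * (A * B\<^sup>2)"
    using A B Tpos \<open>1 < \<Gamma>\<close> by simp_all
  have \<Delta>: "0 < \<Delta>" using dpos(1) 1 by linarith
  have bound: "x / \<Delta> \<le> (\<Gamma> + 1) / (\<Gamma> - 1) * (x / (A * B\<^sup>2))" if "0 \<le> x" for x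
  proof -
    have "x / \<Delta> \<le> x / ((\<Gamma> - 1) / (\<Gamma> + 1) * (A * B\<^sup>2))"
      by (rule divide_left_mono[OF 2 that mult_pos_pos[OF \<Delta> dpos(2)]])
    then show ?thesis by (simp add: mult_ac)
  qed
  \<comment> \<open>The witnesses are Cramer's quotients. The second equation has no forcing term,
    so \<open>s2\<close> and \<open>s3\<close> share the factor
    \<open>r * e1 + A * e3\<close>.\<close>
  show ?thesis
  proof (rule that[of "(e1 * T + p * q * e3) / \<Delta>" "q * (r * e1 + A * e3) / \<Delta>" "B * (r * e1 + A * e3) / \<Delta>"])
    show "a * ((e1 * T + p * q * e3) / \<Delta>) + p * (q * (r * e1 + A * e3) / \<Delta>) + e1 = (e1 * T + p * q * e3) / \<Delta>"
      unfolding a using \<Delta> by (simp add: field_simps) (simp add: \<Delta>_def algebra_simps)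
    show "b * (q * (r * e1 + A * e3) / \<Delta>) + q * (B * (r * e1 + A * e3) / \<Delta>) = q * (r * e1 + A * e3) / \<Delta>"
    proof -
      have "(1 - B) * (q * K / \<Delta>) + q * (B * K / \<Delta>) = q * K / \<Delta>" for K
        using \<Delta> by (simp add: field_simps)
      then show ?thesis unfolding b by blast
    qed
    show "r * ((e1 * T + p * q * e3) / \<Delta>) + s * (q * (r * e1 + A * e3) / \<Delta>) + b * (B * (r * e1 + A * e3) / \<Delta>) + e3
        = B * (r * e1 + A * e3) / \<Delta>"
      unfolding b using \<Delta> by (simp add: field_simps) (simp add: \<Delta>_def T_def power2_eq_square algebra_simps)
    have "e1 * T / \<Delta> \<le> e1 * T / (\<Gamma> / (\<Gamma> + 1) * A * T)"
      using \<open>0 \<le> e1\<close> Tpos by (intro divide_left_mono[OF 1 _ mult_pos_pos[OF \<Delta> dpos(1)]]) simp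
    also have "\<dots> = (\<Gamma> + 1) / \<Gamma> * (e1 / A)" using Tpos by (simp add: mult_ac)
    finally show "(e1 * T + p * q * e3) / \<Delta> \<le> (\<Gamma> + 1) / \<Gamma> * (e1 / (1 - a))
      + (\<Gamma> + 1) / (\<Gamma> - 1) * (p * q * e3 / ((1 - a) * (1 - b)\<^sup>2))"
      using bound[of "p * q * e3"] assms by (simp add: add_divide_distrib A_def B_def)
    show "q * (r * e1 + A * e3) / \<Delta> \<le> (\<Gamma> + 1) / (\<Gamma> - 1) * (q * (r * e1 + (1 - a) * e3) / ((1 - a) * (1 - b)\<^sup>2))"
      using bound[of "q * (r * e1 + A * e3)"] assms A by (simp add: A_def B_def)
    show "p * q * r < (1 - a) * ((1 - b)\<^sup>2 - q * s)" using \<Delta> by (simp add: \<Delta>_def A_def B_def T_def)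
  qed
qed

text \<open>In terms of t = rw^2 and z = \<alpha> L, the first bound reads z t <= (1 - t) / 12. The
  second is used through both arguments of its maximum \<open>m\<close>: \<open>1 - t\<close> yields
  z <= (1 - t) / 2 and 4 \<Gamma> z^2 <= (1 - t)^2, while \<open>6 * rw * d\<close> yields z^2 t d^2
  <= (1 - t)^4 / (144 \<Gamma>). The third, cubed, controls the product of the loop p, q, r.\<close>

lemma
  fixes \<mu> L rw d \<Gamma> \<alpha> :: real
  assumes \<mu>: "0 < \<mu>" and \<mu>L: "\<mu> \<le> L" and rw: "0 < rw" "rw < 1" and d: "0 \<le> d" and \<Gamma>: "1 < \<Gamma>" and \<alpha>: "0 < \<alpha>"
    and bound: "\<alpha> \<le> step_bound \<mu> L rw d \<Gamma>"
  shows step_bound_small: "\<alpha> * L \<le> 1 / 2"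
    and step_bound_beta: "0 < beta L rw \<alpha>"
    and step_bound_qs: "\<alpha>\<^sup>2 * ((1 + rw\<^sup>2) * rw\<^sup>2 / (1 - rw\<^sup>2)) * ((1 / beta L rw \<alpha> + 2) * d\<^sup>2 * L\<^sup>2 + 3 * \<alpha> * L^3)
        \<le> (1 - (1/2) * (1 + rw\<^sup>2))\<^sup>2 / \<Gamma>"
    and step_bound_pqr: "0 < n \<Longrightarrow> (\<alpha> * L\<^sup>2 / (\<mu> * n)) * (1 + \<alpha> * \<mu>) * (\<alpha>\<^sup>2 * ((1 + rw\<^sup>2) * rw\<^sup>2 / (1 - rw\<^sup>2))) * (2 * \<alpha> * n * L^3)
        \<le> (1 - (1 - \<alpha> * \<mu>)) * (\<Gamma> - 1) / (\<Gamma> * (\<Gamma> + 1)) * (1 - (1/2) * (1 + rw\<^sup>2))\<^sup>2"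
proof -
  define t z m where "t = rw\<^sup>2" and "z = \<alpha> * L" and "m = max (6 * rw * d) (1 - t)"
  have L: "0 < L" using \<mu> \<mu>L by simp
  have t: "0 < t" "t < 1" using rw by (simp_all add: t_def power_less_one_iff)
  have z: "0 < z" using \<alpha> L by (simp add: z_def)
  have m: "1 - t \<le> m" "6 * rw * d \<le> m" "0 < m" using t by (simp_all add: m_def)
  have b1: "\<alpha> \<le> (1 - t) / (12 * t * L)"
    and b2: "\<alpha> \<le> (1 - t)\<^sup>2 / (2 * sqrt \<Gamma> * L * m)"
    and b3: "\<alpha> \<le> (1 - t) / (3 * (rw powr (2/3)) * L) * ((\<mu>\<^sup>2 / L\<^sup>2) * ((\<Gamma> - 1) / (\<Gamma> * (\<Gamma> + 1)))) powr (1/3)"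
    using bound by (simp_all add: step_bound_def t_def m_def)
  have z1: "z * t \<le> (1 - t) / 12" using b1 L t by (simp add: z_def field_simps)
  have z2: "2 * sqrt \<Gamma> * (z * m) \<le> (1 - t)\<^sup>2" using b2 L m \<Gamma> by (simp add: z_def field_simps)
  have "(2 * sqrt \<Gamma> * (z * m))\<^sup>2 \<le> ((1 - t)\<^sup>2)\<^sup>2"
    using z2 z m \<Gamma> by (intro power_mono) auto
  then have zm: "4 * \<Gamma> * (z\<^sup>2 * m\<^sup>2) \<le> (1 - t)^4"
    using \<Gamma> by (simp add: power_mult_distrib)
  have "2 * sqrt \<Gamma> * z * (1 - t) \<le> 2 * sqrt \<Gamma> * z * m"
    using m z \<Gamma> by (intro mult_left_mono) auto
  also have "\<dots> \<le> (1 - t) * (1 - t)" using z2 by (simp add: power2_eq_square mult_ac)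
  finally have z3: "2 * sqrt \<Gamma> * z \<le> 1 - t" using t by (simp add: mult_le_cancel_right)
  have "1 \<le> sqrt \<Gamma>" using \<Gamma> by simp
  then have "2 * z * 1 \<le> 2 * z * sqrt \<Gamma>" using z by (intro mult_left_mono) auto
  then have z4: "2 * z \<le> 1 - t" using z3 by (simp add: mult_ac)
  have "(2 * sqrt \<Gamma> * z)\<^sup>2 \<le> (1 - t)\<^sup>2" using z3 z \<Gamma> by (intro power_mono) auto
  then have z5: "4 * \<Gamma> * z\<^sup>2 \<le> (1 - t)\<^sup>2" using \<Gamma> by (simp add: power_mult_distrib)
  show "\<alpha> * L \<le> 1 / 2" using z4 t by (simp add: z_def)

  define be where "be = beta L rw \<alpha>"
  have be_eq: "be = (1 - t) / (2 * t) - 4 * z - 2 * z\<^sup>2"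
    by (simp add: be_def beta_def t_def z_def power_mult_distrib mult_ac)
  have "2 * (z * t) * z \<le> 2 * ((1 - t) / 12) * ((1 - t) / 2)"
    using z1 z4 z t by (intro mult_mono) auto
  moreover have "2 * (z * t) * z = 2 * z\<^sup>2 * t" "2 * ((1 - t) / 12) * ((1 - t) / 2) = (1 - t)\<^sup>2 / 12"
    by (simp_all add: power2_eq_square)
  ultimately have zz: "2 * z\<^sup>2 * t \<le> (1 - t)\<^sup>2 / 12" by metis
  \<comment> \<open>Of the budget (1 - t) / 2, the linear term takes at most (1 - t) / 3 and the
    quadratic one at most (1 - t)^2 / 12. What remains has the factor 1 + t, which later cancels the
    same factor in the entry q.\<close>
  have "be * t = (1 - t) / 2 - 4 * (z * t) - 2 * z\<^sup>2 * t"
    using t by (simp add: be_eq field_simps)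
  also have "\<dots> \<ge> (1 - t) / 2 - (1 - t) / 3 - (1 - t)\<^sup>2 / 12" using z1 zz by linarith
  also have "(1 - t) / 2 - (1 - t) / 3 - (1 - t)\<^sup>2 / 12 = (1 - t) * (1 + t) / 12"
    by (simp add: power2_eq_square field_simps)
  finally have be: "(1 - t) * (1 + t) / (12 * t) \<le> be" using t by (simp add: field_simps)
  have be0: "0 < (1 - t) * (1 + t) / (12 * t)" using t by simp
  then show "0 < beta L rw \<alpha>" using be by (simp add: be_def)
  have "1 / be + 2 \<le> 1 / ((1 - t) * (1 + t) / (12 * t)) + 2"
    using be be0 by (intro add_right_mono divide_left_mono mult_pos_pos) auto
  also have "\<dots> = 12 * t / ((1 - t) * (1 + t)) + 2" by simp
  also have "\<dots> = (12 * t + 2 - 2 * t\<^sup>2) / ((1 - t) * (1 + t))"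
  proof -
    have D: "(1 - t) * (1 + t) \<noteq> 0" using t by simp
    have "12 * t + 2 - 2 * t\<^sup>2 = 12 * t + 2 * ((1 - t) * (1 + t))"
      by (simp add: power2_eq_square algebra_simps)
    then show ?thesis using D by (simp only: add_divide_distrib) simp
  qed
  finally have ibe: "1 / be + 2 \<le> (12 * t + 2 - 2 * t\<^sup>2) / ((1 - t) * (1 + t))"
    by simp
  have "\<alpha>\<^sup>2 * ((1 + t) * t / (1 - t)) * ((1 / be + 2) * d\<^sup>2 * L\<^sup>2 + 3 * \<alpha> * L^3)
    \<le> \<alpha>\<^sup>2 * ((1 + t) * t / (1 - t)) * ((12 * t + 2 - 2 * t\<^sup>2) / ((1 - t) * (1 + t)) * d\<^sup>2 * L\<^sup>2 + 3 * \<alpha> * L^3)"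
    using ibe t by (intro mult_left_mono add_right_mono mult_right_mono) auto
  \<comment> \<open>After the cancellation of 1 + t, the terms are regrouped into the products t d^2
    z^2, z t and z^2 that the step size bounds control.\<close>
  also have "\<dots> = (12 * t + 2 - 2 * t\<^sup>2) / (1 - t)\<^sup>2 * (z\<^sup>2 * (t * d\<^sup>2)) + 3 * (1 + t) / (1 - t) * (z * t) * z\<^sup>2"
  proof -
    have "(1 + t) * t / (1 - t) * ((12 * t + 2 - 2 * t\<^sup>2) / ((1 - t) * (1 + t))) = (12 * t + 2 - 2 * t\<^sup>2) / (1 - t)\<^sup>2 * t"
      using t by (simp add: power2_eq_square)
    from arg_cong[OF this, of "\<lambda>x. \<alpha>\<^sup>2 * x * d\<^sup>2 * L\<^sup>2"] have "\<alpha>\<^sup>2 * ((1 + t) * t / (1 - t)) * ((12 * t + 2 - 2 * t\<^sup>2) / ((1 - t) * (1 + t)) * d\<^sup>2 * L\<^sup>2)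
      = (12 * t + 2 - 2 * t\<^sup>2) / (1 - t)\<^sup>2 * (z\<^sup>2 * (t * d\<^sup>2))"
      by (simp only: z_def power_mult_distrib mult_ac)
    moreover have "\<alpha>\<^sup>2 * ((1 + t) * t / (1 - t)) * (3 * \<alpha> * L^3) = 3 * (1 + t) / (1 - t) * (z * t) * z\<^sup>2"
      by (simp add: z_def power2_eq_square power3_eq_cube mult_ac)
    ultimately show ?thesis by (simp add: distrib_left)
  qed
  also have "\<dots> \<le> (12 * t + 2 - 2 * t\<^sup>2) / (1 - t)\<^sup>2 * ((1 - t)^4 / (144 * \<Gamma>)) + 3 * (1 + t) / (1 - t) * ((1 - t) / 12) * ((1 - t)\<^sup>2 / (4 * \<Gamma>))"
  proof -
    have "(6 * rw * d)\<^sup>2 \<le> m\<^sup>2" using m rw d by (intro power_mono) auto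
    then have "36 * (t * d\<^sup>2) \<le> m\<^sup>2" by (simp add: power_mult_distrib t_def)
    then have zd: "4 * \<Gamma> * (z\<^sup>2 * (36 * (t * d\<^sup>2))) \<le> 4 * \<Gamma> * (z\<^sup>2 * m\<^sup>2)"
      using \<Gamma> by (intro mult_left_mono) auto
    have 1: "z\<^sup>2 * (t * d\<^sup>2) \<le> (1 - t)^4 / (144 * \<Gamma>)"
    proof -
      have "z\<^sup>2 * (t * d\<^sup>2) * (144 * \<Gamma>) = 4 * \<Gamma> * (z\<^sup>2 * (36 * (t * d\<^sup>2)))" by simp
      also have "\<dots> \<le> (1 - t)^4" using zm zd by (rule order_trans[rotated])
      finally show ?thesis using \<Gamma> by (simp add: pos_le_divide_eq)
    qed
    have 2: "z\<^sup>2 \<le> (1 - t)\<^sup>2 / (4 * \<Gamma>)" using z5 \<Gamma> by (simp add: field_simps)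
    have "t\<^sup>2 \<le> 1" using t by (simp add: power_le_one)
    then have "0 \<le> (12 * t + 2 - 2 * t\<^sup>2) / (1 - t)\<^sup>2" using t by (intro divide_nonneg_nonneg) auto
    then show ?thesis using 1 2 z1 t z by (intro add_mono mult_mono mult_left_mono) auto
  qed
  also have "\<dots> = (1 - t)\<^sup>2 / (4 * \<Gamma>) * ((11 + 21 * t - 2 * t\<^sup>2) / 36)"
  proof -
    have "(1 - t)^4 / (144 * \<Gamma>) = (1 - t)\<^sup>2 * ((1 - t)\<^sup>2 / (144 * \<Gamma>))"
      by (simp add: power4_eq_xxxx power2_eq_square)
    then have "(12 * t + 2 - 2 * t\<^sup>2) / (1 - t)\<^sup>2 * ((1 - t)^4 / (144 * \<Gamma>)) = (12 * t + 2 - 2 * t\<^sup>2) * ((1 - t)\<^sup>2 / (144 * \<Gamma>))"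
    proof -
      have "x / u\<^sup>2 * (u^4 / y) = x * (u\<^sup>2 / y)" if "u \<noteq> 0" for x y u :: real
        using that by (simp add: power2_eq_square power4_eq_xxxx)
      then show ?thesis using t by simp
    qed
    moreover have "3 * (1 + t) / (1 - t) * ((1 - t) / 12) = (1 + t) / 4" using t by simp
    ultimately show ?thesis by (simp add: add_divide_distrib diff_divide_distrib algebra_simps)
  qed
  \<comment> \<open>On the unit interval the numerator 11 + 21 t - 2 t^2 increases up to 30, so the
    quotient by 36 stays below 1.\<close>
  also have "\<dots> \<le> (1 - t)\<^sup>2 / (4 * \<Gamma>) * 1"
  proof (intro mult_left_mono)
    show "(11 + 21 * t - 2 * t\<^sup>2) / 36 \<le> 1"
      using t by (simp add: add_increasing2 divide_le_eq) (smt (verit) zero_le_power2)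
  qed (use \<Gamma> in auto)
  also have "\<dots> = (1 - (1/2) * (1 + t))\<^sup>2 / \<Gamma>"
    by (simp add: power2_eq_square field_simps)
  finally show "\<alpha>\<^sup>2 * ((1 + rw\<^sup>2) * rw\<^sup>2 / (1 - rw\<^sup>2)) * ((1 / beta L rw \<alpha> + 2) * d\<^sup>2 * L\<^sup>2 + 3 * \<alpha> * L^3)
        \<le> (1 - (1/2) * (1 + rw\<^sup>2))\<^sup>2 / \<Gamma>"
    by (simp only: be_def t_def)

  assume n: "0 < n"
  \<comment> \<open>Cubing the third bound turns the fractional powers into t and \<mu>^2 / L^2
    times this factor, and its 3 into 27. Here \<kappa> is a constant, not the eigenvalue.\<close>
  define \<kappa> where "\<kappa> = (\<Gamma> - 1) / (\<Gamma> * (\<Gamma> + 1))"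
  have \<kappa>: "0 < \<kappa>" using \<Gamma> by (simp add: \<kappa>_def)
  have cubes: "(rw powr (2/3))^3 = t" "(((\<mu>\<^sup>2 / L\<^sup>2) * \<kappa>) powr (1/3)) ^ 3 = \<mu>\<^sup>2 / L\<^sup>2 * \<kappa>"
    using rw \<mu> L \<kappa> by (simp_all add: t_def powr_power)
  have "\<alpha>^3 \<le> ((1 - t) / (3 * (rw powr (2/3)) * L) * ((\<mu>\<^sup>2 / L\<^sup>2) * \<kappa>) powr (1/3))^3"
    using b3 \<alpha> unfolding \<kappa>_def by (intro power_mono) auto
  also have "\<dots> = (1 - t)^3 / (27 * t * L^3) * (\<mu>\<^sup>2 / L\<^sup>2 * \<kappa>)"
    by (simp only: power_mult_distrib power_divide cubes) simp
  finally have a3: "\<alpha>^3 * L^5 * t \<le> (1 - t)^3 / 27 * \<mu>\<^sup>2 * \<kappa>"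
    using t L by (simp add: field_simps eval_nat_numeral)
  have "\<alpha> * \<mu> \<le> z" using \<mu>L \<alpha> by (simp add: z_def)
  then have am: "\<alpha> * \<mu> \<le> (1 - t) / 2" using z4 by simp
  have am0: "0 < \<alpha> * \<mu>" using \<alpha> \<mu> by simp
  have "(\<alpha> * L\<^sup>2 / (\<mu> * n)) * (1 + \<alpha> * \<mu>) * (\<alpha>\<^sup>2 * ((1 + t) * t / (1 - t))) * (2 * \<alpha> * n * L^3)
    = 2 * (\<alpha> * (1 + \<alpha> * \<mu>) * (1 + t) / (\<mu> * (1 - t))) * (\<alpha>^3 * L^5 * t)"
    using n \<mu> t by (simp add: field_simps eval_nat_numeral)
  also have "\<dots> \<le> 2 * (\<alpha> * (1 + \<alpha> * \<mu>) * (1 + t) / (\<mu> * (1 - t))) * ((1 - t)^3 / 27 * \<mu>\<^sup>2 * \<kappa>)"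
    using a3 \<alpha> am0 t \<mu> by (intro mult_left_mono) auto
  also have "\<dots> = \<alpha> * \<mu> * \<kappa> * (1 - t)\<^sup>2 * (2 / 27 * ((1 + \<alpha> * \<mu>) * (1 + t)))"
    using \<mu> t by (simp add: power3_eq_cube power2_eq_square mult_ac)
  also have "\<dots> \<le> \<alpha> * \<mu> * \<kappa> * (1 - t)\<^sup>2 * (1 / 4)"
  proof (intro mult_left_mono)
    \<comment> \<open>As \<alpha>\<mu> <= (1 - t) / 2, the product is at most 2, and 4/27 is below
      the 1/4 that comes from (1 - b)^2 = (1 - t)^2 / 4.\<close>
    have "(1 + \<alpha> * \<mu>) * (1 + t) \<le> (1 + (1 - t) / 2) * (1 + t)"
      using am t by (intro mult_right_mono) auto
    also have "\<dots> = 2 - (1 - t)\<^sup>2 / 2" by (simp add: power2_eq_square field_simps)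
    also have "\<dots> \<le> 2" by simp
    finally show "2 / 27 * ((1 + \<alpha> * \<mu>) * (1 + t)) \<le> 1 / 4" by simp
  qed (use am0 \<kappa> in auto)
  also have "\<dots> = (1 - (1 - \<alpha> * \<mu>)) * (\<Gamma> - 1) / (\<Gamma> * (\<Gamma> + 1)) * (1 - (1/2) * (1 + t))\<^sup>2"
    by (simp add: \<kappa>_def power2_eq_square field_simps)
  finally show "(\<alpha> * L\<^sup>2 / (\<mu> * n)) * (1 + \<alpha> * \<mu>) * (\<alpha>\<^sup>2 * ((1 + rw\<^sup>2) * rw\<^sup>2 / (1 - rw\<^sup>2))) * (2 * \<alpha> * n * L^3)
        \<le> (1 - (1 - \<alpha> * \<mu>)) * (\<Gamma> - 1) / (\<Gamma> * (\<Gamma> + 1)) * (1 - (1/2) * (1 + rw\<^sup>2))\<^sup>2"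
    by (simp only: t_def)
qed

section \<open>Strongly convex smooth functions\<close>

text \<open>The auxiliary function \<phi> has nonnegative derivative on the unit interval. Both
  quadratic bounds follow: the lower one with c = \<mu> |v|^2, the upper one from -F with c = -L
  |v|^2.\<close>

lemma GDERIV_line_ge:
  fixes F :: "'v::real_inner \<Rightarrow> real"
  assumes G: "\<And>u. GDERIV F u :> G u"
    and ge: "\<And>s. 0 \<le> s \<Longrightarrow> s \<le> 1 \<Longrightarrow> s * c \<le> (G (x + s *\<^sub>R v) - G x) \<bullet> v"
  shows "F x + G x \<bullet> v + c / 2 \<le> F (x + v)"
proof -
  define \<phi> where "\<phi> s = F (x + s *\<^sub>R v) - s * (G x \<bullet> v) - c / 2 * s\<^sup>2" for s
  have "\<exists>y. (\<phi> has_real_derivative y) (at s) \<and> 0 \<le> y" if "0 \<le> s" "s \<le> 1" for s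
  proof (intro exI conjI)
    have "((\<lambda>s. F (x + s *\<^sub>R v)) has_derivative (\<lambda>h. (h *\<^sub>R v) \<bullet> G (x + s *\<^sub>R v))) (at s)"
      by (rule has_derivative_compose[of "\<lambda>s. x + s *\<^sub>R v", OF _ G[unfolded gderiv_def]])
        (auto intro!: derivative_eq_intros)
    then have "((\<lambda>s. F (x + s *\<^sub>R v)) has_real_derivative G (x + s *\<^sub>R v) \<bullet> v) (at s)"
      by (simp add: has_field_derivative_def inner_commute mult_commute_abs)
    then show "(\<phi> has_real_derivative (G (x + s *\<^sub>R v) \<bullet> v - G x \<bullet> v - c * s)) (at s)"
      unfolding \<phi>_def by (auto intro!: derivative_eq_intros)
    show "0 \<le> G (x + s *\<^sub>R v) \<bullet> v - G x \<bullet> v - c * s"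
      using ge[OF that] by (simp add: inner_diff_left mult.commute)
  qed
  from DERIV_nonneg_imp_nondecreasing[of 0 1 \<phi>, OF _ this] have "\<phi> 0 \<le> \<phi> 1" by simp
  then show ?thesis by (simp add: \<phi>_def)
qed

locale strongly_convex_smooth =
  fixes F :: "'v::euclidean_space \<Rightarrow> real" and G :: "'v \<Rightarrow> 'v" and \<mu> L :: real
  assumes gderiv: "GDERIV F u :> G u"
    and strong: "\<mu> * (norm (u - v))\<^sup>2 \<le> (G u - G v) \<bullet> (u - v)"
    and smooth: "norm (G u - G v) \<le> L * norm (u - v)"
    and mu_pos: "0 < \<mu>"
begin

lemma \<mu>_le_L: "\<mu> \<le> L"
proof -
  obtain b :: 'v where b: "norm b = 1" using norm_Basis nonempty_Basis by blast
  have "\<mu> * 1 \<le> (G b - G 0) \<bullet> (b - 0)" using strong[of b 0] b by simp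
  also have "\<dots> \<le> norm (G b - G 0) * norm (b - 0)" by (rule norm_cauchy_schwarz)
  also have "\<dots> \<le> L" using smooth[of b 0] b by simp
  finally show ?thesis by simp
qed

lemma quadratic_lower: "F x + G x \<bullet> (y - x) + \<mu> / 2 * (norm (y - x))\<^sup>2 \<le> F y"
proof -
  have "s * (\<mu> * (norm (y - x))\<^sup>2) \<le> (G (x + s *\<^sub>R (y - x)) - G x) \<bullet> (y - x)" if "0 \<le> s" for s
  \<comment> \<open>Strong monotonicity between x + s(y - x) and x carries s on the inner product
    and s^2 on the norm; one factor s is cancelled.\<close>
  proof (cases "s = 0")
    case False
    then show ?thesis
      using strong[of "x + s *\<^sub>R (y - x)" x] that
      by (simp add: power_mult_distrib power2_eq_square mult_ac)
  qed simp
  from GDERIV_line_ge[of F G, OF gderiv this] show ?thesis by simp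
qed

lemma quadratic_upper: "F y \<le> F x + G x \<bullet> (y - x) + L / 2 * (norm (y - x))\<^sup>2"
proof -
  have "s * - (L * (norm (y - x))\<^sup>2) \<le> (- G (x + s *\<^sub>R (y - x)) - - G x) \<bullet> (y - x)" if "0 \<le> s" for s
  proof -
    have "(G (x + s *\<^sub>R (y - x)) - G x) \<bullet> (y - x) \<le> norm (G (x + s *\<^sub>R (y - x)) - G x) * norm (y - x)"
      by (rule norm_cauchy_schwarz)
    also have "\<dots> \<le> L * norm (s *\<^sub>R (y - x)) * norm (y - x)"
      using smooth[of "x + s *\<^sub>R (y - x)" x] by (intro mult_right_mono) auto
    finally show ?thesis using that by (simp add: inner_diff_left power2_eq_square mult_ac)
  qed
  from GDERIV_line_ge[of "\<lambda>u. - F u" "\<lambda>u. - G u", OF GDERIV_minus[OF gderiv] this] show ?thesis by simp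
qed

text \<open>Outside the ball of radius \<open>R\<close> the quadratic term of the lower bound at 0
  outweighs the linear one, so values there are at least F 0 and compactness of the ball
  suffices.\<close>

lemma exists_minimizer: "\<exists>x. \<forall>y. F x \<le> F y"
proof -
  define R where "R = 2 * norm (G 0) / \<mu>"
  have "continuous_on (cball 0 R) F"
    using gderiv unfolding gderiv_def
    by (intro continuous_at_imp_continuous_on) (auto intro: has_derivative_continuous)
  moreover have R: "0 \<le> R" using mu_pos by (simp add: R_def)
  ultimately obtain x where x: "x \<in> cball 0 R" "\<And>y. y \<in> cball 0 R \<Longrightarrow> F x \<le> F y"
    using continuous_attains_inf[of "cball 0 R" F] by auto
  have "F x \<le> F y" for y
  proof (cases "y \<in> cball 0 R")
    case False
    then have "R < norm y" by simp
    then have "2 * norm (G 0) \<le> \<mu> * norm y" using mu_pos by (simp add: R_def field_simps)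
    then have "2 * norm (G 0) * norm y \<le> \<mu> * norm y * norm y" by (intro mult_right_mono) auto
    moreover have "- (norm (G 0) * norm y) \<le> G 0 \<bullet> y"
      using Cauchy_Schwarz_ineq2[of "G 0" y] by linarith
    ultimately have "F 0 \<le> F y" using quadratic_lower[of 0 y] by (simp add: power2_eq_square)
    then show ?thesis using x(2)[of 0] R by simp
  qed (use x in auto)
  then show ?thesis by blast
qed

text \<open>\<open>arg_min\<close> is a choice operator, so it denotes a minimizer only because one
  exists; the derivative vanishes there.\<close>

lemma arg_min_gradient_zero: "G (arg_min F (\<lambda>_. True)) = 0"
proof -
  define m where "m = arg_min F (\<lambda>_. True)"
  obtain x where "\<forall>y. F x \<le> F y" using exists_minimizer by blast
  then have "is_arg_min F (\<lambda>_. True) x" by (auto simp: is_arg_min_def not_less)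
  then have "is_arg_min F (\<lambda>_. True) m" unfolding m_def arg_min_def by (rule someI)
  then have "\<forall>y\<in>UNIV. F m \<le> F y" by (auto simp: is_arg_min_def not_less)
  with differential_zero_maxmin[of m UNIV F "\<lambda>h. h \<bullet> G m"] gderiv[of m]
  have "(\<lambda>h. h \<bullet> G m) = (\<lambda>_. 0)" unfolding gderiv_def by auto
  from fun_cong[OF this, of "G m"] show ?thesis by (simp add: m_def)
qed

text \<open>
  Subtracting \<open>\<mu> / 2 * norm (z - m)\<^sup>2\<close> from \<open>F\<close> leaves a convex function whose gradient at
  \<open>x\<close> is \<open>H = G x - \<mu> u\<close>; comparing its values at \<open>m\<close> and at \<open>x - t H\<close>
  gives \<open>H \<bullet> u \<ge> t / 2 * norm H ^ 2\<close>, and \<open>t = \<alpha> / (1 - \<alpha> \<mu>)\<close> is exactly what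
  the expansion of the square needs.
\<close>

lemma gradient_step_contraction:
  assumes m: "G m = 0" and \<alpha>: "0 < \<alpha>" "\<alpha> * L \<le> 1" "\<alpha> * \<mu> < 1"
  shows "norm (x - m - \<alpha> *\<^sub>R G x) \<le> (1 - \<alpha> * \<mu>) * norm (x - m)"
proof -
  define u H t where "u = x - m" and "H = G x - \<mu> *\<^sub>R u" and "t = \<alpha> / (1 - \<alpha> * \<mu>)"
  have t: "0 < t" using \<alpha> by (simp add: t_def)
  have Gx: "G x = H + \<mu> *\<^sub>R u" by (simp add: H_def)
  have 1: "F x - G x \<bullet> u + \<mu> / 2 * (u \<bullet> u) \<le> F m"
    using quadratic_lower[of x m]
    by (simp add: u_def inner_diff_right norm_minus_commute flip: power2_norm_eq_inner)
  have 2: "F (x - t *\<^sub>R H) \<le> F x - t * (G x \<bullet> H) + L / 2 * (t\<^sup>2 * (H \<bullet> H))"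
    using quadratic_upper[of "x - t *\<^sub>R H" x] by (simp add: power_mult_distrib power2_norm_eq_inner)
  have 3: "F m + \<mu> / 2 * (u \<bullet> u - 2 * t * (H \<bullet> u) + t\<^sup>2 * (H \<bullet> H)) \<le> F (x - t *\<^sub>R H)"
  proof -
    have "(norm (x - t *\<^sub>R H - m))\<^sup>2 = (norm (u - t *\<^sub>R H))\<^sup>2" by (simp add: u_def algebra_simps)
    also have "\<dots> = u \<bullet> u - 2 * t * (H \<bullet> u) + t\<^sup>2 * (H \<bullet> H)"
      unfolding power2_norm_eq_inner inner_diff_left inner_diff_right
      by (simp add: inner_commute power2_eq_square)
    finally show ?thesis using quadratic_lower[of m "x - t *\<^sub>R H"] m by simp
  qed
  \<comment> \<open>Chaining 1, 2 and 3 eliminates all values of F and leaves an inequality between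
    \<open>H\<close> and \<open>u\<close> alone.\<close>
  have "t * (H \<bullet> H) - (L - \<mu>) / 2 * (t\<^sup>2 * (H \<bullet> H)) \<le> H \<bullet> u"
    using 1 2 3 unfolding Gx inner_add_left inner_scaleR_left inner_commute[of u H]
    by (simp add: algebra_simps diff_divide_distrib)
  moreover have "(L - \<mu>) / 2 * (t\<^sup>2 * (H \<bullet> H)) \<le> t / 2 * (H \<bullet> H)"
  proof -
    \<comment> \<open>For t = \<alpha> / (1 - \<alpha>\<mu>) this is equivalent to \<alpha> L <=
      1.\<close>
    have "(L - \<mu>) * t \<le> 1" using \<alpha> by (simp add: t_def field_simps)
    from mult_right_mono[OF this, of "t * (H \<bullet> H)"] show ?thesis
      using t by (simp add: power2_eq_square mult_ac)
  qed
  ultimately have coco: "t / 2 * (H \<bullet> H) \<le> H \<bullet> u" by (simp add: field_simps)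
  have "(norm (u - \<alpha> *\<^sub>R G x))\<^sup>2 = (norm ((1 - \<alpha> * \<mu>) *\<^sub>R u - \<alpha> *\<^sub>R H))\<^sup>2"
    by (simp add: Gx algebra_simps)
  also have "\<dots> = (1 - \<alpha> * \<mu>)\<^sup>2 * (u \<bullet> u) - 2 * \<alpha> * (1 - \<alpha> * \<mu>) * (H \<bullet> u) + \<alpha>\<^sup>2 * (H \<bullet> H)"
    unfolding power2_norm_eq_inner inner_diff_left inner_diff_right
    by (simp add: inner_commute power2_eq_square algebra_simps)
  finally have eq: "(norm (u - \<alpha> *\<^sub>R G x))\<^sup>2 = (1 - \<alpha> * \<mu>)\<^sup>2 * (u \<bullet> u) - 2 * \<alpha> * (1 - \<alpha> * \<mu>) * (H \<bullet> u) + \<alpha>\<^sup>2 * (H \<bullet> H)" .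
  have "2 * \<alpha> * (1 - \<alpha> * \<mu>) * (t / 2 * (H \<bullet> H)) \<le> 2 * \<alpha> * (1 - \<alpha> * \<mu>) * (H \<bullet> u)"
    using coco \<alpha> by (intro mult_left_mono) auto
  moreover have "2 * \<alpha> * (1 - \<alpha> * \<mu>) * (t / 2 * (H \<bullet> H)) = \<alpha>\<^sup>2 * (H \<bullet> H)"
  proof -
    have "(1 - \<alpha> * \<mu>) * t = \<alpha>" using \<alpha> by (simp add: t_def)
    then have "2 * \<alpha> * ((1 - \<alpha> * \<mu>) * t) / 2 * (H \<bullet> H) = \<alpha>\<^sup>2 * (H \<bullet> H)"
      by (simp add: power2_eq_square)
    then show ?thesis by (simp add: mult_ac)
  qed
  ultimately have "(norm (u - \<alpha> *\<^sub>R G x))\<^sup>2 \<le> ((1 - \<alpha> * \<mu>) * norm u)\<^sup>2"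
    using eq unfolding power_mult_distrib power2_norm_eq_inner by linarith
  then show ?thesis
    using \<alpha> by (simp add: u_def power2_le_iff_abs_le)
qed

end

section \<open>Row-stacked vectors\<close>

lemma norm_power2_rows: "(norm (X :: ('a::real_normed_vector)^'n))\<^sup>2 = (\<Sum>i\<in>UNIV. (norm (X $ i))\<^sup>2)"
  by (simp add: norm_vec_def L2_set_def sum_nonneg)

lemma norm_power2_columns:
  "(norm (X :: real^'p^'n))\<^sup>2 = (\<Sum>j\<in>UNIV. (norm (column j X))\<^sup>2)"
proof -
  have "(\<Sum>i\<in>UNIV. \<Sum>j\<in>UNIV. (X $ i $ j)\<^sup>2) = (\<Sum>j\<in>UNIV. \<Sum>i\<in>UNIV. (X $ i $ j)\<^sup>2)"
    by (rule sum.swap)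
  then show ?thesis by (simp add: norm_power2_rows column_def)
qed

lemma matrix_mult_row: "((A :: real^'n^'m) ** (X :: real^'p^'n)) $ i = (\<Sum>j\<in>UNIV. A $ i $ j *\<^sub>R X $ j)"
  by (simp add: Finite_Cartesian_Product.vec_eq_iff matrix_matrix_mult_def)

lemma vec_rows_eqI: "(\<And>i. X $ i = Y $ i) \<Longrightarrow> X = Y"
  by (simp add: Finite_Cartesian_Product.vec_eq_iff)

lemma matrix_diff_ldistrib: "(A :: real^'n^'m) ** (X - Y) = A ** X - A ** (Y :: real^'p^'n)"
  and matrix_diff_rdistrib: "(A - B) ** X = A ** X - B ** (X :: real^'p^'n)"
  and matrix_scaleR_right: "(A :: real^'n^'m) ** (c *\<^sub>R X) = c *\<^sub>R (A ** X)"
  by (rule vec_rows_eqI, simp add: matrix_mult_row scaleR_diff_right scaleR_diff_left sum_subtractf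
      scaleR_sum_right mult.commute)+

text \<open>The squared Frobenius norm is the sum over columns, and the operator norm bounds each
  column. This lets the spectral norm \<open>rho_w\<close> contract stacked iterates measured in the
  Frobenius norm.\<close>

lemma norm_matrix_mult_onorm: "norm ((A :: real^'n^'m) ** (X :: real^'p^'n)) \<le> onorm ((*v) A) * norm X"
proof -
  have bl: "bounded_linear ((*v) A)" by (rule matrix_vector_mul_bounded_linear)
  have "(norm (A ** X))\<^sup>2 = (\<Sum>j\<in>UNIV. (norm (A *v column j X))\<^sup>2)"
    unfolding norm_power2_columns
    by (intro sum.cong) (simp_all add: column_def matrix_matrix_mult_def matrix_vector_mult_def)
  also have "\<dots> \<le> (\<Sum>j\<in>UNIV. (onorm ((*v) A) * norm (column j X))\<^sup>2)"
    by (intro sum_mono power_mono onorm[OF bl]) auto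
  also have "\<dots> = (onorm ((*v) A) * norm X)\<^sup>2"
    by (simp add: norm_power2_columns power_mult_distrib sum_distrib_left)
  finally show ?thesis
    by (rule power2_le_imp_le) (simp add: onorm_pos_le[OF bl])
qed

text \<open>By Cauchy-Schwarz on each row the operator norm is at most the Frobenius norm, the norm
  in which \<open>dist_id\<close> is measured.\<close>

lemma norm_matrix_mult_le: "norm ((A :: real^'n^'m) ** (X :: real^'p^'n)) \<le> norm A * norm X"
proof -
  have "norm (A *v v) \<le> norm A * norm v" for v
  proof (rule power2_le_imp_le)
    have "(norm (A *v v))\<^sup>2 = (\<Sum>i\<in>UNIV. (A $ i \<bullet> v)\<^sup>2)"
      by (simp add: norm_power2_rows matrix_vector_mult_def inner_vec_def)
    also have "\<dots> \<le> (\<Sum>i\<in>UNIV. (norm (A $ i))\<^sup>2 * (norm v)\<^sup>2)"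
      using Cauchy_Schwarz_ineq by (intro sum_mono) (simp add: power2_norm_eq_inner)
    also have "\<dots> = (norm A * norm v)\<^sup>2"
      by (simp add: norm_power2_rows[of A] power_mult_distrib sum_distrib_right)
    finally show "(norm (A *v v))\<^sup>2 \<le> (norm A * norm v)\<^sup>2" .
  qed simp
  then have "onorm ((*v) A) \<le> norm A" by (intro onorm_le)
  then show ?thesis
    by (intro order_trans[OF norm_matrix_mult_onorm] mult_right_mono) auto
qed

lemma row_avg_eq: "row_avg (X :: real^'p^'n::finite) = (1 / real CARD('n)) *\<^sub>R (\<Sum>i\<in>UNIV. X $ i)"
  by (simp add: row_avg_def vector_matrix_mult_def Finite_Cartesian_Product.vec_eq_iff)

lemma sum_rows: "(\<Sum>i\<in>UNIV. X $ i) = real CARD('n) *\<^sub>R row_avg (X :: real^'p^'n::finite)"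
  by (simp add: row_avg_eq)

lemma row_avg_add: "row_avg (X + Y) = row_avg X + row_avg Y"
  and row_avg_diff: "row_avg (X - Y) = row_avg X - row_avg Y"
  and row_avg_scaleR: "row_avg (c *\<^sub>R X) = c *\<^sub>R row_avg X"
  by (simp_all add: row_avg_eq sum.distrib sum_subtractf scaleR_right_distrib scaleR_right_diff_distrib
      scaleR_sum_right mult.commute)

lemma row_avg_const: "row_avg (\<chi> i. v) = v"
  by (simp add: row_avg_eq sum_constant_scaleR del: sum_constant)

text \<open>Pythagoras: deviations from the row average are orthogonal to matrices with equal rows.
  The bounds for the average and for the deviation both follow.\<close>

lemma norm_power2_consensus_error:
  "(norm (consensus_error (X :: real^'p^'n::finite)))\<^sup>2 = (norm X)\<^sup>2 - real CARD('n) * (norm (row_avg X))\<^sup>2"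
proof -
  have "(norm (consensus_error X))\<^sup>2 = (\<Sum>i\<in>UNIV. (norm (X $ i - row_avg X))\<^sup>2)"
    by (simp add: norm_power2_rows consensus_error_def)
  also have "\<dots> = (\<Sum>i\<in>UNIV. (norm (X $ i))\<^sup>2 - 2 * (X $ i \<bullet> row_avg X) + (norm (row_avg X))\<^sup>2)"
    by (intro sum.cong refl) (simp add: power2_norm_eq_inner inner_diff_left inner_diff_right inner_commute)
  also have "\<dots> = (norm X)\<^sup>2 - 2 * ((\<Sum>i\<in>UNIV. X $ i) \<bullet> row_avg X) + real CARD('n) * (norm (row_avg X))\<^sup>2"
    by (simp add: sum.distrib sum_subtractf inner_sum_left sum_distrib_left norm_power2_rows[of X])
  finally show ?thesis by (simp add: sum_rows dot_square_norm)
qed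

lemma norm_power2_row_avg_le:
  "real CARD('n) * (norm (row_avg (X :: real^'p^'n::finite)))\<^sup>2 \<le> (norm X)\<^sup>2"
  using norm_power2_consensus_error[of X] zero_le_power2[of "norm (consensus_error X)"] by linarith

lemma norm_consensus_error_le: "norm (consensus_error (X :: real^'p^'n::finite)) \<le> norm X"
  by (rule power2_le_imp_le) (simp_all add: norm_power2_consensus_error)

lemma consensus_error_add: "consensus_error (X + Y) = consensus_error X + consensus_error Y"
  and consensus_error_diff: "consensus_error (X - Y) = consensus_error X - consensus_error Y"
  and consensus_error_scaleR: "consensus_error (c *\<^sub>R X) = c *\<^sub>R consensus_error X"
  by (simp_all add: consensus_error_def Finite_Cartesian_Product.vec_eq_iff row_avg_add row_avg_diff row_avg_scaleR algebra_simps)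

section \<open>Averaging, contraction and displacement under the mixing matrix\<close>

locale mixing =
  fixes E :: "('n::finite \<times> 'n) set" and W :: "real^'n^'n"
  assumes mixing: "mixing_matrix E W"
begin

lemma W_nonneg: "0 \<le> W $ i $ j"
  and W_sym: "W $ i $ j = W $ j $ i"
  using mixing by (auto simp: mixing_matrix_def)

lemma W_row_sum: "(\<Sum>j\<in>UNIV. W $ i $ j) = 1"
proof -
  have "(W *v 1) $ i = 1" using mixing by (simp add: mixing_matrix_def)
  then show ?thesis by (simp add: matrix_vector_mult_def)
qed

lemma W_col_sum: "(\<Sum>i\<in>UNIV. W $ i $ j) = 1"
  using W_row_sum[of j] by (simp add: W_sym[of j])

lemma W_le_1: "W $ i $ j \<le> 1"
proof -
  have "W $ i $ j \<le> (\<Sum>j\<in>UNIV. W $ i $ j)"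
    by (rule member_le_sum) (auto simp: W_nonneg)
  then show ?thesis by (simp add: W_row_sum)
qed

lemma row_avg_W: "row_avg (W ** (X :: real^'p^'n)) = row_avg X"
proof -
  have "(\<Sum>i\<in>UNIV. \<Sum>j\<in>UNIV. W $ i $ j *\<^sub>R X $ j) = (\<Sum>j\<in>UNIV. \<Sum>i\<in>UNIV. W $ i $ j *\<^sub>R X $ j)"
    by (rule sum.swap)
  also have "\<dots> = (\<Sum>j\<in>UNIV. X $ j)"
    by (simp add: W_col_sum flip: scaleR_sum_left)
  finally show ?thesis by (simp add: row_avg_eq matrix_mult_row)
qed

lemma W_const: "W ** (\<chi> i. (v :: real^'p)) = (\<chi> i. v)"
  by (rule vec_rows_eqI) (simp add: matrix_mult_row W_row_sum flip: scaleR_sum_left)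

lemma avg_mult: "(\<chi> i j. 1 / real CARD('n)) ** (X :: real^'p^'n) = (\<chi> i. row_avg X)"
  by (rule vec_rows_eqI) (simp add: matrix_mult_row row_avg_eq scaleR_sum_right)

lemma W_minus_avg_mult:
  "(W - (\<chi> i j. 1 / real CARD('n))) ** X = W ** X - (\<chi> i. row_avg (X :: real^'p^'n))"
  by (simp add: matrix_diff_rdistrib avg_mult)

text \<open>W minus the averaging matrix annihilates matrices with equal rows, so only the deviation
  is seen and the factor \<open>rho_w W\<close> applies to it.\<close>

lemma consensus_error_W: "consensus_error (W ** (X :: real^'p^'n)) = (W - (\<chi> i j. 1 / real CARD('n))) ** consensus_error X"
  by (simp add: consensus_error_def row_avg_W W_minus_avg_mult matrix_diff_ldistrib W_const row_avg_diff row_avg_const)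

lemma norm_consensus_error_W: "norm (consensus_error (W ** (X :: real^'p^'n))) \<le> rho_w W * norm (consensus_error X)"
  unfolding consensus_error_W rho_w_def by (rule norm_matrix_mult_onorm)

text \<open>W fixes matrices with equal rows, so the displacement caused by mixing is controlled by
  the consensus error.\<close>

lemma W_minus_id_mult: "W ** X - X = (W - Finite_Cartesian_Product.mat 1) ** consensus_error (X :: real^'p^'n)"
  by (simp add: matrix_diff_rdistrib consensus_error_def matrix_diff_ldistrib W_const)

lemma norm_W_minus_id: "norm (W ** X - (X :: real^'p^'n)) \<le> dist_id W * norm (consensus_error X)"
  unfolding W_minus_id_mult dist_id_def by (rule norm_matrix_mult_le)

end

section \<open>Square integrable functions and resampling\<close>

text \<open>Expected squares are expanded into sums of integrals below. A Bochner integral of a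
  non-integrable function is 0, so finiteness of second moments has to be carried along the whole
  process.\<close>

definition square_integrable :: "'a measure \<Rightarrow> ('a \<Rightarrow> 'b::euclidean_space) \<Rightarrow> bool" where
  "square_integrable N h \<longleftrightarrow> h \<in> borel_measurable N \<and> integrable N (\<lambda>z. (norm (h z))\<^sup>2)"

lemma square_integrable_measurable: "square_integrable N h \<Longrightarrow> h \<in> borel_measurable N"
  and square_integrable_norm_power2: "square_integrable N h \<Longrightarrow> integrable N (\<lambda>z. (norm (h z))\<^sup>2)"
  by (auto simp: square_integrable_def)

lemma square_integrable_bound:
  assumes "square_integrable N f" "h \<in> borel_measurable N" "\<And>z. norm (h z) \<le> norm (f z)"
  shows "square_integrable N h"
  unfolding square_integrable_def
proof (intro conjI)
  show "integrable N (\<lambda>z. (norm (h z))\<^sup>2)"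
    by (rule Bochner_Integration.integrable_bound[OF square_integrable_norm_power2[OF assms(1)]])
      (use assms(2,3) in \<open>auto intro!: AE_I2 power_mono\<close>)
qed fact

lemma square_integrable_scaleR:
  "square_integrable N f \<Longrightarrow> square_integrable N (\<lambda>z. c *\<^sub>R f z)"
  unfolding square_integrable_def by (auto simp: power_mult_distrib intro!: borel_measurable_scaleR)

lemma square_integrable_add:
  assumes "square_integrable N f" "square_integrable N h"
  shows "square_integrable N (\<lambda>z. f z + h z)"
  unfolding square_integrable_def
proof (intro conjI)
  have [measurable]: "f \<in> borel_measurable N" "h \<in> borel_measurable N"
    using assms by (auto intro: square_integrable_measurable)
  show "(\<lambda>z. f z + h z) \<in> borel_measurable N" by measurable
  have le: "(norm (f z + h z))\<^sup>2 \<le> 2 * (norm (f z))\<^sup>2 + 2 * (norm (h z))\<^sup>2" for z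
  proof -
    have "(norm (f z + h z))\<^sup>2 \<le> (norm (f z) + norm (h z))\<^sup>2"
      by (intro power_mono norm_triangle_ineq) auto
    also have "\<dots> \<le> 2 * (norm (f z))\<^sup>2 + 2 * (norm (h z))\<^sup>2"
      using sum_squares_bound[of "norm (f z)" "norm (h z)"] by (simp add: power2_sum)
    finally show ?thesis .
  qed
  show "integrable N (\<lambda>z. (norm (f z + h z))\<^sup>2)"
    by (rule Bochner_Integration.integrable_bound[of N "\<lambda>z. 2 * (norm (f z))\<^sup>2 + 2 * (norm (h z))\<^sup>2"])
      (simp_all add: assms square_integrable_norm_power2 le)
qed

lemma square_integrable_diff:
  assumes "square_integrable N f" "square_integrable N h"
  shows "square_integrable N (\<lambda>z. f z - h z)"
  using square_integrable_add[OF assms(1) square_integrable_scaleR[OF assms(2), of "-1"]] by simp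

lemma square_integrable_linear:
  assumes "square_integrable N f" "bounded_linear T"
  shows "square_integrable N (\<lambda>z. T (f z))"
proof -
  from assms(2) obtain K where K: "\<And>v. norm (T v) \<le> norm v * K" "0 < K"
    by (meson bounded_linear.pos_bounded)
  show ?thesis
  proof (rule square_integrable_bound[OF square_integrable_scaleR[OF assms(1), of K]])
    have [measurable]: "f \<in> borel_measurable N" "T \<in> borel_measurable borel"
      using assms by (auto intro: square_integrable_measurable borel_measurable_continuous_onI
          linear_continuous_on bounded_linear.linear)
    show "(\<lambda>z. T (f z)) \<in> borel_measurable N" by measurable
  qed (use K in \<open>simp add: mult.commute\<close>)
qed

lemma square_integrable_inner:
  assumes "square_integrable N f" "square_integrable N h"
  shows "integrable N (\<lambda>z. f z \<bullet> h z)"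
proof -
  have [measurable]: "f \<in> borel_measurable N" "h \<in> borel_measurable N"
    using assms by (auto intro: square_integrable_measurable)
  have le: "\<bar>f z \<bullet> h z\<bar> \<le> (norm (f z))\<^sup>2 + (norm (h z))\<^sup>2" for z
  proof -
    have "\<bar>f z \<bullet> h z\<bar> \<le> norm (f z) * norm (h z)" by (rule Cauchy_Schwarz_ineq2)
    also have "\<dots> \<le> (norm (f z))\<^sup>2 + (norm (h z))\<^sup>2"
      using sum_squares_bound[of "norm (f z)" "norm (h z)"]
        mult_nonneg_nonneg[OF norm_ge_zero norm_ge_zero, of "f z" "h z"] by linarith
    finally show ?thesis .
  qed
  show ?thesis
    by (rule Bochner_Integration.integrable_bound[of N "\<lambda>z. (norm (f z))\<^sup>2 + (norm (h z))\<^sup>2"])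
      (simp_all add: assms square_integrable_norm_power2 le)
qed

lemma (in prob_space) square_integrable_const: "square_integrable M (\<lambda>_. c)"
  by (simp add: square_integrable_def)

lemma borel_measurable_vec_lambda:
  fixes f :: "'n::finite \<Rightarrow> 'a \<Rightarrow> 'b::euclidean_space"
  assumes "\<And>i. f i \<in> borel_measurable N"
  shows "(\<lambda>z. \<chi> i. f i z) \<in> borel_measurable N"
  unfolding borel_measurable_euclidean_space[of "\<lambda>z. \<chi> i. f i z"]
  using assms by (auto simp: Basis_vec_def inner_axis)

lemma borel_measurable_vec_nth:
  fixes f :: "'a \<Rightarrow> 'b::euclidean_space^'n"
  assumes "f \<in> borel_measurable N"
  shows "(\<lambda>z. f z $ i) \<in> borel_measurable N"
  by (rule measurable_compose[OF assms])
    (auto intro!: borel_measurable_continuous_onI continuous_intros)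

lemma square_integrable_vec_lambda:
  fixes f :: "'n::finite \<Rightarrow> 'a \<Rightarrow> 'b::euclidean_space"
  assumes "\<And>i. square_integrable N (f i)"
  shows "square_integrable N (\<lambda>z. \<chi> i. f i z)"
  using assms unfolding square_integrable_def
  by (auto simp: norm_vec_def L2_set_def sum_nonneg intro!: borel_measurable_vec_lambda)

lemma square_integrable_vec_nth:
  fixes f :: "'a \<Rightarrow> 'b::euclidean_space^'n"
  assumes "square_integrable N f"
  shows "square_integrable N (\<lambda>z. f z $ i)"
  by (rule square_integrable_bound[OF assms borel_measurable_vec_nth[OF square_integrable_measurable[OF assms]]])
    (rule Finite_Cartesian_Product.norm_nth_le)

text \<open>A pointwise substitute for measurability with respect to all samples but one. It
  survives composition with arbitrary functions and is checked by rewriting along the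
  recursion.\<close>

definition ignores :: "'i \<Rightarrow> (('i \<Rightarrow> 'b) \<Rightarrow> 'c) \<Rightarrow> bool" where
  "ignores q \<Phi> \<longleftrightarrow> (\<forall>z c. \<Phi> (z(q := c)) = \<Phi> z)"

locale noise_product =
  fixes D :: "'n \<Rightarrow> (real^'m::finite) measure"
  assumes prob_D: "prob_space (D i)" and sets_D: "sets (D i) = sets borel"
begin

definition Q :: "('n \<times> nat \<Rightarrow> real^'m) measure" where "Q = PiM UNIV (\<lambda>p. D (fst p))"

sublocale Q: prob_space Q
  unfolding Q_def by (rule prob_space_PiM) (rule prob_D)

lemma sets_Q: "sets Q = sets (PiM UNIV (\<lambda>_. borel))"
  unfolding Q_def by (rule sets_PiM_cong) (auto simp: sets_D)

lemma measurable_Q: "measurable Q N = measurable (PiM UNIV (\<lambda>_. borel)) N"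
  by (rule measurable_cong_sets) (auto simp: sets_Q)

lemma measurable_sample: "(\<lambda>z. z p) \<in> borel_measurable Q"
  unfolding measurable_Q by simp

text \<open>Coordinates are independent under \<open>Q\<close>, and the fresh value has the law of
  the one it replaces. With Fubini this isolates a single sample in an inner integral, in place of
  conditional expectation.\<close>

lemma distr_resample: "distr (D (fst q) \<Otimes>\<^sub>M Q) Q (\<lambda>(c, z). z(q := c)) = Q"
  using distr_pair_PiM_eq_PiM[of UNIV "\<lambda>p. D (fst p)" q] prob_D by (simp add: Q_def)

lemma measurable_resample: "(\<lambda>(c, z). z(q := c)) \<in> measurable (D (fst q) \<Otimes>\<^sub>M Q) Q"
proof -
  have "(\<lambda>(c, z). z(q := c)) \<in> measurable (D (fst q) \<Otimes>\<^sub>M PiM UNIV (\<lambda>p. D (fst p)))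
      (PiM (insert q UNIV) (\<lambda>p. D (fst p)))"
    by measurable
  then show ?thesis by (simp add: Q_def)
qed

lemma nn_integral_resample:
  assumes "h \<in> borel_measurable Q"
  shows "(\<integral>\<^sup>+z. h z \<partial>Q) = (\<integral>\<^sup>+z. \<integral>\<^sup>+c. h (z(q := c)) \<partial>D (fst q) \<partial>Q)"
proof -
  interpret D: prob_space "D (fst q)" by (rule prob_D)
  interpret pair_sigma_finite "D (fst q)" Q ..
  have "(\<integral>\<^sup>+z. h z \<partial>Q) = (\<integral>\<^sup>+p. h ((\<lambda>(c, z). z(q := c)) p) \<partial>(D (fst q) \<Otimes>\<^sub>M Q))"
    by (subst (1) distr_resample[of q, symmetric], subst nn_integral_distr)
      (use assms measurable_resample in auto)
  also have "\<dots> = (\<integral>\<^sup>+z. \<integral>\<^sup>+c. h ((\<lambda>(c, z). z(q := c)) (c, z)) \<partial>D (fst q) \<partial>Q)"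
    by (rule nn_integral_snd[symmetric]) (rule measurable_compose[OF measurable_resample assms])
  finally show ?thesis by simp
qed

lemma integral_resample:
  fixes h :: "_ \<Rightarrow> real"
  assumes "integrable Q h"
  shows "(\<integral>z. h z \<partial>Q) = (\<integral>z. \<integral>c. h (z(q := c)) \<partial>D (fst q) \<partial>Q)"
proof -
  interpret D: prob_space "D (fst q)" by (rule prob_D)
  interpret pair_sigma_finite "D (fst q)" Q ..
  have h: "h \<in> borel_measurable Q" using assms by simp
  have "(\<integral>z. h z \<partial>Q) = (\<integral>p. h ((\<lambda>(c, z). z(q := c)) p) \<partial>(D (fst q) \<Otimes>\<^sub>M Q))"
    by (subst (1) distr_resample[of q, symmetric], subst integral_distr)
      (use h measurable_resample in auto)
  also have "\<dots> = (\<integral>z. \<integral>c. h ((\<lambda>(c, z). z(q := c)) (c, z)) \<partial>D (fst q) \<partial>Q)"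
  proof -
    have "integrable (distr (D (fst q) \<Otimes>\<^sub>M Q) Q (\<lambda>(c, z). z(q := c))) h"
      unfolding distr_resample by (rule assms)
    then have "integrable (D (fst q) \<Otimes>\<^sub>M Q) (\<lambda>p. h ((\<lambda>(c, z). z(q := c)) p))"
      by (rule integrable_distr[OF measurable_resample])
    then have "integrable (D (fst q) \<Otimes>\<^sub>M Q) (\<lambda>(c, z). h (z(q := c)))"
      by (simp add: case_prod_unfold)
    from integral_snd[OF this] show ?thesis by (simp add: case_prod_unfold)
  qed
  finally show ?thesis by simp
qed

end

locale oracle_noise = noise_product D
  for D :: "'n \<Rightarrow> (real^'m::finite) measure" +
  fixes g :: "'n \<Rightarrow> real^'p::finite \<Rightarrow> real^'m \<Rightarrow> real^'p"
    and grad :: "'n \<Rightarrow> real^'p \<Rightarrow> real^'p" and \<sigma> :: real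
  assumes g_measurable: "(\<lambda>(u, c). g i u c) \<in> borel_measurable (borel \<Otimes>\<^sub>M borel)"
    and g_integrable: "integrable (D i) (g i u)"
    and g_unbiased: "(\<integral>c. g i u c \<partial>D i) = grad i u"
    and g_variance: "(\<integral>\<^sup>+c. ennreal ((norm (g i u c - grad i u))\<^sup>2) \<partial>D i) \<le> ennreal (\<sigma>\<^sup>2)"
    and grad_measurable: "grad i \<in> borel_measurable borel"
begin

text \<open>The query point \<Psi> is itself random. The moment bounds ask that it ignore
  \<open>q\<close>, so that the sample fed to the oracle is fresh.\<close>

definition noise :: "'n \<times> nat \<Rightarrow> (('n \<times> nat \<Rightarrow> real^'m) \<Rightarrow> real^'p) \<Rightarrow> ('n \<times> nat \<Rightarrow> real^'m) \<Rightarrow> real^'p"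
  where "noise q \<Psi> z = g (fst q) (\<Psi> z) (z q) - grad (fst q) (\<Psi> z)"

context
  fixes q :: "'n \<times> nat" and \<Psi> :: "('n \<times> nat \<Rightarrow> real^'m) \<Rightarrow> real^'p"
  assumes meas: "\<Psi> \<in> borel_measurable Q" and ign: "ignores q \<Psi>"
begin

lemma noise_measurable: "noise q \<Psi> \<in> borel_measurable Q"
proof -
  have "(\<lambda>z. (\<Psi> z, z q)) \<in> measurable Q (borel \<Otimes>\<^sub>M borel)"
    using meas measurable_sample by simp
  from measurable_compose[OF this g_measurable[of "fst q"]]
  have "(\<lambda>z. g (fst q) (\<Psi> z) (z q)) \<in> borel_measurable Q" by simp
  moreover have "(\<lambda>z. grad (fst q) (\<Psi> z)) \<in> borel_measurable Q"
    by (rule measurable_compose[OF meas grad_measurable])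
  ultimately show ?thesis unfolding noise_def[abs_def] by simp
qed

lemma noise_resample: "noise q \<Psi> (z(q := c)) = g (fst q) (\<Psi> z) c - grad (fst q) (\<Psi> z)"
  using ign by (simp add: noise_def ignores_def)

text \<open>Resampling makes the query point constant in the inner integral, where the oracle's
  variance bound applies. Working with nonnegative integrals first yields the integrability needed
  afterwards.\<close>

lemma nn_integral_noise: "(\<integral>\<^sup>+z. ennreal ((norm (noise q \<Psi> z))\<^sup>2) \<partial>Q) \<le> ennreal (\<sigma>\<^sup>2)"
proof -
  have "(\<integral>\<^sup>+z. ennreal ((norm (noise q \<Psi> z))\<^sup>2) \<partial>Q)
      = (\<integral>\<^sup>+z. \<integral>\<^sup>+c. ennreal ((norm (noise q \<Psi> (z(q := c))))\<^sup>2) \<partial>D (fst q) \<partial>Q)"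
    by (rule nn_integral_resample) (use noise_measurable in simp)
  also have "\<dots> \<le> (\<integral>\<^sup>+z. ennreal (\<sigma>\<^sup>2) \<partial>Q)"
    unfolding noise_resample by (intro nn_integral_mono g_variance)
  also have "\<dots> = ennreal (\<sigma>\<^sup>2)" by (simp add: Q.emeasure_space_1)
  finally show ?thesis .
qed

lemma noise_square_integrable: "square_integrable Q (noise q \<Psi>)"
  unfolding square_integrable_def
proof (intro conjI noise_measurable integrableI_nonneg)
  show "(\<integral>\<^sup>+z. ennreal ((norm (noise q \<Psi> z))\<^sup>2) \<partial>Q) < \<infinity>"
    using nn_integral_noise by (rule le_less_trans) simp
qed (use noise_measurable in auto)

lemma noise_variance: "(\<integral>z. (norm (noise q \<Psi> z))\<^sup>2 \<partial>Q) \<le> \<sigma>\<^sup>2"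
proof -
  have "ennreal (\<integral>z. (norm (noise q \<Psi> z))\<^sup>2 \<partial>Q) = (\<integral>\<^sup>+z. ennreal ((norm (noise q \<Psi> z))\<^sup>2) \<partial>Q)"
    by (intro nn_integral_eq_integral[symmetric] square_integrable_norm_power2 noise_square_integrable) auto
  also have "\<dots> \<le> ennreal (\<sigma>\<^sup>2)" by (rule nn_integral_noise)
  finally show ?thesis by (simp add: ennreal_le_iff)
qed

text \<open>After resampling \<open>q\<close>, \<Phi> leaves the inner integral, and what remains
  there is the mean of an unbiased error.\<close>

lemma noise_orthogonal:
  assumes \<Phi>: "square_integrable Q \<Phi>" "ignores q \<Phi>"
  shows "(\<integral>z. \<Phi> z \<bullet> noise q \<Psi> z \<partial>Q) = 0"
proof -
  interpret D: prob_space "D (fst q)" by (rule prob_D)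
  have "(\<integral>z. \<Phi> z \<bullet> noise q \<Psi> z \<partial>Q) = (\<integral>z. \<integral>c. \<Phi> (z(q := c)) \<bullet> noise q \<Psi> (z(q := c)) \<partial>D (fst q) \<partial>Q)"
    by (rule integral_resample) (rule square_integrable_inner[OF \<Phi>(1) noise_square_integrable])
  also have "\<dots> = (\<integral>z. \<Phi> z \<bullet> (\<integral>c. g (fst q) (\<Psi> z) c - grad (fst q) (\<Psi> z) \<partial>D (fst q)) \<partial>Q)"
    using \<Phi>(2) g_integrable by (simp add: noise_resample ignores_def)
  also have "\<dots> = 0"
    using g_integrable by (simp add: Bochner_Integration.integral_diff g_unbiased D.prob_space)
  finally show ?thesis .
qed

end

end

section \<open>The stochastic gradient tracking process\<close>

lemma norm_power2_add:
  "(norm (X + Y))\<^sup>2 = (norm X)\<^sup>2 + 2 * (X \<bullet> Y) + (norm (Y :: 'a::real_inner))\<^sup>2"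
  by (simp add: power2_norm_eq_inner inner_add_left inner_add_right inner_commute)

text \<open>Young's inequality with a free weight, the source of the coefficients of A.\<close>

lemma power2_add_le_weighted:
  fixes a b c :: real
  assumes "0 < c"
  shows "(a + b)\<^sup>2 \<le> (1 + c) * a\<^sup>2 + (1 + 1 / c) * b\<^sup>2"
proof -
  have "0 \<le> (c * a - b)\<^sup>2 / c" using assms by simp
  also have "\<dots> = c * a\<^sup>2 - 2 * a * b + b\<^sup>2 / c"
    using assms by (simp add: power2_eq_square field_simps)
  finally show ?thesis by (simp add: power2_sum distrib_right)
qed

text \<open>The step size enters the recursions through \<alpha> L <= 1/2 and positivity of
  \<open>beta\<close>; the bound involving \<Gamma> serves to solve them.\<close>

locale dsgt_process = mixing E W + oracle_noise D g grad \<sigma>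
  for E :: "('n::finite \<times> 'n) set" and W :: "real^'n^'n"
    and D :: "'n \<Rightarrow> (real^'m::finite) measure"
    and g :: "'n \<Rightarrow> real^'p::finite \<Rightarrow> real^'m \<Rightarrow> real^'p"
    and grad :: "'n \<Rightarrow> real^'p \<Rightarrow> real^'p" and \<sigma> :: real +
  fixes f :: "'n \<Rightarrow> real^'p \<Rightarrow> real" and \<mu> L \<alpha> :: real and x0 :: "real^'p^'n"
  assumes cost: "strongly_convex_smooth (f i) (grad i) \<mu> L"
    and L_pos: "0 < L" and \<alpha>_pos: "0 < \<alpha>" and \<alpha>L: "\<alpha> * L \<le> 1 / 2"
    and \<rho>_pos: "0 < rho_w W" and \<rho>_lt_1: "rho_w W < 1" and beta_pos: "0 < beta L (rho_w W) \<alpha>"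
begin

abbreviation "\<rho> \<equiv> rho_w W"

lemma \<mu>_pos: "0 < \<mu>"
  using cost by (auto simp: strongly_convex_smooth_def)

definition Grad :: "real^'p^'n \<Rightarrow> real^'p^'n" where "Grad X = (\<chi> i. grad i (X $ i))"

lemma Grad_nth [simp]: "Grad X $ i = grad i (X $ i)"
  by (simp add: Grad_def)

lemma grad_lipschitz: "norm (grad i u - grad i v) \<le> L * norm (u - v)"
  using cost[of i] by (simp add: strongly_convex_smooth_def)

lemma Grad_lipschitz: "norm (Grad X - Grad Y) \<le> L * norm (X - Y)"
proof (rule power2_le_imp_le)
  have "(norm (Grad X - Grad Y))\<^sup>2 \<le> (\<Sum>i\<in>UNIV. (L * norm (X $ i - Y $ i))\<^sup>2)"
    unfolding norm_power2_rows[of "Grad X - Grad Y"] by (intro sum_mono power_mono) (simp_all add: grad_lipschitz)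
  also have "\<dots> = (L * norm (X - Y))\<^sup>2"
    by (simp add: norm_power2_rows[of "X - Y"] power_mult_distrib sum_distrib_left)
  finally show "(norm (Grad X - Grad Y))\<^sup>2 \<le> (L * norm (X - Y))\<^sup>2" .
qed (use L_pos in simp)

definition avg_grad :: "real^'p \<Rightarrow> real^'p" where "avg_grad u = row_avg (Grad (\<chi> i. u))"

lemma avg_grad_eq: "avg_grad u = (1 / real CARD('n)) *\<^sub>R (\<Sum>i\<in>UNIV. grad i u)"
  by (simp add: avg_grad_def row_avg_eq)

text \<open>Both averages are row averages of stacked gradients, at \<open>X\<close> and at its
  consensus. Averaging gains a factor n in the square, and the Lipschitz bound brings in the
  consensus error.\<close>

lemma row_avg_Grad_error:
  "real CARD('n) * (norm (row_avg (Grad X) - avg_grad (row_avg X)))\<^sup>2 \<le> L\<^sup>2 * (norm (consensus_error X))\<^sup>2"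
proof -
  have "real CARD('n) * (norm (row_avg (Grad X) - avg_grad (row_avg X)))\<^sup>2 \<le> (norm (Grad X - Grad (\<chi> i. row_avg X)))\<^sup>2"
    using norm_power2_row_avg_le[of "Grad X - Grad (\<chi> i. row_avg X)"] by (simp add: avg_grad_def row_avg_diff)
  also have "\<dots> \<le> (L * norm (consensus_error X))\<^sup>2"
    unfolding consensus_error_def by (intro power_mono Grad_lipschitz) simp
  finally show ?thesis by (simp add: power_mult_distrib)
qed

sublocale avg: strongly_convex_smooth "avg_cost f" avg_grad \<mu> L
proof
  fix u v :: "real^'p"
  have "(avg_cost f has_derivative (\<lambda>h. (1 / real CARD('n)) * (\<Sum>i\<in>UNIV. h \<bullet> grad i u))) (at u)"
    unfolding avg_cost_def
    using strongly_convex_smooth.gderiv[OF cost]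
    by (intro has_derivative_mult_right has_derivative_sum) (simp add: gderiv_def)
  then show "GDERIV (avg_cost f) u :> avg_grad u"
    by (simp add: gderiv_def avg_grad_eq inner_sum_right)
  have "(\<Sum>i\<in>(UNIV::'n set). \<mu> * (norm (u - v))\<^sup>2) \<le> (\<Sum>i\<in>UNIV. (grad i u - grad i v) \<bullet> (u - v))"
    by (intro sum_mono strongly_convex_smooth.strong[OF cost])
  also have "\<dots> = real CARD('n) * ((avg_grad u - avg_grad v) \<bullet> (u - v))"
    by (simp add: avg_grad_eq inner_diff_left inner_sum_left sum_subtractf right_diff_distrib)
  finally show "\<mu> * (norm (u - v))\<^sup>2 \<le> (avg_grad u - avg_grad v) \<bullet> (u - v)" by simp
  have "norm (avg_grad u - avg_grad v) \<le> 1 / real CARD('n) * norm (\<Sum>i\<in>UNIV. grad i u - grad i v)"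
    by (simp add: avg_grad_eq sum_subtractf flip: scaleR_diff_right)
  also have "\<dots> \<le> 1 / real CARD('n) * (\<Sum>i\<in>(UNIV::'n set). L * norm (u - v))"
    by (intro mult_left_mono order_trans[OF norm_sum] sum_mono grad_lipschitz) auto
  also have "\<dots> = L * norm (u - v)" by simp
  finally show "norm (avg_grad u - avg_grad v) \<le> L * norm (u - v)" .
qed (rule \<mu>_pos)

abbreviation "xstar \<equiv> minimizer f"

lemma avg_grad_minimizer: "avg_grad xstar = 0"
  unfolding minimizer_def by (rule avg.arg_min_gradient_zero)

lemma \<alpha>\<mu>: "0 < \<alpha> * \<mu>" "\<alpha> * \<mu> \<le> 1 / 2"
proof -
  show "0 < \<alpha> * \<mu>" using \<alpha>_pos \<mu>_pos by simp
  have "\<alpha> * \<mu> \<le> \<alpha> * L" using \<alpha>_pos avg.\<mu>_le_L by simp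
  with \<alpha>L show "\<alpha> * \<mu> \<le> 1 / 2" by linarith
qed

definition xs :: "nat \<Rightarrow> ('n \<times> nat \<Rightarrow> real^'m) \<Rightarrow> real^'p^'n" where
  "xs k z = fst (dsgt W g \<alpha> x0 (\<lambda>i l. z (i, l)) k)"
definition ys :: "nat \<Rightarrow> ('n \<times> nat \<Rightarrow> real^'m) \<Rightarrow> real^'p^'n" where
  "ys k z = snd (dsgt W g \<alpha> x0 (\<lambda>i l. z (i, l)) k)"
definition ns :: "nat \<Rightarrow> ('n \<times> nat \<Rightarrow> real^'m) \<Rightarrow> real^'p^'n" where
  "ns k z = (\<chi> i. g i (xs k z $ i) (z (i, k)) - grad i (xs k z $ i))"

text \<open>The part of the tracking variable that does not involve the samples of the current step.\<close>
definition yp :: "nat \<Rightarrow> ('n \<times> nat \<Rightarrow> real^'m) \<Rightarrow> real^'p^'n" where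
  "yp k z = ys k z - ns k z"

lemma xs_0: "xs 0 z = x0" by (simp add: xs_def)

lemma xs_Suc: "xs (Suc k) z = W ** (xs k z - \<alpha> *\<^sub>R ys k z)"
  by (rule vec_rows_eqI) (simp add: xs_def ys_def case_prod_unfold Let_def matrix_mult_row)

lemma ys_0: "ys 0 z = Grad x0 + ns 0 z"
  by (rule vec_rows_eqI) (simp add: ys_def ns_def xs_def)

lemma ys_Suc: "ys (Suc k) z = W ** ys k z + (Grad (xs (Suc k) z) + ns (Suc k) z) - (Grad (xs k z) + ns k z)"
  by (rule vec_rows_eqI) (simp add: ys_def ns_def xs_def case_prod_unfold Let_def matrix_mult_row)

lemma yp_0: "yp 0 z = Grad x0" by (simp add: yp_def ys_0)

lemma yp_Suc: "yp (Suc k) z = W ** ys k z + Grad (xs (Suc k) z) - (Grad (xs k z) + ns k z)"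
  by (simp add: yp_def ys_Suc)

lemma ys_split: "ys k z = yp k z + ns k z" by (simp add: yp_def)

text \<open>The tracking invariant: mixing preserves the average and the stochastic gradient
  differences telescope, starting from y_0, which is itself a stochastic gradient.\<close>

lemma row_avg_ys: "row_avg (ys k z) = row_avg (Grad (xs k z)) + row_avg (ns k z)"
proof (induction k)
  case 0
  then show ?case by (simp add: ys_0 xs_0 row_avg_add)
next
  case (Suc k)
  then show ?case by (simp add: ys_Suc row_avg_add row_avg_diff row_avg_W)
qed

lemma row_avg_xs_Suc: "row_avg (xs (Suc k) z) = row_avg (xs k z) - \<alpha> *\<^sub>R row_avg (ys k z)"
  by (simp add: xs_Suc row_avg_W row_avg_diff row_avg_scaleR)

lemma ns_nth_noise: "(\<lambda>z. ns k z $ i) = noise (i, k) (\<lambda>z. xs k z $ i)"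
  by (simp add: ns_def noise_def fun_eq_iff)

text \<open>\<open>xs k\<close> and \<open>yp k\<close> are built from samples of times before k
  only. Time k itself may be altered because \<open>yp\<close> has the current noise
  removed.\<close>

lemma resample_future:
  "k \<le> snd q \<Longrightarrow> xs k (z(q := c)) = xs k z \<and> yp k (z(q := c)) = yp k z"
proof (induction k)
  case 0
  then show ?case by (simp add: xs_0 yp_0)
next
  case (Suc k)
  then have k: "k < snd q" by simp
  with Suc have IH: "xs k (z(q := c)) = xs k z" "yp k (z(q := c)) = yp k z"
    by (blast dest: less_imp_le)+
  have "(z(q := c)) (i, k) = z (i, k)" for i using k by auto
  then have ns: "ns k (z(q := c)) = ns k z" unfolding ns_def IH by presburger
  then have "ys k (z(q := c)) = ys k z" unfolding ys_split IH by presburger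
  then show ?case unfolding yp_Suc xs_Suc IH ns by simp
qed

lemma ignores_xs: "k \<le> l \<Longrightarrow> ignores (i, l) (xs k)"
  and ignores_yp: "k \<le> l \<Longrightarrow> ignores (i, l) (yp k)"
  by (simp_all add: ignores_def resample_future)

text \<open>Within one time step, the noise of one agent does not see the sample of another; this is
  what makes the noises of different agents uncorrelated.\<close>

lemma ignores_ns_nth: "k \<le> l \<Longrightarrow> (j, k) \<noteq> (i, l) \<Longrightarrow> ignores (i, l) (\<lambda>z. ns k z $ j)"
  by (auto simp: ignores_def ns_def resample_future)

lemma ignores_ns: "k < l \<Longrightarrow> ignores (i, l) (ns k)"
  using ignores_ns_nth[of k l _ i] by (simp add: ignores_def Finite_Cartesian_Product.vec_eq_iff)

lemma ignores_ys: "k < l \<Longrightarrow> ignores (i, l) (ys k)"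
  using ignores_ns[of k l i] ignores_yp[of k l i] by (simp add: ignores_def ys_split)

lemma square_integrable_Grad:
  assumes "square_integrable Q X"
  shows "square_integrable Q (\<lambda>z. Grad (X z))"
proof -
  have m: "(\<lambda>z. Grad (X z)) \<in> borel_measurable Q"
    unfolding Grad_def
    by (intro borel_measurable_vec_lambda measurable_compose[OF _ grad_measurable] borel_measurable_vec_nth
        square_integrable_measurable assms)
  \<comment> \<open>The Lipschitz bound gives linear growth only after the value at 0 is
    subtracted.\<close>
  have "square_integrable Q (\<lambda>z. Grad (X z) - Grad 0)"
  proof (rule square_integrable_bound[OF square_integrable_scaleR[OF assms, of L]])
    show "norm (Grad (X z) - Grad 0) \<le> norm (L *\<^sub>R X z)" for z
      using Grad_lipschitz[of "X z" 0] L_pos by simp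
  qed (use m in simp)
  from square_integrable_add[OF this Q.square_integrable_const[of "Grad 0"]] show ?thesis by simp
qed

lemma square_integrable_matrix_mult:
  fixes X :: "_ \<Rightarrow> real^'p^'n" and A :: "real^'n^'n"
  assumes "square_integrable Q X"
  shows "square_integrable Q (\<lambda>z. A ** X z)"
proof (rule square_integrable_linear[OF assms])
  show "bounded_linear (\<lambda>X :: real^'p^'n. A ** X)"
    by (rule bounded_linear_intro[where K = "norm A"])
      (simp_all add: matrix_add_ldistrib matrix_scaleR_right mult.commute[of _ "norm A"] norm_matrix_mult_le)
qed

lemma square_integrable_ns_from_xs:
  assumes "square_integrable Q (xs k)"
  shows "square_integrable Q (ns k)"
proof -
  have "square_integrable Q (\<lambda>z. ns k z $ i)" for i
    unfolding ns_nth_noise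
  proof (rule noise_square_integrable)
    show "(\<lambda>z. xs k z $ i) \<in> borel_measurable Q"
      by (rule borel_measurable_vec_nth[OF square_integrable_measurable[OF assms]])
    show "ignores (i, k) (\<lambda>z. xs k z $ i)"
      using ignores_xs[of k k i] by (simp add: ignores_def)
  qed
  from square_integrable_vec_lambda[of Q "\<lambda>i z. ns k z $ i", OF this] show ?thesis by simp
qed

text \<open>The tracker at the next step contains noise evaluated at the next iterate, so in each
  inductive step the iterate has to be settled first.\<close>

lemma square_integrable_xs_ys: "square_integrable Q (xs k) \<and> square_integrable Q (ys k)"
proof (induction k)
  case 0
  have x: "square_integrable Q (xs 0)"
    using Q.square_integrable_const[of x0] by (simp add: xs_0[abs_def])
  have "square_integrable Q (\<lambda>z. Grad x0 + ns 0 z)"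
    by (intro square_integrable_add Q.square_integrable_const square_integrable_ns_from_xs x)
  then show ?case using x by (simp add: ys_0[abs_def])
next
  case (Suc k)
  have x: "square_integrable Q (xs (Suc k))"
    unfolding xs_Suc[abs_def]
    by (intro square_integrable_matrix_mult square_integrable_diff square_integrable_scaleR Suc[THEN conjunct1] Suc[THEN conjunct2])
  moreover have "square_integrable Q (ys (Suc k))"
    unfolding ys_Suc[abs_def]
    by (intro square_integrable_matrix_mult square_integrable_diff square_integrable_add square_integrable_Grad
        square_integrable_ns_from_xs x Suc[THEN conjunct1] Suc[THEN conjunct2])
  ultimately show ?case ..
qed

lemma square_integrable_xs: "square_integrable Q (xs k)"
  and square_integrable_ys: "square_integrable Q (ys k)"
  and square_integrable_ns: "square_integrable Q (ns k)"
  and square_integrable_yp: "square_integrable Q (yp k)"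
  using square_integrable_xs_ys[of k] square_integrable_ns_from_xs[of k]
    square_integrable_diff[of Q "ys k" "ns k"] by (auto simp: yp_def[abs_def])

lemma square_integrable_consensus_error:
  assumes "square_integrable Q X"
  shows "square_integrable Q (\<lambda>z. consensus_error (X z :: real^'p^'n))"
proof (rule square_integrable_linear[OF assms])
  show "bounded_linear (consensus_error :: real^'p^'n \<Rightarrow> _)"
    by (rule bounded_linear_intro[where K = 1])
      (simp_all add: consensus_error_add consensus_error_scaleR norm_consensus_error_le)
qed

lemma square_integrable_row_avg:
  assumes "square_integrable Q X"
  shows "square_integrable Q (\<lambda>z. row_avg (X z :: real^'p^'n))"
proof (rule square_integrable_linear[OF assms])
  show "bounded_linear (row_avg :: real^'p^'n \<Rightarrow> _)"
  proof (rule bounded_linear_intro[where K = 1])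
    fix X :: "real^'p^'n"
    have "1 * (norm (row_avg X))\<^sup>2 \<le> real CARD('n) * (norm (row_avg X))\<^sup>2"
      by (intro mult_right_mono) (auto simp: Suc_leI)
    also have "\<dots> \<le> (norm X)\<^sup>2" by (rule norm_power2_row_avg_le)
    finally show "norm (row_avg X) \<le> norm X * 1" by (simp add: power2_le_iff_abs_le)
  qed (simp_all add: row_avg_add row_avg_scaleR)
qed

lemma ns_measurability_conditions:
  "(\<lambda>z. xs k z $ i) \<in> borel_measurable Q" "ignores (i, k) (\<lambda>z. xs k z $ i)"
proof -
  show "(\<lambda>z. xs k z $ i) \<in> borel_measurable Q"
    by (rule borel_measurable_vec_nth[OF square_integrable_measurable[OF square_integrable_xs]])
  show "ignores (i, k) (\<lambda>z. xs k z $ i)"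
    using ignores_xs[of k k i] by (simp add: ignores_def)
qed

lemma expectation_inner_ns_nth:
  assumes "square_integrable Q \<Phi>" "ignores (i, k) \<Phi>"
  shows "(\<integral>z. \<Phi> z \<bullet> ns k z $ i \<partial>Q) = 0"
  using noise_orthogonal[OF ns_measurability_conditions assms] ns_nth_noise[of k i]
  by (simp add: fun_eq_iff)

lemma expectation_norm_ns_nth: "(\<integral>z. (norm (ns k z $ i))\<^sup>2 \<partial>Q) \<le> \<sigma>\<^sup>2"
  using noise_variance[OF ns_measurability_conditions, of i k] ns_nth_noise[of k i]
  by (simp add: fun_eq_iff)

end

lemma ignores_compose: "ignores q \<Phi> \<Longrightarrow> ignores q (\<lambda>z. h (\<Phi> z))"
  by (simp add: ignores_def)

lemma ignores_compose2: "ignores q \<Phi> \<Longrightarrow> ignores q \<Psi> \<Longrightarrow> ignores q (\<lambda>z. h (\<Phi> z) (\<Psi> z))"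
  by (simp add: ignores_def)

section \<open>Mean-square recursions for the average and the consensus error\<close>

context dsgt_process
begin

definition V1 :: "nat \<Rightarrow> real" where "V1 k = (\<integral>z. (norm (row_avg (xs k z) - xstar))\<^sup>2 \<partial>Q)"
definition V2 :: "nat \<Rightarrow> real" where "V2 k = (\<integral>z. (norm (consensus_error (xs k z)))\<^sup>2 \<partial>Q)"
definition V3 :: "nat \<Rightarrow> real" where "V3 k = (\<integral>z. (norm (consensus_error (ys k z)))\<^sup>2 \<partial>Q)"

lemma square_integrable_u: "square_integrable Q (\<lambda>z. row_avg (xs k z) - xstar)"
  by (intro square_integrable_diff square_integrable_row_avg square_integrable_xs Q.square_integrable_const)

lemmas integrable_V =
  square_integrable_norm_power2[OF square_integrable_u]
  square_integrable_norm_power2[OF square_integrable_consensus_error[OF square_integrable_xs]]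
  square_integrable_norm_power2[OF square_integrable_consensus_error[OF square_integrable_ys]]

lemma square_integrable_ns_nth: "square_integrable Q (\<lambda>z. ns k z $ i)"
  by (rule square_integrable_vec_nth[OF square_integrable_ns])

lemma expectation_inner_ns:
  assumes "square_integrable Q \<Phi>" "\<And>i. ignores (i, k) (\<lambda>z. \<Phi> z $ i)"
  shows "(\<integral>z. \<Phi> z \<bullet> ns k z \<partial>Q) = 0"
proof -
  have "(\<integral>z. \<Phi> z \<bullet> ns k z \<partial>Q) = (\<Sum>i\<in>UNIV. \<integral>z. \<Phi> z $ i \<bullet> ns k z $ i \<partial>Q)"
    unfolding inner_vec_def[of "\<Phi> _"]
    by (rule Bochner_Integration.integral_sum)
      (intro square_integrable_inner square_integrable_vec_nth assms square_integrable_ns)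
  also have "\<dots> = 0"
    by (intro sum.neutral ballI expectation_inner_ns_nth square_integrable_vec_nth assms)
  finally show ?thesis .
qed

lemma expectation_norm_ns: "(\<integral>z. (norm (ns k z))\<^sup>2 \<partial>Q) \<le> real CARD('n) * \<sigma>\<^sup>2"
proof -
  have "(\<integral>z. (norm (ns k z))\<^sup>2 \<partial>Q) = (\<Sum>i\<in>UNIV. \<integral>z. (norm (ns k z $ i))\<^sup>2 \<partial>Q)"
    unfolding norm_power2_rows[of "ns k _"]
    by (rule Bochner_Integration.integral_sum) (intro square_integrable_norm_power2 square_integrable_ns_nth)
  also have "\<dots> \<le> (\<Sum>i\<in>(UNIV::'n set). \<sigma>\<^sup>2)"
    by (intro sum_mono expectation_norm_ns_nth)
  finally show ?thesis by simp
qed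

text \<open>Noises of different agents are uncorrelated, so only the diagonal of the quadratic form
  survives. It is applied to the averaging matrix and to W minus that matrix.\<close>

lemma expectation_quadratic_ns:
  "(\<integral>z. ((A :: real^'n^'n) ** ns k z) \<bullet> ns k z \<partial>Q) = (\<Sum>i\<in>UNIV. A $ i $ i * (\<integral>z. (norm (ns k z $ i))\<^sup>2 \<partial>Q))"
proof -
  have int: "integrable Q (\<lambda>z. ns k z $ j \<bullet> ns k z $ i)" for i j
    by (intro square_integrable_inner square_integrable_ns_nth)
  have "(\<integral>z. (A ** ns k z) \<bullet> ns k z \<partial>Q)
      = (\<integral>z. (\<Sum>i\<in>UNIV. \<Sum>j\<in>UNIV. A $ i $ j * (ns k z $ j \<bullet> ns k z $ i)) \<partial>Q)"
    by (simp add: inner_vec_def[of "A ** _"] matrix_mult_row inner_sum_left)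
  also have "\<dots> = (\<Sum>i\<in>UNIV. \<Sum>j\<in>UNIV. A $ i $ j * (\<integral>z. ns k z $ j \<bullet> ns k z $ i \<partial>Q))"
    using int by (simp add: Bochner_Integration.integral_sum)
  also have "\<dots> = (\<Sum>i\<in>UNIV. \<Sum>j\<in>UNIV. if j = i then A $ i $ i * (\<integral>z. (norm (ns k z $ i))\<^sup>2 \<partial>Q) else 0)"
  proof (intro sum.cong refl)
    fix i j
    show "A $ i $ j * (\<integral>z. ns k z $ j \<bullet> ns k z $ i \<partial>Q)
      = (if j = i then A $ i $ i * (\<integral>z. (norm (ns k z $ i))\<^sup>2 \<partial>Q) else 0)"
      using expectation_inner_ns_nth[OF square_integrable_ns_nth[of k j] ignores_ns_nth[of k k j i]]
      by (simp add: dot_square_norm)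
  qed
  finally show ?thesis by simp
qed

text \<open>The squared average is the quadratic form of the averaging matrix, whose diagonal
  entries 1/n give the variance reduction.\<close>

lemma expectation_row_avg_ns: "real CARD('n) * (\<integral>z. (norm (row_avg (ns k z)))\<^sup>2 \<partial>Q) \<le> \<sigma>\<^sup>2"
proof -
  have "((\<chi> i j. 1 / real CARD('n)) ** X) \<bullet> X = real CARD('n) * (norm (row_avg X))\<^sup>2" for X :: "real^'p^'n"
    by (simp add: avg_mult inner_vec_def[of _ X] sum_rows dot_square_norm flip: inner_sum_right)
  then have "real CARD('n) * (\<integral>z. (norm (row_avg (ns k z)))\<^sup>2 \<partial>Q)
      = (\<integral>z. ((\<chi> i j. 1 / real CARD('n)) ** ns k z) \<bullet> ns k z \<partial>Q)" by simp
  also have "\<dots> = (\<Sum>i\<in>UNIV. (1 / real CARD('n)) * (\<integral>z. (norm (ns k z $ i))\<^sup>2 \<partial>Q))"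
    unfolding expectation_quadratic_ns by simp
  also have "\<dots> \<le> (\<Sum>i\<in>(UNIV::'n set). (1 / real CARD('n)) * \<sigma>\<^sup>2)"
    by (intro sum_mono mult_left_mono expectation_norm_ns_nth) auto
  finally show ?thesis by simp
qed

lemma expectation_inner_row_avg_ns:
  assumes \<Phi>: "square_integrable Q \<Phi>" "\<And>i. ignores (i, k) \<Phi>"
  shows "(\<integral>z. \<Phi> z \<bullet> row_avg (ns k z) \<partial>Q) = 0"
proof -
  have "\<Phi> z \<bullet> row_avg (ns k z) = (1 / real CARD('n)) * ((\<chi> i. \<Phi> z) \<bullet> ns k z)" for z
    by (simp add: inner_vec_def[of _ "ns k z"] row_avg_eq inner_sum_right)
  moreover have "(\<integral>z. (\<chi> i. \<Phi> z) \<bullet> ns k z \<partial>Q) = 0"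
    by (rule expectation_inner_ns) (simp_all add: \<Phi> square_integrable_vec_lambda)
  ultimately show ?thesis by simp
qed

lemma square_integrable_row_avg_ns: "square_integrable Q (\<lambda>z. row_avg (ns k z))"
  by (intro square_integrable_row_avg square_integrable_ns)

text \<open>An exact gradient step on the average cost contracts by 1 - \<alpha>\<mu>; replacing its
  gradient by the average of gradients at the agents' own points costs \<alpha> |e|, which consensus
  controls.\<close>

lemma descent_pointwise:
  "(norm (row_avg X - xstar - \<alpha> *\<^sub>R row_avg (Grad X)))\<^sup>2
    \<le> (1 - \<alpha> * \<mu>) * (norm (row_avg X - xstar))\<^sup>2
      + \<alpha> * L\<^sup>2 / (\<mu> * real CARD('n)) * (1 + \<alpha> * \<mu>) * (norm (consensus_error X))\<^sup>2"
proof -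
  define u where "u = row_avg X - xstar"
  define e where "e = avg_grad (row_avg X) - row_avg (Grad X)"
  have "norm (u - \<alpha> *\<^sub>R row_avg (Grad X)) = norm ((u - \<alpha> *\<^sub>R avg_grad (row_avg X)) + \<alpha> *\<^sub>R e)"
    by (simp add: e_def algebra_simps)
  also have "\<dots> \<le> norm (u - \<alpha> *\<^sub>R avg_grad (row_avg X)) + \<alpha> * norm e"
    using norm_triangle_ineq[of "u - \<alpha> *\<^sub>R avg_grad (row_avg X)" "\<alpha> *\<^sub>R e"] \<alpha>_pos by simp
  also have "norm (u - \<alpha> *\<^sub>R avg_grad (row_avg X)) \<le> (1 - \<alpha> * \<mu>) * norm u"
    unfolding u_def using \<alpha>_pos \<alpha>L \<alpha>\<mu>
    by (intro avg.gradient_step_contraction avg_grad_minimizer) auto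
  finally have "(norm (u - \<alpha> *\<^sub>R row_avg (Grad X)))\<^sup>2 \<le> ((1 - \<alpha> * \<mu>) * norm u + \<alpha> * norm e)\<^sup>2"
    by (intro power_mono) auto
  also have "\<dots> \<le> (1 + \<alpha> * \<mu>) * ((1 - \<alpha> * \<mu>) * norm u)\<^sup>2 + (1 + 1 / (\<alpha> * \<mu>)) * (\<alpha> * norm e)\<^sup>2"
    by (rule power2_add_le_weighted) (rule \<alpha>\<mu>)
  \<comment> \<open>The weight \<alpha>\<mu> costs only one of the two contraction factors: (1 +
    \<alpha>\<mu>)(1 - \<alpha>\<mu>)^2 <= 1 - \<alpha>\<mu>.\<close>
  also have "(1 + \<alpha> * \<mu>) * ((1 - \<alpha> * \<mu>) * norm u)\<^sup>2 = (1 - (\<alpha> * \<mu>)\<^sup>2) * ((1 - \<alpha> * \<mu>) * (norm u)\<^sup>2)"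
    by (simp add: power2_eq_square algebra_simps)
  also have "\<dots> \<le> 1 * ((1 - \<alpha> * \<mu>) * (norm u)\<^sup>2)"
    using \<alpha>\<mu> by (intro mult_right_mono) auto
  also have "(1 + 1 / (\<alpha> * \<mu>)) * (\<alpha> * norm e)\<^sup>2 = \<alpha> / \<mu> * (1 + \<alpha> * \<mu>) * (norm e)\<^sup>2"
    using \<alpha>_pos \<mu>_pos by (simp add: power2_eq_square field_simps)
  also have "\<dots> \<le> \<alpha> / \<mu> * (1 + \<alpha> * \<mu>) * (L\<^sup>2 * (norm (consensus_error X))\<^sup>2 / real CARD('n))"
    using row_avg_Grad_error[of X] \<alpha>_pos \<mu>_pos
    by (intro mult_left_mono) (simp_all add: e_def norm_minus_commute pos_le_divide_eq mult.commute)
  finally show ?thesis by (simp add: u_def mult_ac)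
qed

text \<open>\<open>p\<close> depends on samples before time k, so the averaged noise is orthogonal
  to it and contributes only its variance.\<close>

lemma V1_Suc:
  "V1 (Suc k) \<le> (1 - \<alpha> * \<mu>) * V1 k + \<alpha> * L\<^sup>2 / (\<mu> * real CARD('n)) * (1 + \<alpha> * \<mu>) * V2 k
    + \<alpha>\<^sup>2 * \<sigma>\<^sup>2 / real CARD('n)"
proof -
  define p where "p z = row_avg (xs k z) - xstar - \<alpha> *\<^sub>R row_avg (Grad (xs k z))" for z
  define nb where "nb z = row_avg (ns k z)" for z
  have p: "square_integrable Q p"
    unfolding p_def[abs_def]
    by (intro square_integrable_diff square_integrable_scaleR square_integrable_row_avg square_integrable_Grad
        square_integrable_xs Q.square_integrable_const)
  have nb: "square_integrable Q nb"
    unfolding nb_def[abs_def] by (rule square_integrable_row_avg_ns)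
  have "row_avg (xs (Suc k) z) - xstar = p z + (- \<alpha>) *\<^sub>R nb z" for z
    by (simp add: row_avg_xs_Suc row_avg_ys p_def nb_def algebra_simps)
  then have "(norm (row_avg (xs (Suc k) z) - xstar))\<^sup>2
      = (norm (p z))\<^sup>2 - 2 * \<alpha> * (p z \<bullet> nb z) + \<alpha>\<^sup>2 * (norm (nb z))\<^sup>2" for z
    by (simp only: norm_power2_add) (simp add: power_mult_distrib)
  then have "V1 (Suc k) = (\<integral>z. (norm (p z))\<^sup>2 - 2 * \<alpha> * (p z \<bullet> nb z) + \<alpha>\<^sup>2 * (norm (nb z))\<^sup>2 \<partial>Q)"
    by (simp add: V1_def)
  also have "\<dots> = (\<integral>z. (norm (p z))\<^sup>2 \<partial>Q) - 2 * \<alpha> * (\<integral>z. p z \<bullet> nb z \<partial>Q) + \<alpha>\<^sup>2 * (\<integral>z. (norm (nb z))\<^sup>2 \<partial>Q)"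
    using square_integrable_inner[OF p nb] p nb by (simp add: square_integrable_norm_power2)
  also have "(\<integral>z. p z \<bullet> nb z \<partial>Q) = 0"
    unfolding nb_def
  proof (rule expectation_inner_row_avg_ns[OF p])
    show "ignores (i, k) p" for i
      unfolding p_def[abs_def] by (rule ignores_compose[OF ignores_xs[OF order_refl]])
  qed
  also have "(\<integral>z. (norm (p z))\<^sup>2 \<partial>Q) \<le> (\<integral>z. (1 - \<alpha> * \<mu>) * (norm (row_avg (xs k z) - xstar))\<^sup>2
      + \<alpha> * L\<^sup>2 / (\<mu> * real CARD('n)) * (1 + \<alpha> * \<mu>) * (norm (consensus_error (xs k z)))\<^sup>2 \<partial>Q)"
    unfolding p_def
    by (intro integral_mono descent_pointwise square_integrable_norm_power2 p[unfolded p_def[abs_def]]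
        Bochner_Integration.integrable_add integrable_mult_right integrable_V)
  also have "\<dots> = (1 - \<alpha> * \<mu>) * V1 k + \<alpha> * L\<^sup>2 / (\<mu> * real CARD('n)) * (1 + \<alpha> * \<mu>) * V2 k"
    using integrable_V by (simp add: V1_def V2_def)
  also have "\<alpha>\<^sup>2 * (\<integral>z. (norm (nb z))\<^sup>2 \<partial>Q) \<le> \<alpha>\<^sup>2 * (\<sigma>\<^sup>2 / real CARD('n))"
    using expectation_row_avg_ns[of k]
    by (intro mult_left_mono) (simp_all add: nb_def pos_le_divide_eq mult.commute)
  finally show ?thesis by simp
qed

text \<open>The mean displacement of the iterates is -\<alpha> times this average, which is how the
  optimality error enters the tracking recursion. The noise is split off by orthogonality, the rest
  is compared with the gradient at the average and at the minimizer.\<close>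

lemma expectation_row_avg_ys:
  "real CARD('n) * (\<integral>z. (norm (row_avg (ys k z)))\<^sup>2 \<partial>Q) \<le> 2 * L\<^sup>2 * V2 k + 2 * real CARD('n) * L\<^sup>2 * V1 k + \<sigma>\<^sup>2"
proof -
  define h where "h z = row_avg (Grad (xs k z))" for z
  define nb where "nb z = row_avg (ns k z)" for z
  have h: "square_integrable Q h"
    unfolding h_def[abs_def] by (intro square_integrable_row_avg square_integrable_Grad square_integrable_xs)
  have nb: "square_integrable Q nb"
    unfolding nb_def[abs_def] by (rule square_integrable_row_avg_ns)
  have "(\<integral>z. (norm (row_avg (ys k z)))\<^sup>2 \<partial>Q) = (\<integral>z. (norm (h z))\<^sup>2 + 2 * (h z \<bullet> nb z) + (norm (nb z))\<^sup>2 \<partial>Q)"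
    by (simp only: row_avg_ys norm_power2_add h_def nb_def)
  also have "\<dots> = (\<integral>z. (norm (h z))\<^sup>2 \<partial>Q) + 2 * (\<integral>z. h z \<bullet> nb z \<partial>Q) + (\<integral>z. (norm (nb z))\<^sup>2 \<partial>Q)"
    using square_integrable_inner[OF h nb] h nb by (simp add: square_integrable_norm_power2)
  also have "(\<integral>z. h z \<bullet> nb z \<partial>Q) = 0"
    unfolding nb_def
  proof (rule expectation_inner_row_avg_ns[OF h])
    show "ignores (i, k) h" for i
      unfolding h_def[abs_def] by (rule ignores_compose[OF ignores_xs[OF order_refl]])
  qed
  finally have eq: "real CARD('n) * (\<integral>z. (norm (row_avg (ys k z)))\<^sup>2 \<partial>Q)
      = (\<integral>z. real CARD('n) * (norm (h z))\<^sup>2 \<partial>Q) + real CARD('n) * (\<integral>z. (norm (nb z))\<^sup>2 \<partial>Q)"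
    by (simp add: distrib_left)
  have "(\<integral>z. real CARD('n) * (norm (h z))\<^sup>2 \<partial>Q) \<le> (\<integral>z. 2 * L\<^sup>2 * (norm (consensus_error (xs k z)))\<^sup>2
      + 2 * real CARD('n) * L\<^sup>2 * (norm (row_avg (xs k z) - xstar))\<^sup>2 \<partial>Q)"
  proof (intro integral_mono Bochner_Integration.integrable_add integrable_mult_right integrable_V
      square_integrable_norm_power2 h)
    fix z
    define e where "e = row_avg (Grad (xs k z)) - avg_grad (row_avg (xs k z))"
    define a where "a = avg_grad (row_avg (xs k z))"
    have "(norm (h z))\<^sup>2 = (norm (e + a))\<^sup>2" by (simp add: h_def e_def a_def)
    also have "\<dots> \<le> (norm e + norm a)\<^sup>2" by (intro power_mono norm_triangle_ineq) simp
    also have "\<dots> \<le> 2 * (norm e)\<^sup>2 + 2 * (norm a)\<^sup>2"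
      using power2_add_le_weighted[of 1 "norm e" "norm a"] by simp
    finally have "real CARD('n) * (norm (h z))\<^sup>2 \<le> real CARD('n) * (2 * (norm e)\<^sup>2 + 2 * (norm a)\<^sup>2)"
      by (intro mult_left_mono) auto
    also have "\<dots> = 2 * (real CARD('n) * (norm e)\<^sup>2) + 2 * (real CARD('n) * (norm a)\<^sup>2)"
      by (simp add: distrib_left)
    finally have "real CARD('n) * (norm (h z))\<^sup>2 \<le> \<dots>" .
    moreover have "real CARD('n) * (norm e)\<^sup>2 \<le> L\<^sup>2 * (norm (consensus_error (xs k z)))\<^sup>2"
      unfolding e_def by (rule row_avg_Grad_error)
    moreover have "(norm a)\<^sup>2 \<le> (L * norm (row_avg (xs k z) - xstar))\<^sup>2"
      using avg.smooth[of "row_avg (xs k z)" xstar] by (intro power_mono) (simp_all add: avg_grad_minimizer a_def)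
    then have "real CARD('n) * (norm a)\<^sup>2 \<le> real CARD('n) * (L\<^sup>2 * (norm (row_avg (xs k z) - xstar))\<^sup>2)"
      by (intro mult_left_mono) (simp_all add: power_mult_distrib)
    ultimately show "real CARD('n) * (norm (h z))\<^sup>2 \<le> 2 * L\<^sup>2 * (norm (consensus_error (xs k z)))\<^sup>2
        + 2 * real CARD('n) * L\<^sup>2 * (norm (row_avg (xs k z) - xstar))\<^sup>2"
      by linarith
  qed
  also have "\<dots> = 2 * L\<^sup>2 * V2 k + 2 * real CARD('n) * L\<^sup>2 * V1 k"
    using integrable_V by (simp add: V1_def V2_def)
  finally show ?thesis
    using eq expectation_row_avg_ns[of k] by (simp add: nb_def)
qed

lemma V2_Suc:
  "V2 (Suc k) \<le> (1 / 2) * (1 + \<rho>\<^sup>2) * V2 k + \<alpha>\<^sup>2 * ((1 + \<rho>\<^sup>2) * \<rho>\<^sup>2 / (1 - \<rho>\<^sup>2)) * V3 k"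
proof -
  \<comment> \<open>This weight turns the factor \<rho>^2 on the old consensus error into the
    midpoint of \<rho>^2 and 1.\<close>
  define c where "c = (1 - \<rho>\<^sup>2) / (2 * \<rho>\<^sup>2)"
  have \<rho>2: "\<rho>\<^sup>2 < 1" using \<rho>_pos \<rho>_lt_1 by (simp add: power_less_one_iff)
  have c: "0 < c" using \<rho>2 \<rho>_pos by (simp add: c_def)
  have "(norm (consensus_error (xs (Suc k) z)))\<^sup>2 \<le> (1 / 2) * (1 + \<rho>\<^sup>2) * (norm (consensus_error (xs k z)))\<^sup>2
      + \<alpha>\<^sup>2 * ((1 + \<rho>\<^sup>2) * \<rho>\<^sup>2 / (1 - \<rho>\<^sup>2)) * (norm (consensus_error (ys k z)))\<^sup>2" for z
  proof -
    let ?X = "norm (consensus_error (xs k z))" and ?Y = "norm (consensus_error (ys k z))"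
    have "consensus_error (xs (Suc k) z) = consensus_error (W ** xs k z) - \<alpha> *\<^sub>R consensus_error (W ** ys k z)"
      by (simp add: xs_Suc matrix_diff_ldistrib matrix_scaleR_right consensus_error_diff consensus_error_scaleR)
    also have "norm \<dots> \<le> norm (consensus_error (W ** xs k z)) + \<alpha> * norm (consensus_error (W ** ys k z))"
      using norm_triangle_ineq4[of "consensus_error (W ** xs k z)" "\<alpha> *\<^sub>R consensus_error (W ** ys k z)"] \<alpha>_pos
      by simp
    also have "\<dots> \<le> \<rho> * ?X + \<alpha> * (\<rho> * ?Y)"
      using \<alpha>_pos by (intro add_mono mult_left_mono norm_consensus_error_W) auto
    finally have "(norm (consensus_error (xs (Suc k) z)))\<^sup>2 \<le> (\<rho> * ?X + \<alpha> * (\<rho> * ?Y))\<^sup>2"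
      by (intro power_mono) auto
    also have "\<dots> \<le> (1 + c) * (\<rho> * ?X)\<^sup>2 + (1 + 1 / c) * (\<alpha> * (\<rho> * ?Y))\<^sup>2"
      by (rule power2_add_le_weighted[OF c])
    also have "\<dots> = ((1 + c) * \<rho>\<^sup>2) * ?X\<^sup>2 + \<alpha>\<^sup>2 * ((1 + 1 / c) * \<rho>\<^sup>2) * ?Y\<^sup>2"
      by (simp add: power_mult_distrib mult_ac)
    also have "(1 + c) * \<rho>\<^sup>2 = (1 / 2) * (1 + \<rho>\<^sup>2)"
      using \<rho>_pos by (simp add: c_def field_simps)
    also have "1 + 1 / c = (1 + \<rho>\<^sup>2) / (1 - \<rho>\<^sup>2)"
      using \<rho>_pos \<rho>2 by (simp add: c_def field_simps)
    finally show ?thesis by simp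
  qed
  then have "V2 (Suc k) \<le> (\<integral>z. (1 / 2) * (1 + \<rho>\<^sup>2) * (norm (consensus_error (xs k z)))\<^sup>2
      + \<alpha>\<^sup>2 * ((1 + \<rho>\<^sup>2) * \<rho>\<^sup>2 / (1 - \<rho>\<^sup>2)) * (norm (consensus_error (ys k z)))\<^sup>2 \<partial>Q)"
    unfolding V2_def
    by (intro integral_mono Bochner_Integration.integrable_add integrable_mult_right integrable_V)
  also have "\<dots> = (1 / 2) * (1 + \<rho>\<^sup>2) * V2 k + \<alpha>\<^sup>2 * ((1 + \<rho>\<^sup>2) * \<rho>\<^sup>2 / (1 - \<rho>\<^sup>2)) * V3 k"
    unfolding V2_def V3_def
    by (simp only: Bochner_Integration.integral_add[OF integrable_mult_right integrable_mult_right]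
        integrable_V integral_mult_right_zero)
  finally show ?thesis .
qed

end

section \<open>Mean-square recursion for the tracking error\<close>

context dsgt_process
begin

text \<open>The pathwise part of the tracking recursion. The displacement X' - X splits orthogonally
  into a consensus part and the mean part -\<alpha> \<open>row_avg Y\<close>.\<close>

lemma tracking_pointwise:
  fixes X Y :: "real^'p^'n"
  defines "X' \<equiv> W ** (X - \<alpha> *\<^sub>R Y)" and "\<beta> \<equiv> beta L \<rho> \<alpha>"
  shows "(norm (consensus_error (W ** Y) + (Grad X' - Grad X)))\<^sup>2
    \<le> (1 / 2) * (1 + \<rho>\<^sup>2) * (norm (consensus_error Y))\<^sup>2
      + (1 / \<beta> + 2) * (dist_id W)\<^sup>2 * L\<^sup>2 * (norm (consensus_error X))\<^sup>2
      + (\<alpha>\<^sup>2 * L\<^sup>2 + \<alpha> * L / 2) * (real CARD('n) * (norm (row_avg Y))\<^sup>2)"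
proof -
  define a where "a = consensus_error (W ** Y)"
  define x y w S where "x = norm (consensus_error X)" and "y = norm (consensus_error Y)"
    and "w = sqrt (real CARD('n)) * norm (row_avg Y)" and "S = norm (X' - X)"
  define d where "d = dist_id W"
  have nonneg: "0 \<le> x" "0 \<le> y" "0 \<le> w" "0 \<le> S" "0 \<le> d"
    by (simp_all add: x_def y_def w_def S_def d_def dist_id_def)
  have w2: "w\<^sup>2 = real CARD('n) * (norm (row_avg Y))\<^sup>2" by (simp add: w_def power_mult_distrib)
  have a: "norm a \<le> \<rho> * y" unfolding a_def y_def by (rule norm_consensus_error_W)
  have \<beta>: "0 < \<beta>" using beta_pos by (simp add: \<beta>_def)
  have ce: "consensus_error (X' - X) = (W ** X - X) - \<alpha> *\<^sub>R a"
  proof -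
    have "consensus_error (W ** X - X) = W ** X - X"
      by (simp add: consensus_error_def row_avg_diff row_avg_W Finite_Cartesian_Product.vec_eq_iff)
    moreover have "X' - X = (W ** X - X) - \<alpha> *\<^sub>R (W ** Y)"
      by (simp add: X'_def matrix_diff_ldistrib matrix_scaleR_right)
    ultimately show ?thesis
      by (simp only: a_def consensus_error_diff[of "W ** X - X"] consensus_error_scaleR)
  qed
  have avg: "row_avg (X' - X) = - (\<alpha> *\<^sub>R row_avg Y)"
    by (simp add: X'_def matrix_diff_ldistrib matrix_scaleR_right row_avg_diff row_avg_scaleR row_avg_W)
  have ce_le: "norm (consensus_error (X' - X)) \<le> d * x + \<alpha> * (\<rho> * y)"
  proof -
    have "norm (consensus_error (X' - X)) \<le> norm (W ** X - X) + \<alpha> * norm a"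
      unfolding ce using norm_triangle_ineq4[of "W ** X - X" "\<alpha> *\<^sub>R a"] \<alpha>_pos by simp
    also have "\<dots> \<le> d * x + \<alpha> * (\<rho> * y)"
      unfolding d_def x_def using a \<alpha>_pos by (intro add_mono mult_left_mono norm_W_minus_id) auto
    finally show ?thesis .
  qed
  have S2_eq: "S\<^sup>2 = (norm (consensus_error (X' - X)))\<^sup>2 + (\<alpha> * w)\<^sup>2"
    using norm_power2_consensus_error[of "X' - X"] by (simp add: S_def avg w2 power_mult_distrib)
  have "(norm (consensus_error (X' - X)))\<^sup>2 \<le> (d * x + \<alpha> * (\<rho> * y))\<^sup>2"
    using ce_le by (intro power_mono) auto
  also have "\<dots> \<le> 2 * (d * x)\<^sup>2 + 2 * (\<alpha> * (\<rho> * y))\<^sup>2"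
    using power2_add_le_weighted[of 1 "d * x" "\<alpha> * (\<rho> * y)"] by simp
  finally have S2: "S\<^sup>2 \<le> 2 * (d * x)\<^sup>2 + 2 * (\<alpha> * (\<rho> * y))\<^sup>2 + (\<alpha> * w)\<^sup>2"
    using S2_eq by simp
  \<comment> \<open>Two estimates of the displacement are kept: \<open>S2\<close> for its square,
    and this linear one for the product with \<rho> y.\<close>
  have S1: "S \<le> d * x + \<alpha> * (\<rho> * y) + \<alpha> * w"
  proof (rule power2_le_imp_le)
    have "S\<^sup>2 \<le> (norm (consensus_error (X' - X)) + \<alpha> * w)\<^sup>2"
      using S2_eq \<alpha>_pos nonneg by (simp add: power2_sum)
    also have "\<dots> \<le> (d * x + \<alpha> * (\<rho> * y) + \<alpha> * w)\<^sup>2"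
      using ce_le \<alpha>_pos nonneg by (intro power_mono) auto
    finally show "S\<^sup>2 \<le> (d * x + \<alpha> * (\<rho> * y) + \<alpha> * w)\<^sup>2" .
  qed (use nonneg \<alpha>_pos \<rho>_pos in auto)
  have "norm (a + (Grad X' - Grad X)) \<le> \<rho> * y + L * S"
    using norm_triangle_ineq[of a "Grad X' - Grad X"] a Grad_lipschitz[of X' X] by (simp add: S_def)
  then have "(norm (a + (Grad X' - Grad X)))\<^sup>2 \<le> (\<rho> * y + L * S)\<^sup>2"
    by (intro power_mono) auto
  also have "\<dots> = (\<rho> * y)\<^sup>2 + 2 * (\<rho> * y) * L * S + L\<^sup>2 * S\<^sup>2"
    by (simp add: power2_sum power_mult_distrib)
  also have "\<dots> \<le> (\<rho> * y)\<^sup>2 + 2 * (\<rho> * y) * L * (d * x + \<alpha> * (\<rho> * y) + \<alpha> * w)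
      + L\<^sup>2 * (2 * (d * x)\<^sup>2 + 2 * (\<alpha> * (\<rho> * y))\<^sup>2 + (\<alpha> * w)\<^sup>2)"
    using S1 S2 nonneg \<rho>_pos L_pos by (intro add_mono mult_left_mono) auto
  also have "\<dots> = (1 + 2 * \<alpha> * L + 2 * \<alpha>\<^sup>2 * L\<^sup>2) * (\<rho> * y)\<^sup>2 + 2 * (\<rho> * y) * (L * d * x)
      + \<alpha> * L * (2 * (\<rho> * y) * w) + L\<^sup>2 * (2 * (d * x)\<^sup>2) + \<alpha>\<^sup>2 * L\<^sup>2 * w\<^sup>2"
    by (simp add: power2_eq_square algebra_simps)
  \<comment> \<open>The cross term with \<open>x\<close> is split with weight \<beta>, the one with
    \<open>w\<close> with weight 2. The latter adds another 2 \<alpha> L, so (\<rho> y)^2 collects 1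
    + \<beta> + 4 \<alpha> L + 2 \<alpha>^2 L^2, and \<open>beta\<close> is defined by setting
    \<rho>^2 times this equal to (1 + \<rho>^2) / 2.\<close>
  also have "\<dots> \<le> (1 + 2 * \<alpha> * L + 2 * \<alpha>\<^sup>2 * L\<^sup>2) * (\<rho> * y)\<^sup>2 + (\<beta> * (\<rho> * y)\<^sup>2 + 1 / \<beta> * (L * d * x)\<^sup>2)
      + \<alpha> * L * (2 * (\<rho> * y)\<^sup>2 + 1 / 2 * w\<^sup>2) + L\<^sup>2 * (2 * (d * x)\<^sup>2) + \<alpha>\<^sup>2 * L\<^sup>2 * w\<^sup>2"
  proof (intro add_mono order_refl mult_left_mono)
    show "2 * (\<rho> * y) * (L * d * x) \<le> \<beta> * (\<rho> * y)\<^sup>2 + 1 / \<beta> * (L * d * x)\<^sup>2"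
      using power2_add_le_weighted[OF \<beta>, of "\<rho> * y" "L * d * x"] by (simp add: power2_sum distrib_right)
    show "2 * (\<rho> * y) * w \<le> 2 * (\<rho> * y)\<^sup>2 + 1 / 2 * w\<^sup>2"
      using power2_add_le_weighted[of 2 "\<rho> * y" w] by (simp add: power2_sum distrib_right)
  qed (use \<alpha>_pos L_pos in auto)
  also have "\<dots> = (1 + \<beta> + 4 * \<alpha> * L + 2 * \<alpha>\<^sup>2 * L\<^sup>2) * \<rho>\<^sup>2 * y\<^sup>2
      + (1 / \<beta> + 2) * d\<^sup>2 * L\<^sup>2 * x\<^sup>2 + (\<alpha>\<^sup>2 * L\<^sup>2 + \<alpha> * L / 2) * w\<^sup>2"
    by (simp add: power_mult_distrib algebra_simps)
  also have "(1 + \<beta> + 4 * \<alpha> * L + 2 * \<alpha>\<^sup>2 * L\<^sup>2) * \<rho>\<^sup>2 = (1 / 2) * (1 + \<rho>\<^sup>2)"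
    using \<rho>_pos by (simp add: \<beta>_def beta_def field_simps)
  finally show ?thesis by (simp only: a_def d_def x_def y_def w2)
qed

text \<open>The tracker contains the current noise. Its remaining part \<open>yp\<close> is
  orthogonal to that noise, and the noise part gives a diagonal form with entries w_ii - 1/n >=
  -1/n, whose n terms add up to at least -\<sigma>^2.\<close>

lemma tracking_noise_correlation: "- \<sigma>\<^sup>2 \<le> (\<integral>z. consensus_error (W ** ys k z) \<bullet> ns k z \<partial>Q)"
proof -
  define B where "B = W - (\<chi> i j. 1 / real CARD('n))"
  have "consensus_error (W ** ys k z) = B ** yp k z + B ** ns k z" for z
    unfolding matrix_add_ldistrib[symmetric] ys_split[symmetric]
    by (simp only: B_def W_minus_avg_mult consensus_error_def row_avg_W)
  then have "(\<integral>z. consensus_error (W ** ys k z) \<bullet> ns k z \<partial>Q)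
      = (\<integral>z. (B ** yp k z) \<bullet> ns k z + (B ** ns k z) \<bullet> ns k z \<partial>Q)"
    by (simp only: inner_add_left)
  also have "\<dots> = (\<integral>z. (B ** yp k z) \<bullet> ns k z \<partial>Q) + (\<integral>z. (B ** ns k z) \<bullet> ns k z \<partial>Q)"
    by (intro Bochner_Integration.integral_add square_integrable_inner square_integrable_matrix_mult
        square_integrable_yp square_integrable_ns)
  also have "(\<integral>z. (B ** yp k z) \<bullet> ns k z \<partial>Q) = 0"
  proof (rule expectation_inner_ns)
    show "ignores (i, k) (\<lambda>z. (B ** yp k z) $ i)" for i
      by (rule ignores_compose[OF ignores_yp[OF order_refl]])
  qed (intro square_integrable_matrix_mult square_integrable_yp)
  also have "(\<integral>z. (B ** ns k z) \<bullet> ns k z \<partial>Q) = (\<Sum>i\<in>UNIV. B $ i $ i * (\<integral>z. (norm (ns k z $ i))\<^sup>2 \<partial>Q))"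
    by (rule expectation_quadratic_ns)
  finally have eq: "(\<integral>z. consensus_error (W ** ys k z) \<bullet> ns k z \<partial>Q)
      = (\<Sum>i\<in>UNIV. B $ i $ i * (\<integral>z. (norm (ns k z $ i))\<^sup>2 \<partial>Q))" by simp
  have "(\<Sum>i\<in>(UNIV::'n set). - (1 / real CARD('n)) * \<sigma>\<^sup>2)
      \<le> (\<Sum>i\<in>UNIV. B $ i $ i * (\<integral>z. (norm (ns k z $ i))\<^sup>2 \<partial>Q))"
  proof (intro sum_mono)
    fix i :: 'n
    have "0 \<le> (\<integral>z. (norm (ns k z $ i))\<^sup>2 \<partial>Q)" by simp
    then have "- (1 / real CARD('n)) * (\<integral>z. (norm (ns k z $ i))\<^sup>2 \<partial>Q) \<le> B $ i $ i * (\<integral>z. (norm (ns k z $ i))\<^sup>2 \<partial>Q)"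
      using W_nonneg[of i i] by (intro mult_right_mono) (simp_all add: B_def)
    moreover have "(1 / real CARD('n)) * (\<integral>z. (norm (ns k z $ i))\<^sup>2 \<partial>Q) \<le> (1 / real CARD('n)) * \<sigma>\<^sup>2"
      by (intro mult_left_mono expectation_norm_ns_nth) auto
    ultimately show "- (1 / real CARD('n)) * \<sigma>\<^sup>2 \<le> B $ i $ i * (\<integral>z. (norm (ns k z $ i))\<^sup>2 \<partial>Q)"
      by linarith
  qed
  then show ?thesis unfolding eq by simp
qed

lemma square_integrable_grad:
  assumes "square_integrable Q X"
  shows "square_integrable Q (\<lambda>z. grad i (X z))"
  using square_integrable_vec_nth[OF square_integrable_Grad[OF square_integrable_vec_lambda[of Q "\<lambda>_. X"]], of i] assms
  by simp

text \<open>
  Agent \<open>i\<close>'s next iterate depends on its own current sample only through \<open>- \<alpha> w\<^sub>i\<^sub>i\<close> times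
  its noise; adding this term back decouples the two.
\<close>

lemma gradient_noise_correlation:
  "- (\<alpha> * L * real CARD('n) * \<sigma>\<^sup>2) \<le> (\<integral>z. (Grad (xs (Suc k) z) - Grad (xs k z)) \<bullet> ns k z \<partial>Q)"
proof -
  have row: "- (\<alpha> * L * \<sigma>\<^sup>2) \<le> (\<integral>z. (Grad (xs (Suc k) z) - Grad (xs k z)) $ i \<bullet> ns k z $ i \<partial>Q)" for i
  proof -
    define xh where "xh z = xs (Suc k) z $ i + (\<alpha> * W $ i $ i) *\<^sub>R ns k z $ i" for z
    have xh: "square_integrable Q xh"
      unfolding xh_def[abs_def]
      by (intro square_integrable_add square_integrable_scaleR square_integrable_vec_nth square_integrable_xs square_integrable_ns)
    have xh_eq: "xh z = (W ** (xs k z - \<alpha> *\<^sub>R yp k z)) $ i - \<alpha> *\<^sub>R (\<Sum>j\<in>UNIV - {i}. W $ i $ j *\<^sub>R ns k z $ j)" for z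
    proof -
      have "(W ** ns k z) $ i = W $ i $ i *\<^sub>R ns k z $ i + (\<Sum>j\<in>UNIV - {i}. W $ i $ j *\<^sub>R ns k z $ j)"
        by (simp add: matrix_mult_row sum.remove[of UNIV i])
      then show ?thesis
        by (simp add: xh_def xs_Suc ys_split scaleR_right_distrib matrix_diff_ldistrib matrix_add_ldistrib
            matrix_scaleR_right)
    qed
    have ign: "ignores (i, k) xh"
    proof -
      have "ns k (z((i, k) := c)) $ j = ns k z $ j" if "j \<noteq> i" for j z c
        using ignores_ns_nth[of k k j i] that by (simp add: ignores_def)
      then have "(\<Sum>j\<in>UNIV - {i}. W $ i $ j *\<^sub>R ns k (z((i, k) := c)) $ j) = (\<Sum>j\<in>UNIV - {i}. W $ i $ j *\<^sub>R ns k z $ j)" for z c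
        by (intro sum.cong) auto
      moreover have "xs k (z((i, k) := c)) = xs k z" "yp k (z((i, k) := c)) = yp k z" for z c
        using resample_future[of k "(i, k)"] by simp_all
      ultimately show ?thesis unfolding ignores_def xh_eq by presburger
    qed
    define dh where "dh z = grad i (xh z) - grad i (xs k z $ i)" for z
    define r where "r z = grad i (xs (Suc k) z $ i) - grad i (xh z)" for z
    have dh: "square_integrable Q dh"
      unfolding dh_def[abs_def]
      by (intro square_integrable_diff square_integrable_grad square_integrable_vec_nth square_integrable_xs xh)
    have r: "square_integrable Q r"
      unfolding r_def[abs_def]
      by (intro square_integrable_diff square_integrable_grad square_integrable_vec_nth square_integrable_xs xh)
    have "(\<integral>z. (Grad (xs (Suc k) z) - Grad (xs k z)) $ i \<bullet> ns k z $ i \<partial>Q)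
        = (\<integral>z. dh z \<bullet> ns k z $ i + r z \<bullet> ns k z $ i \<partial>Q)"
      by (simp add: dh_def r_def flip: inner_add_left)
    also have "\<dots> = (\<integral>z. dh z \<bullet> ns k z $ i \<partial>Q) + (\<integral>z. r z \<bullet> ns k z $ i \<partial>Q)"
      by (intro Bochner_Integration.integral_add square_integrable_inner dh r square_integrable_ns_nth)
    also have "(\<integral>z. dh z \<bullet> ns k z $ i \<partial>Q) = 0"
    proof (rule expectation_inner_ns_nth[OF dh])
      show "ignores (i, k) dh"
        unfolding dh_def[abs_def]
        by (rule ignores_compose2[of _ xh "xs k" "\<lambda>u X. grad i u - grad i (X $ i)"]) (auto simp: ign ignores_xs)
    qed
    finally have eq: "(\<integral>z. (Grad (xs (Suc k) z) - Grad (xs k z)) $ i \<bullet> ns k z $ i \<partial>Q)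
        = (\<integral>z. r z \<bullet> ns k z $ i \<partial>Q)" by simp
    have "- (\<alpha> * L) * \<sigma>\<^sup>2 \<le> - (\<alpha> * L) * (\<integral>z. (norm (ns k z $ i))\<^sup>2 \<partial>Q)"
      using \<alpha>_pos L_pos expectation_norm_ns_nth[of k i] by (intro mult_left_mono_neg) auto
    also have "\<dots> = (\<integral>z. - (\<alpha> * L) * (norm (ns k z $ i))\<^sup>2 \<partial>Q)"
      by simp
    also have "\<dots> \<le> (\<integral>z. r z \<bullet> ns k z $ i \<partial>Q)"
    proof (intro integral_mono integrable_mult_right square_integrable_norm_power2 square_integrable_inner r
        square_integrable_ns_nth)
      fix z
      \<comment> \<open>Only the remainder \<open>r\<close> is correlated with the noise, and by the
        Lipschitz bound its norm is at most \<alpha> L times that of the noise.\<close>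
      have "norm (r z) \<le> L * norm (xs (Suc k) z $ i - xh z)" unfolding r_def by (rule grad_lipschitz)
      also have "\<dots> = L * (\<alpha> * W $ i $ i) * norm (ns k z $ i)"
        using \<alpha>_pos W_nonneg[of i i] by (simp add: xh_def abs_mult)
      also have "\<dots> \<le> L * (\<alpha> * 1) * norm (ns k z $ i)"
        using \<alpha>_pos L_pos W_le_1[of i i] by (intro mult_right_mono mult_left_mono) auto
      finally have "norm (r z) * norm (ns k z $ i) \<le> L * (\<alpha> * 1) * norm (ns k z $ i) * norm (ns k z $ i)"
        by (intro mult_right_mono) auto
      then show "- (\<alpha> * L) * (norm (ns k z $ i))\<^sup>2 \<le> r z \<bullet> ns k z $ i"
        using Cauchy_Schwarz_ineq2[of "r z" "ns k z $ i"] by (simp add: power2_eq_square mult_ac)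
    qed
    finally show ?thesis unfolding eq by simp
  qed
  have "- (\<alpha> * L * real CARD('n) * \<sigma>\<^sup>2) = (\<Sum>i\<in>(UNIV::'n set). - (\<alpha> * L * \<sigma>\<^sup>2))" by simp
  also have "\<dots> \<le> (\<Sum>i\<in>UNIV. \<integral>z. (Grad (xs (Suc k) z) - Grad (xs k z)) $ i \<bullet> ns k z $ i \<partial>Q)"
    by (intro sum_mono row)
  also have "\<dots> = (\<integral>z. (Grad (xs (Suc k) z) - Grad (xs k z)) \<bullet> ns k z \<partial>Q)"
    unfolding inner_vec_def[of "Grad _ - _"]
    by (rule Bochner_Integration.integral_sum[symmetric])
      (intro square_integrable_inner square_integrable_vec_nth square_integrable_diff square_integrable_Grad
        square_integrable_xs square_integrable_ns)
  finally show ?thesis .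
qed

text \<open>The new noise is orthogonal to everything determined before it, but the old noise is
  not: the two correlation bounds contribute 2 \<sigma>^2 and 2 \<alpha> L n \<sigma>^2, the second
  moments of old and new noise another 2 n \<sigma>^2.\<close>

lemma V3_Suc:
  "V3 (Suc k) \<le> 2 * \<alpha> * real CARD('n) * L^3 * V1 k
    + ((1 / beta L \<rho> \<alpha> + 2) * (dist_id W)\<^sup>2 * L\<^sup>2 + 3 * \<alpha> * L^3) * V2 k
    + (1 / 2) * (1 + \<rho>\<^sup>2) * V3 k + M_sigma (real CARD('n)) L \<alpha> \<sigma>"
proof -
  let ?n = "real CARD('n)"
  define b where "b z = consensus_error (W ** ys k z) + (Grad (xs (Suc k) z) - Grad (xs k z))" for z
  define v where "v z = b z - ns k z" for z
  have a_sq: "square_integrable Q (\<lambda>z. consensus_error (W ** ys k z))"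
    by (intro square_integrable_consensus_error square_integrable_matrix_mult square_integrable_ys)
  have \<delta>_sq: "square_integrable Q (\<lambda>z. Grad (xs (Suc k) z) - Grad (xs k z))"
    by (intro square_integrable_diff square_integrable_Grad square_integrable_xs)
  have b_sq: "square_integrable Q b"
    unfolding b_def[abs_def] by (rule square_integrable_add[OF a_sq \<delta>_sq])
  have v_sq: "square_integrable Q v"
    unfolding v_def[abs_def] by (rule square_integrable_diff[OF b_sq square_integrable_ns])
  note ns_sq = square_integrable_ns
  \<comment> \<open>Removing the average is an orthogonal projection: it fixes the mixed deviation
    and may be dropped from the gradient differences and noises at the cost of an
    inequality.\<close>
  have le: "(norm (consensus_error (ys (Suc k) z)))\<^sup>2
      \<le> (norm (v z))\<^sup>2 + 2 * (v z \<bullet> ns (Suc k) z) + (norm (ns (Suc k) z))\<^sup>2" for z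
  proof -
    have "consensus_error (consensus_error (W ** ys k z)) = consensus_error (W ** ys k z)"
      by (simp add: consensus_error_def row_avg_diff row_avg_const Finite_Cartesian_Product.vec_eq_iff)
    then have "consensus_error (ys (Suc k) z) = consensus_error (v z + ns (Suc k) z)"
      by (simp add: ys_Suc v_def b_def consensus_error_add consensus_error_diff algebra_simps)
    then have "norm (consensus_error (ys (Suc k) z)) \<le> norm (v z + ns (Suc k) z)"
      by (simp only: norm_consensus_error_le)
    then have "(norm (consensus_error (ys (Suc k) z)))\<^sup>2 \<le> (norm (v z + ns (Suc k) z))\<^sup>2"
      by (intro power_mono) auto
    then show ?thesis by (simp only: norm_power2_add)
  qed
  have "V3 (Suc k) \<le> (\<integral>z. (norm (v z))\<^sup>2 + 2 * (v z \<bullet> ns (Suc k) z) + (norm (ns (Suc k) z))\<^sup>2 \<partial>Q)"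
    unfolding V3_def
    by (intro integral_mono le integrable_V Bochner_Integration.integrable_add integrable_mult_right
        square_integrable_inner square_integrable_norm_power2 v_sq ns_sq)
  also have "\<dots> = (\<integral>z. (norm (v z))\<^sup>2 \<partial>Q) + 2 * (\<integral>z. v z \<bullet> ns (Suc k) z \<partial>Q) + (\<integral>z. (norm (ns (Suc k) z))\<^sup>2 \<partial>Q)"
    using square_integrable_inner[OF v_sq ns_sq] v_sq ns_sq by (simp add: square_integrable_norm_power2)
  also have "(\<integral>z. v z \<bullet> ns (Suc k) z \<partial>Q) = 0"
  proof (rule expectation_inner_ns[OF v_sq])
    fix i
    have "xs (Suc k) (z((i, Suc k) := c)) = xs (Suc k) z" "xs k (z((i, Suc k) := c)) = xs k z"
        "ys k (z((i, Suc k) := c)) = ys k z" "ns k (z((i, Suc k) := c)) = ns k z" for z c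
      using ignores_xs[of "Suc k" "Suc k" i] ignores_xs[of k "Suc k" i] ignores_ys[of k "Suc k" i]
        ignores_ns[of k "Suc k" i] by (simp_all add: ignores_def)
    then show "ignores (i, Suc k) (\<lambda>z. v z $ i)"
      unfolding ignores_def v_def b_def by presburger
  qed
  also have "(\<integral>z. (norm (v z))\<^sup>2 \<partial>Q) = (\<integral>z. (norm (b z))\<^sup>2 - 2 * (consensus_error (W ** ys k z) \<bullet> ns k z)
      - 2 * ((Grad (xs (Suc k) z) - Grad (xs k z)) \<bullet> ns k z) + (norm (ns k z))\<^sup>2 \<partial>Q)"
  proof (rule Bochner_Integration.integral_cong[OF refl])
    fix z
    have "(norm (v z))\<^sup>2 = (norm (b z + - ns k z))\<^sup>2" by (simp add: v_def)
    also have "\<dots> = (norm (b z))\<^sup>2 - 2 * (b z \<bullet> ns k z) + (norm (ns k z))\<^sup>2"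
      unfolding norm_power2_add by simp
    also have "b z \<bullet> ns k z = consensus_error (W ** ys k z) \<bullet> ns k z + (Grad (xs (Suc k) z) - Grad (xs k z)) \<bullet> ns k z"
      unfolding b_def by (rule inner_add_left)
    finally show "(norm (v z))\<^sup>2 = (norm (b z))\<^sup>2 - 2 * (consensus_error (W ** ys k z) \<bullet> ns k z)
      - 2 * ((Grad (xs (Suc k) z) - Grad (xs k z)) \<bullet> ns k z) + (norm (ns k z))\<^sup>2" by simp
  qed
  also have "\<dots> = (\<integral>z. (norm (b z))\<^sup>2 \<partial>Q) - 2 * (\<integral>z. consensus_error (W ** ys k z) \<bullet> ns k z \<partial>Q)
      - 2 * (\<integral>z. (Grad (xs (Suc k) z) - Grad (xs k z)) \<bullet> ns k z \<partial>Q) + (\<integral>z. (norm (ns k z))\<^sup>2 \<partial>Q)"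
    using square_integrable_inner[OF a_sq ns_sq[of k]] square_integrable_inner[OF \<delta>_sq ns_sq[of k]]
      square_integrable_norm_power2[OF b_sq] square_integrable_norm_power2[OF ns_sq[of k]]
    by simp
  also have "(\<integral>z. (norm (b z))\<^sup>2 \<partial>Q) \<le> (\<integral>z. (1 / 2) * (1 + \<rho>\<^sup>2) * (norm (consensus_error (ys k z)))\<^sup>2
      + (1 / beta L \<rho> \<alpha> + 2) * (dist_id W)\<^sup>2 * L\<^sup>2 * (norm (consensus_error (xs k z)))\<^sup>2
      + (\<alpha>\<^sup>2 * L\<^sup>2 + \<alpha> * L / 2) * (?n * (norm (row_avg (ys k z)))\<^sup>2) \<partial>Q)"
    unfolding b_def xs_Suc
    by (intro integral_mono tracking_pointwise integrable_V Bochner_Integration.integrable_add integrable_mult_right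
        square_integrable_norm_power2 b_sq[unfolded b_def[abs_def] xs_Suc] square_integrable_row_avg square_integrable_ys)
  also have "\<dots> = (1 / 2) * (1 + \<rho>\<^sup>2) * V3 k + (1 / beta L \<rho> \<alpha> + 2) * (dist_id W)\<^sup>2 * L\<^sup>2 * V2 k
      + (\<alpha>\<^sup>2 * L\<^sup>2 + \<alpha> * L / 2) * (?n * (\<integral>z. (norm (row_avg (ys k z)))\<^sup>2 \<partial>Q))"
    unfolding V2_def V3_def
    by (simp only: Bochner_Integration.integral_add Bochner_Integration.integrable_add integrable_mult_right
        integrable_V integral_mult_right_zero square_integrable_norm_power2 square_integrable_row_avg square_integrable_ys)
  also have "(\<alpha>\<^sup>2 * L\<^sup>2 + \<alpha> * L / 2) * (?n * (\<integral>z. (norm (row_avg (ys k z)))\<^sup>2 \<partial>Q))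
      \<le> (\<alpha>\<^sup>2 * L\<^sup>2 + \<alpha> * L / 2) * (2 * L\<^sup>2 * V2 k + 2 * ?n * L\<^sup>2 * V1 k + \<sigma>\<^sup>2)"
    using \<alpha>_pos L_pos by (intro mult_left_mono expectation_row_avg_ys) auto
  finally have main: "V3 (Suc k) \<le> (1 / 2) * (1 + \<rho>\<^sup>2) * V3 k + (1 / beta L \<rho> \<alpha> + 2) * (dist_id W)\<^sup>2 * L\<^sup>2 * V2 k
      + (\<alpha>\<^sup>2 * L\<^sup>2 + \<alpha> * L / 2) * (2 * L\<^sup>2 * V2 k + 2 * ?n * L\<^sup>2 * V1 k + \<sigma>\<^sup>2)
      + 2 * \<sigma>\<^sup>2 + 2 * (\<alpha> * L * ?n * \<sigma>\<^sup>2) + 2 * (?n * \<sigma>\<^sup>2)"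
    using tracking_noise_correlation[of k] gradient_noise_correlation[of k] expectation_norm_ns[of k]
      expectation_norm_ns[of "Suc k"] by linarith
  have V: "0 \<le> V1 k" "0 \<le> V2 k" by (simp_all add: V1_def V2_def)
  define s where "s = \<alpha> * L"
  have s: "0 < s" "s \<le> 1 / 2" using \<alpha>_pos L_pos \<alpha>L by (simp_all add: s_def)
  \<comment> \<open>Hence s^2 + s/2 <= s, which gives the entry 2 \<alpha> n L^3 and, with slack,
    the term 3 \<alpha> L^3.\<close>
  then have ss: "s * s \<le> s / 2" using mult_left_mono[of s "1 / 2" s] by simp
  have coeff: "\<alpha>\<^sup>2 * L\<^sup>2 + \<alpha> * L / 2 = s * s + s / 2" by (simp add: s_def power2_eq_square)
  have "(s * s + s / 2) * (2 * L\<^sup>2 * V2 k) \<le> (3 / 2 * s) * (2 * L\<^sup>2 * V2 k)"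
    using ss s V by (intro mult_right_mono) auto
  also have "\<dots> = 3 * \<alpha> * L^3 * V2 k" by (simp add: s_def power2_eq_square power3_eq_cube)
  finally have c2: "(s * s + s / 2) * (2 * L\<^sup>2 * V2 k) \<le> 3 * \<alpha> * L^3 * V2 k" .
  have "(s * s + s / 2) * (2 * ?n * L\<^sup>2 * V1 k) \<le> s * (2 * ?n * L\<^sup>2 * V1 k)"
    using ss V by (intro mult_right_mono) auto
  also have "\<dots> = 2 * \<alpha> * ?n * L^3 * V1 k" by (simp add: s_def power2_eq_square power3_eq_cube)
  finally have c1: "(s * s + s / 2) * (2 * ?n * L\<^sup>2 * V1 k) \<le> 2 * \<alpha> * ?n * L^3 * V1 k" .
  \<comment> \<open>Enlarged to 3 s^2 + 2 s, this combines with 2 + 2 s n + 2 n into 3 s^2 + 2 (s +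
    1)(n + 1), the bracket of \<open>M_sigma\<close>.\<close>
  have "(s * s + s / 2) * \<sigma>\<^sup>2 \<le> (3 * (s * s) + 2 * s) * \<sigma>\<^sup>2"
    using s by (intro mult_right_mono) auto
  then have c0: "(s * s + s / 2) * \<sigma>\<^sup>2 + 2 * \<sigma>\<^sup>2 + 2 * (\<alpha> * L * ?n * \<sigma>\<^sup>2) + 2 * (?n * \<sigma>\<^sup>2) \<le> M_sigma ?n L \<alpha> \<sigma>"
    by (simp add: M_sigma_def s_def power2_eq_square algebra_simps)
  show ?thesis
    using main c0 c1 c2 unfolding coeff by (simp only: distrib_left distrib_right)
qed

end

section \<open>Solving the recursion and transfer to the given probability space\<close>

lemma A_mat_carrier: "A_mat n \<mu> L rw d \<alpha> \<in> carrier_mat 3 3"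
  by (rule carrier_matI) (simp_all add: A_mat_def mat_of_rows_list_def)

lemma A_mat_entries:
  "A_mat n \<mu> L rw d \<alpha> $$ (0, 0) = 1 - \<alpha> * \<mu>"
  "A_mat n \<mu> L rw d \<alpha> $$ (0, Suc 0) = (\<alpha> * L\<^sup>2 / (\<mu> * n)) * (1 + \<alpha> * \<mu>)"
  "A_mat n \<mu> L rw d \<alpha> $$ (0, Suc (Suc 0)) = 0"
  "A_mat n \<mu> L rw d \<alpha> $$ (Suc 0, 0) = 0"
  "A_mat n \<mu> L rw d \<alpha> $$ (Suc 0, Suc 0) = (1/2) * (1 + rw\<^sup>2)"
  "A_mat n \<mu> L rw d \<alpha> $$ (Suc 0, Suc (Suc 0)) = \<alpha>\<^sup>2 * ((1 + rw\<^sup>2) * rw\<^sup>2 / (1 - rw\<^sup>2))"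
  "A_mat n \<mu> L rw d \<alpha> $$ (Suc (Suc 0), 0) = 2 * \<alpha> * n * L^3"
  "A_mat n \<mu> L rw d \<alpha> $$ (Suc (Suc 0), Suc 0) = (1 / beta L rw \<alpha> + 2) * d\<^sup>2 * L\<^sup>2 + 3 * \<alpha> * L^3"
  "A_mat n \<mu> L rw d \<alpha> $$ (Suc (Suc 0), Suc (Suc 0)) = (1/2) * (1 + rw\<^sup>2)"
  by (simp_all add: A_mat_def mat_of_rows_list_def)

lemma (in dsgt_process) V_bounds:
  assumes \<Gamma>: "1 < \<Gamma>" and bound: "\<alpha> \<le> step_bound \<mu> L \<rho> (dist_id W) \<Gamma>"
  defines "n \<equiv> real CARD('n)"
  defines "\<kappa> \<equiv> rho_A n \<mu> L \<rho> (dist_id W) \<alpha>"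
  obtains C where "0 < C" "0 < \<kappa>" "\<kappa> < 1"
    "\<And>k. V1 k \<le> R1 n \<mu> L \<rho> \<alpha> \<sigma> \<Gamma> + C * \<kappa> ^ k" "\<And>k. V2 k \<le> R2 n \<mu> L \<rho> \<alpha> \<sigma> \<Gamma> + C * \<kappa> ^ k"
proof -
  define a b p q r s where "a = 1 - \<alpha> * \<mu>" and "b = (1/2) * (1 + \<rho>\<^sup>2)"
    and "p = (\<alpha> * L\<^sup>2 / (\<mu> * n)) * (1 + \<alpha> * \<mu>)" and "q = \<alpha>\<^sup>2 * ((1 + \<rho>\<^sup>2) * \<rho>\<^sup>2 / (1 - \<rho>\<^sup>2))"
    and "r = 2 * \<alpha> * n * L^3" and "s = (1 / beta L \<rho> \<alpha> + 2) * (dist_id W)\<^sup>2 * L\<^sup>2 + 3 * \<alpha> * L^3"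
  define e1 e3 where "e1 = \<alpha>\<^sup>2 * \<sigma>\<^sup>2 / n" and "e3 = M_sigma n L \<alpha> \<sigma>"
  have d: "0 \<le> dist_id W" by (simp add: dist_id_def)
  have n: "0 < n" by (simp add: n_def)
  have \<rho>2: "0 < \<rho>\<^sup>2" "\<rho>\<^sup>2 < 1" using \<rho>_pos \<rho>_lt_1 by (simp_all add: power_less_one_iff)
  have a: "0 \<le> a" "a < 1" using \<alpha>\<mu> by (simp_all add: a_def)
  have b: "0 \<le> b" "b < 1" using \<rho>2 by (simp_all add: b_def)
  have pqr: "0 < p" "0 < q" "0 < r"
    using n \<rho>2 \<alpha>_pos \<mu>_pos L_pos by (simp_all add: p_def q_def r_def add_pos_pos)
  have s: "0 \<le> s" using beta_pos \<alpha>_pos L_pos by (simp add: s_def)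
  have e: "0 \<le> e1" "0 \<le> e3" using n \<alpha>_pos L_pos by (simp_all add: e1_def e3_def M_sigma_def)
  note sb = \<mu>_pos avg.\<mu>_le_L \<rho>_pos \<rho>_lt_1 d \<Gamma> \<alpha>_pos bound
  have qs: "q * s \<le> (1 - b)\<^sup>2 / \<Gamma>"
    unfolding q_def s_def b_def by (rule step_bound_qs[OF sb])
  have pqr_le: "p * q * r \<le> (1 - a) * (\<Gamma> - 1) / (\<Gamma> * (\<Gamma> + 1)) * (1 - b)\<^sup>2"
    unfolding p_def q_def r_def a_def b_def by (rule step_bound_pqr[OF sb n])
  obtain s1 s2 s3 where fp:
    "a * s1 + p * s2 + e1 = s1" "b * s2 + q * s3 = s2" "r * s1 + s * s2 + b * s3 + e3 = s3"
    and s1: "s1 \<le> (\<Gamma> + 1) / \<Gamma> * (e1 / (1 - a)) + (\<Gamma> + 1) / (\<Gamma> - 1) * (p * q * e3 / ((1 - a) * (1 - b)\<^sup>2))"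
    and s2: "s2 \<le> (\<Gamma> + 1) / (\<Gamma> - 1) * (q * (r * e1 + (1 - a) * e3) / ((1 - a) * (1 - b)\<^sup>2))"
    and det: "p * q * r < (1 - a) * ((1 - b)\<^sup>2 - q * s)"
    using fixed_point_bound_3[OF a(2) b(2) pqr s e \<Gamma> qs pqr_le] by blast
  obtain x w1 w2 w3 where x: "a < x" "b < x" "x < 1" and w: "0 < w1" "0 < w2" "0 < w3"
    and ev: "a * w1 + p * w2 = x * w1" "b * w2 + q * w3 = x * w2" "r * w1 + s * w2 + b * w3 = x * w3"
    using positive_eigenvector_3[OF a(2) b(2) pqr s det] by blast
  \<comment> \<open>This is the origin of the factor 4 in \<open>R1\<close> and \<open>R2\<close>;
    with the denominator of \<open>q\<close> it makes the cube of 1 - \<rho>^2.\<close>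
  have b2: "(1 - b)\<^sup>2 = (1 - \<rho>\<^sup>2)\<^sup>2 / 4" by (simp add: b_def power2_eq_square field_simps)
  have \<kappa>: "\<kappa> = x"
    unfolding \<kappa>_def rho_A_def
  proof (rule spectral_radius_eq_positive_eigenvalue[where m = 3 and w = "\<lambda>i. [w1, w2, w3] ! i"])
    let ?A = "A_mat n \<mu> L \<rho> (dist_id W) \<alpha>"
    note entries = A_mat_entries[of n \<mu> L \<rho> "dist_id W" \<alpha>,
        folded a_def p_def b_def q_def r_def s_def]
    have three: "i < 3 \<longleftrightarrow> i = 0 \<or> i = Suc 0 \<or> i = Suc (Suc 0)" for i :: nat by auto
    show "0 \<le> ?A $$ (i, j)" if "i < 3" "j < 3" for i j
      using that a b pqr s unfolding three by (auto simp: entries)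
    show "0 < [w1, w2, w3] ! i" if "i < 3" for i
      using that w unfolding three by auto
    show "(\<Sum>j<3. ?A $$ (i, j) * [w1, w2, w3] ! j) = x * [w1, w2, w3] ! i" if "i < 3" for i
      using that ev unfolding three by (auto simp: entries numeral_3_eq_3)
  qed (simp_all add: A_mat_carrier)
  obtain C where C: "0 < C" "\<And>k. V1 k \<le> s1 + C * x ^ k" "\<And>k. V2 k \<le> s2 + C * x ^ k"
  proof (rule affine_recursion_3[of a b p q r s w1 w2 w3 x s1 s2 e1 s3 e3 V1 V2 V3])
    show "V1 (Suc k) \<le> a * V1 k + p * V2 k + e1" for k
      using V1_Suc[of k] by (simp add: a_def p_def e1_def n_def)
    show "V2 (Suc k) \<le> b * V2 k + q * V3 k" for k
      using V2_Suc[of k] by (simp add: b_def q_def)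
    show "V3 (Suc k) \<le> r * V1 k + s * V2 k + b * V3 k + e3" for k
      using V3_Suc[of k] by (simp only: r_def s_def b_def e3_def n_def)
  qed (use a b pqr s w ev fp in auto)
  have s1_le: "s1 \<le> R1 n \<mu> L \<rho> \<alpha> \<sigma> \<Gamma>"
  proof -
    have "e1 / (1 - a) = \<alpha> * \<sigma>\<^sup>2 / (\<mu> * n)"
      using \<alpha>_pos by (simp add: e1_def a_def power2_eq_square)
    moreover have "p * q * e3 / ((1 - a) * (1 - b)\<^sup>2)
      = 4 * \<alpha>\<^sup>2 * L\<^sup>2 * (1 + \<alpha> * \<mu>) * (1 + \<rho>\<^sup>2) * \<rho>\<^sup>2 / (\<mu>\<^sup>2 * n * (1 - \<rho>\<^sup>2)^3) * e3"
    proof -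
      have "\<alpha> * L\<^sup>2 / (\<mu> * n) * m * (\<alpha>\<^sup>2 * (t1 * t2 / D)) * e3 / ((1 - (1 - \<alpha> * \<mu>)) * (D\<^sup>2 / 4))
        = 4 * \<alpha>\<^sup>2 * L\<^sup>2 * m * t1 * t2 / (\<mu>\<^sup>2 * n * D^3) * e3" for m t1 t2 D
        using \<alpha>_pos by (simp add: power2_eq_square power3_eq_cube mult_ac)
      then show ?thesis unfolding p_def q_def a_def b2 .
    qed
    ultimately show ?thesis using s1 by (simp add: R1_def e3_def)
  qed
  have s2_le: "s2 \<le> R2 n \<mu> L \<rho> \<alpha> \<sigma> \<Gamma>"
  proof -
    have "q * (r * e1 + (1 - a) * e3) / ((1 - a) * (1 - b)\<^sup>2)
      = 4 * \<alpha>\<^sup>2 * (1 + \<rho>\<^sup>2) * \<rho>\<^sup>2 * (2 * \<alpha>\<^sup>2 * L^3 * \<sigma>\<^sup>2 + \<mu> * e3) / (\<mu> * (1 - \<rho>\<^sup>2)^3)"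
    proof -
      have "\<alpha>\<^sup>2 * (t1 * t2 / D) * (2 * \<alpha> * n * L^3 * (\<alpha>\<^sup>2 * \<sigma>\<^sup>2 / n) + (1 - (1 - \<alpha> * \<mu>)) * e3) / ((1 - (1 - \<alpha> * \<mu>)) * (D\<^sup>2 / 4))
        = 4 * \<alpha>\<^sup>2 * t1 * t2 * (2 * \<alpha>\<^sup>2 * L^3 * \<sigma>\<^sup>2 + \<mu> * e3) / (\<mu> * D^3)" for t1 t2 D
      proof -
        have "2 * \<alpha> * n * L^3 * (\<alpha>\<^sup>2 * \<sigma>\<^sup>2 / n) + (1 - (1 - \<alpha> * \<mu>)) * e3
            = \<alpha> * (2 * \<alpha>\<^sup>2 * L^3 * \<sigma>\<^sup>2 + \<mu> * e3)"
          using n by (simp add: distrib_left mult_ac)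
        moreover have "\<alpha>\<^sup>2 * (t1 * t2 / D) * (\<alpha> * x) / ((1 - (1 - \<alpha> * \<mu>)) * (D\<^sup>2 / 4))
            = 4 * \<alpha>\<^sup>2 * t1 * t2 * x / (\<mu> * D^3)" for x
          using \<alpha>_pos by (simp add: power2_eq_square power3_eq_cube mult_ac)
        ultimately show ?thesis by simp
      qed
      then show ?thesis unfolding q_def r_def e1_def a_def b2 .
    qed
    then show ?thesis using s2 by (simp add: R2_def e3_def)
  qed
  show ?thesis
  proof (rule that[OF C(1)])
    show "0 < \<kappa>" "\<kappa> < 1" using x a by (simp_all add: \<kappa>)
    show "V1 k \<le> R1 n \<mu> L \<rho> \<alpha> \<sigma> \<Gamma> + C * \<kappa> ^ k" for k using C(2)[of k] s1_le by (simp add: \<kappa>)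
    show "V2 k \<le> R2 n \<mu> L \<rho> \<alpha> \<sigma> \<Gamma> + C * \<kappa> ^ k" for k using C(3)[of k] s2_le by (simp add: \<kappa>)
  qed
qed

theorem theorem1:
  fixes M :: "'a measure"
    and f :: "'n::finite \<Rightarrow> real^'p::finite \<Rightarrow> real"
    and grad :: "'n \<Rightarrow> real^'p \<Rightarrow> real^'p"
    and g :: "'n \<Rightarrow> real^'p \<Rightarrow> real^'m::finite \<Rightarrow> real^'p"
    and D :: "'n \<Rightarrow> (real^'m) measure"
    and \<xi> :: "'n \<Rightarrow> nat \<Rightarrow> 'a \<Rightarrow> real^'m"
    and E :: "('n \<times> 'n) set"
    and W :: "real^'n^'n"
    and x0 :: "real^'p^'n"
    and x :: "nat \<Rightarrow> 'a \<Rightarrow> real^'p^'n"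
    and xstar :: "real^'p"
    and n \<mu> L \<sigma> \<Gamma> \<alpha> rw d \<rho> :: real
  assumes "prob_space M"
    and "0 < \<mu>" and "0 < L" and "0 < \<sigma>"
    and "\<And>i u. GDERIV (f i) u :> grad i u"
    and "\<And>i u v. inner (grad i u - grad i v) (u - v) \<ge> \<mu> * (norm (u - v))\<^sup>2"
    and "\<And>i u v. norm (grad i u - grad i v) \<le> L * norm (u - v)"
    and "stochastic_oracle D g grad \<sigma>"
    and "\<And>i k. distr M borel (\<xi> i k) = D i"
    and "prob_space.indep_vars M (\<lambda>_. borel) (\<lambda>(i, k). \<xi> i k) UNIV"
    and "connected_graph E" and "mixing_matrix E W"
    and "0 < rho_w W" and "rho_w W < 1"
    and "1 < \<Gamma>"
    and "0 < \<alpha>" and "\<alpha> \<le> step_bound \<mu> L (rho_w W) (dist_id W) \<Gamma>"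
  defines "n \<equiv> real CARD('n)"
    and "rw \<equiv> rho_w W"
    and "d \<equiv> dist_id W"
    and "\<rho> \<equiv> rho_A n \<mu> L rw d \<alpha>"
    and "xstar \<equiv> minimizer f"
    and "x \<equiv> (\<lambda>k \<omega>. fst (dsgt W g \<alpha> x0 (\<lambda>i l. \<xi> i l \<omega>) k))"
  shows "\<rho> < 1 \<and>
    (\<exists>C>0. \<forall>k.
       (SUP l\<in>{k..}. \<integral>\<^sup>+\<omega>. ennreal ((norm (row_avg (x l \<omega>) - xstar))\<^sup>2) \<partial>M)
         \<le> ennreal (R1 n \<mu> L rw \<alpha> \<sigma> \<Gamma> + C * \<rho> ^ k) \<and>
       (SUP l\<in>{k..}. \<integral>\<^sup>+\<omega>. ennreal ((norm (consensus_error (x (l + 1) \<omega>)))\<^sup>2) \<partial>M)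
         \<le> ennreal (R2 n \<mu> L rw \<alpha> \<sigma> \<Gamma> + C * \<rho> ^ k)) \<and>
    limsup (\<lambda>k. \<integral>\<^sup>+\<omega>. ennreal ((norm (row_avg (x k \<omega>) - xstar))\<^sup>2) \<partial>M)
      \<le> ennreal (R1 n \<mu> L rw \<alpha> \<sigma> \<Gamma>) \<and>
    limsup (\<lambda>k. \<integral>\<^sup>+\<omega>. ennreal ((norm (consensus_error (x k \<omega>)))\<^sup>2) \<partial>M)
      \<le> ennreal (R2 n \<mu> L rw \<alpha> \<sigma> \<Gamma>)"
proof -
  interpret M: prob_space M by fact
  have orc: "prob_space (D i)" "sets (D i) = sets borel"
    "(\<lambda>(u, c). g i u c) \<in> borel_measurable (borel \<Otimes>\<^sub>M borel)"
    "integrable (D i) (g i u)" "(\<integral>c. g i u c \<partial>D i) = grad i u"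
    "(\<integral>\<^sup>+c. ennreal ((norm (g i u c - grad i u))\<^sup>2) \<partial>D i) \<le> ennreal (\<sigma>\<^sup>2)" for i u
    using assms(8) unfolding stochastic_oracle_def by blast+
  have cost: "strongly_convex_smooth (f i) (grad i) \<mu> L" for i
    unfolding strongly_convex_smooth_def using assms(2,5,6,7) by blast
  have \<mu>L: "\<mu> \<le> L" by (rule strongly_convex_smooth.\<mu>_le_L[OF cost])
  have d: "0 \<le> dist_id W" by (simp add: dist_id_def)
  note sb = assms(2) \<mu>L assms(13,14) d assms(15,16,17)
  have grad_meas: "grad i \<in> borel_measurable borel" for i
  proof (rule borel_measurable_continuous_onI)
    have "L-lipschitz_on UNIV (grad i)"
      using assms(3,7) by (intro lipschitz_onI) (auto simp: dist_norm)
    then show "continuous_on UNIV (grad i)" by (rule lipschitz_on_continuous_on)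
  qed
  interpret dsgt_process E W D g grad \<sigma> f \<mu> L \<alpha> x0
    by (intro dsgt_process.intro mixing.intro oracle_noise.intro noise_product.intro
        oracle_noise_axioms.intro dsgt_process_axioms.intro)
      (fact assms(12) orc grad_meas cost assms(3,16,13,14) step_bound_small[OF sb] step_bound_beta[OF sb])+
  define Z where "Z \<omega> p = \<xi> (fst p) (snd p) \<omega>" for \<omega> p
  have \<xi>: "(\<lambda>(i, k). \<xi> i k) p \<in> borel_measurable M" for p
    using assms(10) unfolding M.indep_vars_def by (cases p) auto
  \<comment> \<open>Independence says that the joint law of all samples is the product of their
    laws, so every expectation can be computed on \<open>Q\<close>.\<close>
  have distr_Z: "distr M (PiM UNIV (\<lambda>_. borel)) Z = Q"
  proof -
    have "distr M (PiM UNIV (\<lambda>_. borel)) (\<lambda>\<omega>. \<lambda>p\<in>UNIV. (\<lambda>(i, k). \<xi> i k) p \<omega>)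
        = PiM UNIV (\<lambda>p. distr M borel ((\<lambda>(i, k). \<xi> i k) p))"
      using assms(10) \<xi> by (subst (asm) M.indep_vars_iff_distr_eq_PiM) auto
    also have "\<dots> = Q"
      unfolding Q_def using assms(9) by (simp add: case_prod_unfold)
    finally show ?thesis by (simp add: Z_def[abs_def] case_prod_unfold restrict_UNIV)
  qed
  have Z: "Z \<in> measurable M Q"
  proof -
    have "Z \<in> measurable M (PiM UNIV (\<lambda>_. borel))"
      using \<xi> by (intro measurable_PiM_single') (auto simp: Z_def case_prod_unfold)
    then show ?thesis by (simp cong: measurable_cong_sets add: sets_Q)
  qed
  have transfer: "(\<integral>\<^sup>+\<omega>. h (Z \<omega>) \<partial>M) = (\<integral>\<^sup>+z. h z \<partial>Q)" if "h \<in> borel_measurable Q" for h :: "_ \<Rightarrow> ennreal"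
  proof -
    \<comment> \<open>The product of Borel spaces and \<open>Q\<close> have the same measurable sets
      but are different measures, so the target of \<open>distr\<close> is exchanged.\<close>
    have "distr M Q Z = Q" unfolding distr_Z[symmetric] by (rule distr_cong) (auto simp: sets_Q)
    then show ?thesis using nn_integral_distr[of Z M Q h] Z that by simp
  qed
  have x_eq: "x k \<omega> = xs k (Z \<omega>)" for k \<omega>
    by (simp add: x_def xs_def Z_def)
  have E1: "(\<integral>\<^sup>+\<omega>. ennreal ((norm (row_avg (x k \<omega>) - xstar))\<^sup>2) \<partial>M) = ennreal (V1 k)" for k
  proof -
    have "(\<integral>\<^sup>+\<omega>. ennreal ((norm (row_avg (x k \<omega>) - xstar))\<^sup>2) \<partial>M)
        = (\<integral>\<^sup>+z. ennreal ((norm (row_avg (xs k z) - xstar))\<^sup>2) \<partial>Q)"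
      unfolding x_eq
      by (rule transfer[of "\<lambda>z. ennreal ((norm (row_avg (xs k z) - xstar))\<^sup>2)"])
        (use square_integrable_measurable[OF square_integrable_u[of k]] in \<open>simp add: xstar_def\<close>)
    also have "\<dots> = ennreal (V1 k)"
      unfolding V1_def xstar_def by (intro nn_integral_eq_integral integrable_V) auto
    finally show ?thesis .
  qed
  have E2: "(\<integral>\<^sup>+\<omega>. ennreal ((norm (consensus_error (x k \<omega>)))\<^sup>2) \<partial>M) = ennreal (V2 k)" for k
  proof -
    have "(\<integral>\<^sup>+\<omega>. ennreal ((norm (consensus_error (x k \<omega>)))\<^sup>2) \<partial>M)
        = (\<integral>\<^sup>+z. ennreal ((norm (consensus_error (xs k z)))\<^sup>2) \<partial>Q)"
      unfolding x_eq
      by (rule transfer[of "\<lambda>z. ennreal ((norm (consensus_error (xs k z)))\<^sup>2)"])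
        (use square_integrable_measurable[OF square_integrable_consensus_error[OF square_integrable_xs[of k]]] in simp)
    also have "\<dots> = ennreal (V2 k)"
      unfolding V2_def by (intro nn_integral_eq_integral integrable_V) auto
    finally show ?thesis .
  qed
  obtain C where C: "0 < C" "0 < \<rho>" "\<rho> < 1"
    "\<And>k. V1 k \<le> R1 n \<mu> L rw \<alpha> \<sigma> \<Gamma> + C * \<rho> ^ k" "\<And>k. V2 k \<le> R2 n \<mu> L rw \<alpha> \<sigma> \<Gamma> + C * \<rho> ^ k"
    using V_bounds[OF assms(15,17)] unfolding n_def rw_def d_def \<rho>_def by blast
  \<comment> \<open>As 0 < \<rho> < 1, the bound at any time l >= k is at most the bound at
    k.\<close>
  have sup: "(SUP l\<in>{k..}. ennreal (v l)) \<le> ennreal (R + C * \<rho> ^ k)"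
    if "\<And>l. v l \<le> R + C * \<rho> ^ l" for v :: "nat \<Rightarrow> real" and R k
  proof (rule SUP_least)
    fix l assume "l \<in> {k..}"
    then have "C * \<rho> ^ l \<le> C * \<rho> ^ k" using C by (intro mult_left_mono power_decreasing) auto
    then show "ennreal (v l) \<le> ennreal (R + C * \<rho> ^ k)"
      using that[of l] by (intro ennreal_leI) linarith
  qed
  have lim: "limsup (\<lambda>k. ennreal (v k)) \<le> ennreal R"
    if "\<And>l. v l \<le> R + C * \<rho> ^ l" for v :: "nat \<Rightarrow> real" and R
  proof -
    have "limsup (\<lambda>k. ennreal (v k)) \<le> limsup (\<lambda>k. ennreal (R + C * \<rho> ^ k))"
      using that by (intro Limsup_mono always_eventually allI ennreal_leI) auto
    also have "(\<lambda>k. R + C * \<rho> ^ k) \<longlonglongrightarrow> R + C * 0"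
      using C by (intro tendsto_intros LIMSEQ_power_zero) auto
    then have "limsup (\<lambda>k. ennreal (R + C * \<rho> ^ k)) = ennreal R"
      by (intro lim_imp_Limsup tendsto_ennrealI) auto
    finally show ?thesis .
  qed
  \<comment> \<open>The consensus supremum is shifted by one step; the extra factor \<rho> < 1 is
    dropped, so the same \<open>C\<close> serves both bounds.\<close>
  have "V2 (l + 1) \<le> R2 n \<mu> L rw \<alpha> \<sigma> \<Gamma> + C * \<rho> ^ l" for l
  proof -
    have "C * \<rho> ^ (l + 1) \<le> C * \<rho> ^ l" using C by (intro mult_left_mono power_decreasing) auto
    then show ?thesis using C(5)[of "l + 1"] by linarith
  qed
  then have "\<forall>k. (SUP l\<in>{k..}. ennreal (V1 l)) \<le> ennreal (R1 n \<mu> L rw \<alpha> \<sigma> \<Gamma> + C * \<rho> ^ k) \<and>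
      (SUP l\<in>{k..}. ennreal (V2 (l + 1))) \<le> ennreal (R2 n \<mu> L rw \<alpha> \<sigma> \<Gamma> + C * \<rho> ^ k)"
    by (intro allI conjI sup C(4))
  then show ?thesis
    unfolding E1 E2 by (intro conjI exI[of _ C] C(1,3) lim C(4,5))
qed

end
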